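(* (1) There exist $\Pi^0_1$ sets $P,Q\subseteq 2^{\mathbb N}$ such that $P\triangledown_\omega Q<^1_{<\omega}P\triangledown Q$. (2) There exist $\Pi^0_1$ sets $P,Q\subseteq 2^{\mathbb N}$ such that $P\equiv^1_{\omega|<\omega}Q$ and $P<^1_{<\omega}Q$.
   Context: Learnability reducibilities. Let $\{\Phi_e\}_{e\in\mathbb N}$ be an effective enumeration of all partial computable functions $\Phi_e:\subseteq\mathbb N^{\mathbb N}\to\mathbb N^{\mathbb N}$. A learner is a total computable function $\Psi:\mathbb N^{<\mathbb N}\to\mathbb N$. A partial function $\Gamma:\subseteq\mathbb N^{\mathbb N}\to\mathbb N^{\mathbb N}$ is identified by $\Psi$ if for every $g\in\mathrm{dom}(\Gamma)$ the limit $\lim_n\Psi(g\upharpoonright n)$ exists and $\Phi_{\lim_n\Psi(g\upharpoonright n)}(g)=\Gamma(g)$. $\Gamma$ is $(1,<\omega)$-computable if it is identified by a learner $\Psi$ for which $\sup_{g\in\mathrm{dom}(\Gamma)}\#\{n:\Psi(g\upharpoonright (n+1))\neq\Psi(g\upharpoonright n)\}<\omega$. $\Gamma$ is $(1,\omega|<\omega)$-computable if it is identified by a learner $\Psi$ for which $\sup_{g\in\mathrm{dom}(\Gamma)}\#\{\Psi(g\upharpoonright n):n\in\mathbb N\}<\omega$. For $A,B\subseteq\mathbb N^{\mathbb N}$, $A\le^1_{<\omega}B$ (resp. $A\le^1_{\omega|<\omega}B$) means there is a $(1,<\omega)$-computable (resp. $(1,\omega|<\omega)$-computable) partial function $\Gamma$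 with $B\subseteq\mathrm{dom}(\Gamma)$ and $\Gamma(g)\in A$ for every $g\in B$. $A<B$ means $A\le B$ and $B\not\le A$; $A\equiv B$ means $A\le B$ and $B\le A$. Disjunction operations. With each $\Pi^0_1$ set $P\subseteq 2^{\mathbb N}$ (given by an index) a corresponding computable tree $T_P\subseteq2^{<\mathbb N}$ with $[T_P]=P$ is fixed, and $L_P$ is the set of leaves (dead ends) of $T_P$. The concatenation is $P^\frown Q=P\cup\bigcup_{\rho\in L_P}\rho^\frown Q$, where $\rho^\frown Q=\{\rho^\frown f:f\in Q\}$; the coproduct is $A\oplus B=(\langle0\rangle^\frown A)\cup(\langle1\rangle^\frown B)$; the commutative concatenation is $P\triangledown Q=(P^\frown Q)\oplus(Q^\frown P)$. For $f\in(\{0,1\}\times\mathbb N)^{\mathbb N}$ (or a finite sequence) and $i\in\{0,1\}$, $\mathrm{pr}_i(f)$ is the (finite or infinite) sequence of second coordinates of those entries of $f$ whose first coordinate is $i$, in order; $\mathrm{mc}(f)$ is the number of $n$ such that the first coordinates of $f(n)$ and $f(n+1)$ differ. Then, writing $P_0=P$, $P_1=Q$, the set $P\triangledown_\omega Q$ consists of all $f\in(\{0,1\}\times\mathbb N)^{\mathbb N}$ such that $\mathrm{pr}_i(f)\in P_i$ for some $i\in\{0,1\}$, $\mathrm{mc}(f)<\omega$, and $\mathrm{pr}_i(f\upharpoonright n)\in T_{P_i}$ for all $i\in\{0,1\}$ and all $n\in\mathbb N$. Via a standard computable pairing, $(\{0,1\}\times\mathbb N)^{\mathbb N}$ is viewed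 as a subset of $\mathbb N^{\mathbb N}$. *)

theory Defs
  imports Complex_Main "HOL-Library.Nat_Bijection" "HOL-Library.Infinite_Set"
begin

section \<open>Computability relative to an element of Baire space\<close>

text \<open>
  Programs denote partial functions from numbers to numbers.  Several arguments are passed
  through the pairing function \<^const>\<open>prod_encode\<close>, and \<open>Query\<close> asks for a value of the
  function \<open>g\<close> relative to which the program is run.
\<close>

datatype prog =
    Zero | Succ | Fst | Snd | Query
  | Pair prog prog
  | Comp prog prog
  | Prec prog prog
  | Search prog

primrec run :: "(nat \<Rightarrow> nat) \<Rightarrow> prog \<Rightarrow> nat \<Rightarrow> nat option" where
  "run g Zero = (\<lambda>x. Some 0)"
| "run g Succ = (\<lambda>x. Some (Suc x))"
| "run g Fst = (\<lambda>x. Some (fst (prod_decode x)))"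
| "run g Snd = (\<lambda>x. Some (snd (prod_decode x)))"
| "run g Query = (\<lambda>x. Some (g x))"
| "run g (Pair a b) = (\<lambda>x. Option.bind (run g a x) (\<lambda>u.
      Option.bind (run g b x) (\<lambda>v. Some (prod_encode (u, v)))))"
| "run g (Comp a b) = (\<lambda>x. Option.bind (run g b x) (run g a))"
| "run g (Prec a b) = (\<lambda>x. rec_nat (run g a (fst (prod_decode x)))
      (\<lambda>k r. Option.bind r (\<lambda>v.
         run g b (prod_encode (fst (prod_decode x), prod_encode (k, v)))))
      (snd (prod_decode x)))"
| "run g (Search a) = (\<lambda>x.
      if \<exists>n. run g a (prod_encode (x, n)) = Some 0 \<and>
             (\<forall>m<n. run g a (prod_encode (x, m)) \<noteq> None)
      then Some (LEAST n. run g a (prod_encode (x, n)) = Some 0)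
      else None)"

lemma prod_decode_less:
  assumes "5 \<le> (e::nat)"
  shows "fst (prod_decode ((e - 5) div 4)) < e"
    and "snd (prod_decode ((e - 5) div 4)) < e"
    and "(e - 5) div 4 < e"
proof -
  obtain u v where uv: "prod_decode ((e - 5) div 4) = (u, v)"
    by (cases "prod_decode ((e - 5) div 4)")
  then have "prod_encode (u, v) = (e - 5) div 4"
    by (metis prod_decode_inverse)
  moreover show "(e - 5) div 4 < e"
    using assms by linarith
  ultimately show "fst (prod_decode ((e - 5) div 4)) < e"
    and "snd (prod_decode ((e - 5) div 4)) < e"
    using le_prod_encode_1[of u v] le_prod_encode_2[of v u] uv by auto
qed

text \<open>A Goedel numbering of the programs.\<close>

function prog_of :: "nat \<Rightarrow> prog" where
  "prog_of e =
    (if e = 0 then Zero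
     else if e = 1 then Succ
     else if e = 2 then Fst
     else if e = 3 then Snd
     else if e = 4 then Query
     else
       let q = (e - 5) div 4; r = (e - 5) mod 4 in
       if r = 0 then Pair (prog_of (fst (prod_decode q))) (prog_of (snd (prod_decode q)))
       else if r = 1 then Comp (prog_of (fst (prod_decode q))) (prog_of (snd (prod_decode q)))
       else if r = 2 then Prec (prog_of (fst (prod_decode q))) (prog_of (snd (prod_decode q)))
       else Search (prog_of q))"
  by pat_completeness auto
termination
  by (relation "measure id") (auto intro: prod_decode_less)

declare prog_of.simps [simp del]

primrec index_of :: "prog \<Rightarrow> nat" where
  "index_of Zero = 0"
| "index_of Succ = 1"
| "index_of Fst = 2"
| "index_of Snd = 3"
| "index_of Query = 4"
| "index_of (Pair a b) = 5 + 4 * prod_encode (index_of a, index_of b)"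
| "index_of (Comp a b) = 6 + 4 * prod_encode (index_of a, index_of b)"
| "index_of (Prec a b) = 7 + 4 * prod_encode (index_of a, index_of b)"
| "index_of (Search a) = 8 + 4 * index_of a"

lemma prog_of_step:
  assumes "r < 4"
  shows "prog_of (5 + r + 4 * q) =
      (if r = 0 then Pair (prog_of (fst (prod_decode q))) (prog_of (snd (prod_decode q)))
       else if r = 1 then Comp (prog_of (fst (prod_decode q))) (prog_of (snd (prod_decode q)))
       else if r = 2 then Prec (prog_of (fst (prod_decode q))) (prog_of (snd (prod_decode q)))
       else Search (prog_of q))"
  using assms by (subst prog_of.simps) (simp add: Let_def)

lemma prog_of_index_of: "prog_of (index_of c) = c"
proof (induction c)
  case (Pair a b)
  then show ?case using prog_of_step[of 0] by simp
next
  case (Comp a b)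
  then show ?case using prog_of_step[of 1] by simp
next
  case (Prec a b)
  then show ?case using prog_of_step[of 2] by simp
next
  case (Search a)
  then show ?case using prog_of_step[of 3] by simp
qed (simp_all add: prog_of.simps)

text \<open>\<open>Phi e\<close> is the \<open>e\<close>-th partial computable function on Baire space, defined at those \<open>g\<close>
  for which the \<open>e\<close>-th program computes a total function relative to \<open>g\<close>.\<close>

definition Phi :: "nat \<Rightarrow> (nat \<Rightarrow> nat) \<Rightarrow> (nat \<Rightarrow> nat) option" where
  "Phi e g =
     (if \<forall>n. run g (prog_of e) n \<noteq> None
      then Some (\<lambda>n. the (run g (prog_of e) n))
      else None)"

text \<open>Running a program relative to the zero function gives absolute computability.\<close>

definition computable_on_strings :: "(nat list \<Rightarrow> nat) \<Rightarrow> bool" where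
  "computable_on_strings h \<longleftrightarrow>
     (\<exists>c. \<forall>\<sigma>. run (\<lambda>_. 0) c (list_encode \<sigma>) = Some (h \<sigma>))"

section \<open>Learnability reducibilities\<close>

definition initial_segment :: "(nat \<Rightarrow> 'a) \<Rightarrow> nat \<Rightarrow> 'a list" where
  "initial_segment g n = map g [0..<n]"

abbreviation learner :: "(nat list \<Rightarrow> nat) \<Rightarrow> bool" where
  "learner \<Psi> \<equiv> computable_on_strings \<Psi>"

definition identifies ::
  "(nat list \<Rightarrow> nat) \<Rightarrow> ((nat \<Rightarrow> nat) \<Rightarrow> (nat \<Rightarrow> nat) option) \<Rightarrow> bool" where
  "identifies \<Psi> \<Gamma> \<longleftrightarrow>
     (\<forall>g\<in>dom \<Gamma>. convergent (\<lambda>n. \<Psi> (initial_segment g n)) \<and>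
        Phi (lim (\<lambda>n. \<Psi> (initial_segment g n))) g = \<Gamma> g)"

definition mind_changes :: "(nat list \<Rightarrow> nat) \<Rightarrow> (nat \<Rightarrow> nat) \<Rightarrow> nat set" where
  "mind_changes \<Psi> g =
     {n. \<Psi> (initial_segment g (Suc n)) \<noteq> \<Psi> (initial_segment g n)}"

definition hypotheses :: "(nat list \<Rightarrow> nat) \<Rightarrow> (nat \<Rightarrow> nat) \<Rightarrow> nat set" where
  "hypotheses \<Psi> g = range (\<lambda>n. \<Psi> (initial_segment g n))"

definition bounded_mind_change_computable ::
  "((nat \<Rightarrow> nat) \<Rightarrow> (nat \<Rightarrow> nat) option) \<Rightarrow> bool" where
  "bounded_mind_change_computable \<Gamma> \<longleftrightarrow>
     (\<exists>\<Psi>. learner \<Psi> \<and> identifies \<Psi> \<Gamma> \<and>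
        (\<exists>k. \<forall>g\<in>dom \<Gamma>. finite (mind_changes \<Psi> g) \<and> card (mind_changes \<Psi> g) \<le> k))"

definition bounded_error_computable ::
  "((nat \<Rightarrow> nat) \<Rightarrow> (nat \<Rightarrow> nat) option) \<Rightarrow> bool" where
  "bounded_error_computable \<Gamma> \<longleftrightarrow>
     (\<exists>\<Psi>. learner \<Psi> \<and> identifies \<Psi> \<Gamma> \<and>
        (\<exists>k. \<forall>g\<in>dom \<Gamma>. finite (hypotheses \<Psi> g) \<and> card (hypotheses \<Psi> g) \<le> k))"

definition reducible_via ::
  "(((nat \<Rightarrow> nat) \<Rightarrow> (nat \<Rightarrow> nat) option) \<Rightarrow> bool) \<Rightarrow>
   (nat \<Rightarrow> nat) set \<Rightarrow> (nat \<Rightarrow> nat) set \<Rightarrow> bool" where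
  "reducible_via \<C> A B \<longleftrightarrow>
     (\<exists>\<Gamma>. \<C> \<Gamma> \<and> B \<subseteq> dom \<Gamma> \<and> (\<forall>g\<in>B. the (\<Gamma> g) \<in> A))"

text \<open>The reducibilities \<open>\<le>\<^sup>1\<^bsub><\<omega>\<^esub>\<close> and \<open>\<le>\<^sup>1\<^bsub>\<omega>|<\<omega>\<^esub>\<close>, with the strict part of the first and the
  equivalence of the second.\<close>

definition le_mc :: "(nat \<Rightarrow> nat) set \<Rightarrow> (nat \<Rightarrow> nat) set \<Rightarrow> bool" where
  "le_mc A B \<longleftrightarrow> reducible_via bounded_mind_change_computable A B"

definition le_err :: "(nat \<Rightarrow> nat) set \<Rightarrow> (nat \<Rightarrow> nat) set \<Rightarrow> bool" where
  "le_err A B \<longleftrightarrow> reducible_via bounded_error_computable A B"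

definition less_mc :: "(nat \<Rightarrow> nat) set \<Rightarrow> (nat \<Rightarrow> nat) set \<Rightarrow> bool" where
  "less_mc A B \<longleftrightarrow> le_mc A B \<and> \<not> le_mc B A"

definition equiv_err :: "(nat \<Rightarrow> nat) set \<Rightarrow> (nat \<Rightarrow> nat) set \<Rightarrow> bool" where
  "equiv_err A B \<longleftrightarrow> le_err A B \<and> le_err B A"

section \<open>Effectively closed subsets of Cantor space\<close>

definition cantor_space :: "(nat \<Rightarrow> nat) set" where
  "cantor_space = {f. range f \<subseteq> {0, 1}}"

text \<open>The \<open>\<Pi>\<^sup>0\<^sub>1\<close> subset of Cantor space with index \<open>e\<close>: the complement of the effectively open
  set of those \<open>f\<close> relative to which the \<open>e\<close>-th program halts on input 0.\<close>

definition Pi01_index :: "nat \<Rightarrow> (nat \<Rightarrow> nat) set" where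
  "Pi01_index e = {f \<in> cantor_space. run f (prog_of e) 0 = None}"

definition Pi01 :: "(nat \<Rightarrow> nat) set \<Rightarrow> bool" where
  "Pi01 P \<longleftrightarrow> (\<exists>e. P = Pi01_index e)"

definition computable_tree :: "nat list set \<Rightarrow> bool" where
  "computable_tree T \<longleftrightarrow>
     (\<forall>\<sigma>\<in>T. set \<sigma> \<subseteq> {0, 1}) \<and>
     (\<forall>\<sigma> \<tau>. \<sigma> @ \<tau> \<in> T \<longrightarrow> \<sigma> \<in> T) \<and>
     computable_on_strings (\<lambda>\<sigma>. of_bool (\<sigma> \<in> T))"

definition paths :: "nat list set \<Rightarrow> (nat \<Rightarrow> nat) set" where
  "paths T = {f. \<forall>n. initial_segment f n \<in> T}"

definition leaves :: "nat list set \<Rightarrow> nat list set" where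
  "leaves T = {\<rho> \<in> T. \<forall>i. \<rho> @ [i] \<notin> T}"

text \<open>A choice, for every index, of a computable tree for the \<open>\<Pi>\<^sup>0\<^sub>1\<close> set with that index.\<close>

definition tree_assignment :: "(nat \<Rightarrow> nat list set) \<Rightarrow> bool" where
  "tree_assignment T \<longleftrightarrow>
     (\<forall>e. computable_tree (T e) \<and> paths (T e) = Pi01_index e)"

section \<open>Disjunction operations\<close>

definition prepend :: "nat list \<Rightarrow> (nat \<Rightarrow> nat) \<Rightarrow> nat \<Rightarrow> nat" where
  "prepend \<rho> f n = (if n < length \<rho> then \<rho> ! n else f (n - length \<rho>))"

text \<open>In the operations below a \<open>\<Pi>\<^sup>0\<^sub>1\<close> set is followed by its tree whenever the operation
  depends on that tree.\<close>

definition concatenation ::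
  "(nat \<Rightarrow> nat) set \<Rightarrow> nat list set \<Rightarrow> (nat \<Rightarrow> nat) set \<Rightarrow> (nat \<Rightarrow> nat) set" where
  "concatenation P TP Q = P \<union> (\<Union>\<rho>\<in>leaves TP. prepend \<rho> ` Q)"

definition coproduct :: "(nat \<Rightarrow> nat) set \<Rightarrow> (nat \<Rightarrow> nat) set \<Rightarrow> (nat \<Rightarrow> nat) set" where
  "coproduct A B = prepend [0] ` A \<union> prepend [1] ` B"

definition commutative_concatenation ::
  "(nat \<Rightarrow> nat) set \<Rightarrow> nat list set \<Rightarrow> (nat \<Rightarrow> nat) set \<Rightarrow> nat list set \<Rightarrow>
   (nat \<Rightarrow> nat) set" where
  "commutative_concatenation P TP Q TQ =
     coproduct (concatenation P TP Q) (concatenation Q TQ P)"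

definition pr_list :: "nat \<Rightarrow> (nat \<times> nat) list \<Rightarrow> nat list" where
  "pr_list i \<sigma> = map snd (filter (\<lambda>x. fst x = i) \<sigma>)"

text \<open>\<open>pr_in i f X\<close>: the projection of \<open>f\<close> to its entries with tag \<open>i\<close> is an infinite sequence
  and belongs to \<open>X\<close>.\<close>

definition pr_in :: "nat \<Rightarrow> (nat \<Rightarrow> nat \<times> nat) \<Rightarrow> (nat \<Rightarrow> nat) set \<Rightarrow> bool" where
  "pr_in i f X \<longleftrightarrow>
     infinite {n. fst (f n) = i} \<and>
     (\<lambda>k. snd (f (enumerate {n. fst (f n) = i} k))) \<in> X"

definition tag_changes :: "(nat \<Rightarrow> nat \<times> nat) \<Rightarrow> nat set" where
  "tag_changes f = {n. fst (f n) \<noteq> fst (f (Suc n))}"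

definition disjunction_omega ::
  "(nat \<Rightarrow> nat) set \<Rightarrow> nat list set \<Rightarrow> (nat \<Rightarrow> nat) set \<Rightarrow> nat list set \<Rightarrow>
   (nat \<Rightarrow> nat) set" where
  "disjunction_omega P TP Q TQ =
     {prod_encode \<circ> f | f :: nat \<Rightarrow> nat \<times> nat.
        (\<forall>n. fst (f n) \<in> {0, 1}) \<and>
        (pr_in 0 f P \<or> pr_in 1 f Q) \<and>
        finite (tag_changes f) \<and>
        (\<forall>n. pr_list 0 (initial_segment f n) \<in> TP \<and> pr_list 1 (initial_segment f n) \<in> TQ)}"

end

theory Submission
  imports Defs
begin

text \<open>
  Both parts rest on two \<open>\<Pi>\<^sup>0\<^sub>1\<close> classes \<open>P\<close>, \<open>Q\<close> with members \<open>x \<in> P\<close> and \<open>y \<in> Q\<close> such that \<open>x\<close>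
  computes no member of \<open>Q\<close> and \<open>y\<close> computes no member of \<open>P\<close>.

  The classes are built without a priority argument.  Members of \<open>P\<close> and \<open>Q\<close> are (graphs of)
  sequences obeying fast growing bounds, where \<open>P\<close> lives on the even and \<open>Q\<close> on the odd levels.
  For each odd level \<open>n\<close>, assigned to the program \<open>e\<close>, and each bounded string \<open>\<sigma>\<close> of length \<open>n\<close>,
  one searches for a value \<open>v\<close> such that the extensions \<open>\<tau>\<close> of \<open>\<sigma>\<close> with \<open>\<Phi>\<^sub>e\<^sup>\<tau>(n) = v\<close> form a bushy
  tree, and forbids the first such \<open>v\<close> as \<open>n\<close>-th value in \<open>Q\<close>; likewise for \<open>P\<close>.  A
  generic \<open>x \<in> P\<close> can then be kept inside such a bushy tree whenever there is one, so that
  \<open>\<Phi>\<^sub>e\<^sup>x\<close> takes a forbidden value at \<open>n\<close>, and can otherwise be kept off all computations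
  of admissible values at \<open>n\<close>.  Bushiness leaves room for the forbidden values of \<open>P\<close> and for the
  finitely many earlier requirements of the second kind.

  Given \<open>x\<close> and \<open>y\<close>, a learner with boundedly many mind changes is refuted by interleaving them
  on two tapes.  As long as tape 0 is extended by \<open>x\<close>, the output must be an element that \<open>x\<close>
  computes, and then a switch to \<open>y\<close> on tape 1 invalidates it; an output in \<open>P\<triangledown>Q\<close> or
  \<open>P \<oplus> Q\<close> can be repaired only a bounded number of times without a change of mind.
  For part (2), \<open>P \<oplus> Q\<close> is compared with the set of those interleavings whose number of
  switches is at most the position of the first entry on tape 1.  This set is closed,
  admits arbitrarily many switches, and the current tape is a learner's hypothesis.
\<close>

section \<open>Effective functionals\<close>

abbreviation pfst :: "nat \<Rightarrow> nat" where "pfst z \<equiv> fst (prod_decode z)"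
abbreviation psnd :: "nat \<Rightarrow> nat" where "psnd z \<equiv> snd (prod_decode z)"

text \<open>One program has to work for all oracles and be total on each of them, so closure under
  composition needs no domain conditions, and the oracle stays available as the parameter
  \<open>g\<close>.\<close>

definition effective :: "((nat \<Rightarrow> nat) \<Rightarrow> nat \<Rightarrow> nat) \<Rightarrow> bool" where
  "effective F \<longleftrightarrow> (\<exists>c. \<forall>g x. run g c x = Some (F g x))"

abbreviation decidable :: "((nat \<Rightarrow> nat) \<Rightarrow> nat \<Rightarrow> bool) \<Rightarrow> bool" where
  "decidable R \<equiv> effective (\<lambda>g x. of_bool (R g x))"

named_theorems eff

lemma effectiveI: "(\<And>g x. run g c x = Some (F g x)) \<Longrightarrow> effective F"
  unfolding effective_def by blast

lemma eff_id [eff]: "effective (\<lambda>g x. x)"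
  by (rule effectiveI[of "Pair Fst Snd"]) simp

lemma eff_comp:
  assumes "effective F" "effective G"
  shows "effective (\<lambda>g x. F g (G g x))"
proof -
  obtain c d where "\<And>g x. run g c x = Some (F g x)" "\<And>g x. run g d x = Some (G g x)"
    using assms unfolding effective_def by blast
  then show ?thesis by (intro effectiveI[of "Comp c d"]) simp
qed

lemma eff_pair [eff]:
  assumes "effective F" "effective G"
  shows "effective (\<lambda>g x. prod_encode (F g x, G g x))"
proof -
  obtain c d where "\<And>g x. run g c x = Some (F g x)" "\<And>g x. run g d x = Some (G g x)"
    using assms unfolding effective_def by blast
  then show ?thesis by (intro effectiveI[of "Pair c d"]) simp
qed

text \<open>Programs have one argument. Variables bound by recursors and quantifiers therefore
  become components of a pair, and \<open>eff_comp2\<close> and \<open>eff_comp3\<close> return to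
  separate arguments.\<close>

lemma eff_comp2:
  assumes "effective (\<lambda>g z. F g (pfst z) (psnd z))" "effective A" "effective B"
  shows "effective (\<lambda>g x. F g (A g x) (B g x))"
  using eff_comp[OF assms(1) eff_pair[OF assms(2,3)]] by simp

lemma eff_comp3:
  assumes "effective (\<lambda>g z. F g (pfst z) (pfst (psnd z)) (psnd (psnd z)))"
    "effective A" "effective B" "effective C"
  shows "effective (\<lambda>g x. F g (A g x) (B g x) (C g x))"
  using eff_comp[OF assms(1) eff_pair[OF assms(2) eff_pair[OF assms(3,4)]]] by simp

lemma eff_basic: "effective (\<lambda>g x. 0)" "effective (\<lambda>g x. Suc x)" "effective (\<lambda>g x. pfst x)"
  "effective (\<lambda>g x. psnd x)" "effective (\<lambda>g x. g x)"
  by (rule effectiveI[of Zero], simp) (rule effectiveI[of Succ], simp,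
      rule effectiveI[of Fst], simp, rule effectiveI[of Snd], simp, rule effectiveI[of Query], simp)

lemmas eff_Suc [eff] = eff_comp[OF eff_basic(2)]
lemmas eff_pfst [eff] = eff_comp[OF eff_basic(3)]
lemmas eff_psnd [eff] = eff_comp[OF eff_basic(4)]
lemmas eff_query [eff] = eff_comp[OF eff_basic(5)]

lemma eff_const [eff]: "effective (\<lambda>g x. k)"
  by (induction k) (auto intro: eff_basic(1) eff_Suc)

lemma eff_rec [eff]:
  assumes "effective A" "effective (\<lambda>g z. B g (pfst z) (pfst (psnd z)) (psnd (psnd z)))" "effective N"
  shows "effective (\<lambda>g x. rec_nat (A g x) (\<lambda>k r. B g x k r) (N g x))"
proof -
  obtain a b where a: "\<And>g x. run g a x = Some (A g x)"
    and b: "\<And>g z. run g b z = Some (B g (pfst z) (pfst (psnd z)) (psnd (psnd z)))"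
    using assms unfolding effective_def by blast
  have "rec_nat (run g a x) (\<lambda>k r. Option.bind r (\<lambda>v. run g b (prod_encode (x, prod_encode (k, v))))) n
      = Some (rec_nat (A g x) (B g x) n)" for g x n
    by (induction n) (simp_all add: a b)
  then have "effective (\<lambda>g z. rec_nat (A g (pfst z)) (B g (pfst z)) (psnd z))"
    by (intro effectiveI[of "Prec a b"]) simp
  from eff_comp2[OF this eff_id assms(3)] show ?thesis by simp
qed

section \<open>Arithmetic, case distinctions and bounded quantifiers\<close>

lemma eff_add [eff]:
  assumes "effective A" "effective B" shows "effective (\<lambda>g x. A g x + B g x)"
proof -
  have "m + n = rec_nat m (\<lambda>k r. Suc r) n" for m n :: nat by (induction n) auto
  moreover have "effective (\<lambda>g x. rec_nat (A g x) (\<lambda>k r. Suc r) (B g x))"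
    using assms by (intro eff)
  ultimately show ?thesis by simp
qed

lemma eff_mult [eff]:
  assumes "effective A" "effective B" shows "effective (\<lambda>g x. A g x * B g x)"
proof -
  have "m * n = rec_nat 0 (\<lambda>k r. r + m) n" for m n :: nat by (induction n) auto
  moreover have "effective (\<lambda>g x. rec_nat 0 (\<lambda>k r. r + A g x) (B g x))"
    using assms by (intro eff eff_comp[OF assms(1)])
  ultimately show ?thesis by simp
qed

lemma eff_pow [eff]:
  assumes "effective A" "effective B" shows "effective (\<lambda>g x. A g x ^ B g x)"
proof -
  have "m ^ n = rec_nat 1 (\<lambda>k r. r * m) n" for m n :: nat by (induction n) auto
  moreover have "effective (\<lambda>g x. rec_nat 1 (\<lambda>k r. r * A g x) (B g x))"
    using assms by (intro eff eff_comp[OF assms(1)])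
  ultimately show ?thesis by simp
qed

lemma eff_diff [eff]:
  assumes "effective A" "effective B" shows "effective (\<lambda>g x. A g x - B g x)"
proof -
  have p: "n - 1 = rec_nat 0 (\<lambda>k r. k) n" for n :: nat by (cases n) auto
  have "effective (\<lambda>g x. rec_nat 0 (\<lambda>k r. k) x)" by (intro eff)
  then have pe: "effective (\<lambda>g x. F g x - 1)" if "effective F" for F
    using eff_comp[of "\<lambda>g x. x - 1", OF _ that] unfolding p by simp
  have "m - n = rec_nat m (\<lambda>k r. r - 1) n" for m n :: nat by (induction n) auto
  then have "(\<lambda>g x. A g x - B g x) = (\<lambda>g x. rec_nat (A g x) (\<lambda>k r. r - 1) (B g x))" by (intro ext)
  moreover have "effective (\<lambda>g x. rec_nat (A g x) (\<lambda>k r. r - 1) (B g x))"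
    using assms by (intro eff pe)
  ultimately show ?thesis by (simp only:)
qed

lemma eff_if [eff]:
  assumes "decidable R" "effective A" "effective B"
  shows "effective (\<lambda>g x. if R g x then A g x else B g x)"
proof -
  have *: "(if p then a else b) = a * of_bool p + b * (1 - of_bool p)" for p and a b :: nat by simp
  show ?thesis unfolding * by (intro eff assms)
qed

lemma dec_eq [eff]:
  assumes "effective A" "effective B" shows "decidable (\<lambda>g x. A g x = B g x)"
proof -
  have *: "of_bool (a = b) = 1 - ((a - b) + (b - a))" for a b :: nat by (cases "a = b") simp_all
  show ?thesis unfolding * by (intro eff assms)
qed

lemma dec_less [eff]:
  assumes "effective A" "effective B" shows "decidable (\<lambda>g x. A g x < B g x)"
proof -
  have *: "of_bool (a < b) = 1 - (1 - (b - a))" for a b :: nat by (cases "a < b") simp_all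
  show ?thesis unfolding * by (intro eff assms)
qed

lemma dec_not [eff]:
  assumes "decidable R" shows "decidable (\<lambda>g x. \<not> R g x)"
proof -
  have *: "of_bool (\<not> p) = 1 - (of_bool p :: nat)" for p by (cases p) simp_all
  show ?thesis unfolding * by (intro eff assms)
qed

lemma dec_conj [eff]:
  assumes "decidable R" "decidable S" shows "decidable (\<lambda>g x. R g x \<and> S g x)"
  unfolding of_bool_conj by (intro eff assms)

lemma dec_disj [eff]:
  assumes "decidable R" "decidable S" shows "decidable (\<lambda>g x. R g x \<or> S g x)"
proof -
  have "decidable (\<lambda>g x. \<not> (\<not> R g x \<and> \<not> S g x))" using assms by (intro eff)
  then show ?thesis by simp
qed

lemma dec_imp [eff]:
  assumes "decidable R" "decidable S" shows "decidable (\<lambda>g x. R g x \<longrightarrow> S g x)"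
  using dec_disj[OF dec_not[OF assms(1)] assms(2)] unfolding imp_conv_disj .

lemma dec_if [eff]:
  assumes "decidable C" "decidable R" "decidable S"
  shows "decidable (\<lambda>g x. if C g x then R g x else S g x)"
  unfolding if_bool_eq_conj by (intro eff assms)

lemma dec_comp2:
  assumes "decidable (\<lambda>g z. R g (pfst z) (psnd z))" "effective A" "effective B"
  shows "decidable (\<lambda>g x. R g (A g x) (B g x))"
  using eff_comp2[OF assms] .

lemma dec_ball [eff]:
  assumes "decidable (\<lambda>g z. R g (pfst z) (psnd z))" "effective N"
  shows "decidable (\<lambda>g x. \<forall>i<N g x. R g x i)"
proof -
  have "of_bool (\<forall>i<n. Q i) = rec_nat (1::nat) (\<lambda>k r. r * of_bool (Q k)) n" for n and Q :: "nat \<Rightarrow> bool"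
  proof (induction n)
    case (Suc n)
    then show ?case by (cases "Q n") (simp_all add: All_less_Suc)
  qed simp
  moreover have "effective (\<lambda>g x. rec_nat 1 (\<lambda>k r. r * of_bool (R g x k)) (N g x))"
    by (intro eff dec_comp2[OF assms(1)] assms)
  ultimately show ?thesis by simp
qed

lemma dec_bex [eff]:
  assumes "decidable (\<lambda>g z. R g (pfst z) (psnd z))" "effective N"
  shows "decidable (\<lambda>g x. \<exists>i<N g x. R g x i)"
proof -
  have "decidable (\<lambda>g x. \<not> (\<forall>i<N g x. \<not> R g x i))" by (intro eff assms)
  then show ?thesis by simp
qed

lemma eff_card [eff]:
  assumes "decidable (\<lambda>g z. R g (pfst z) (psnd z))" "effective N"
  shows "effective (\<lambda>g x. card {i. i < N g x \<and> R g x i})"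
proof -
  have "card {i. i < n \<and> Q i} = rec_nat 0 (\<lambda>k r. r + of_bool (Q k)) n" for n and Q :: "nat \<Rightarrow> bool"
  proof (induction n)
    case (Suc n)
    have "{i. i < Suc n \<and> Q i} = {i. i < n \<and> Q i} \<union> (if Q n then {n} else {})"
      by (auto simp: less_Suc_eq)
    then show ?case using Suc by (simp add: card_insert_if)
  qed simp
  moreover have "effective (\<lambda>g x. rec_nat 0 (\<lambda>k r. r + of_bool (R g x k)) (N g x))"
    by (intro eff dec_comp2[OF assms(1)] assms)
  ultimately show ?thesis by simp
qed

lemma eff_mod [eff]:
  assumes "effective A" "effective B" shows "effective (\<lambda>g x. A g x mod B g x)"
proof -
  have "m mod n = rec_nat 0 (\<lambda>k r. if Suc r = n then 0 else Suc r) m" for m n :: nat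
    by (induction m) (simp_all add: mod_Suc)
  moreover have "effective (\<lambda>g x. rec_nat 0 (\<lambda>k r. if Suc r = B g x then 0 else Suc r) (A g x))"
    by (intro eff eff_comp[OF assms(2)] assms)
  ultimately show ?thesis by simp
qed

lemma eff_div [eff]:
  assumes "effective A" "effective B" shows "effective (\<lambda>g x. A g x div B g x)"
proof -
  have "m div n = rec_nat 0 (\<lambda>k r. if Suc k mod n = 0 then Suc r else r) m" for m n :: nat
    by (induction m) (simp_all add: div_Suc)
  moreover have "effective (\<lambda>g x. rec_nat 0 (\<lambda>k r. if Suc k mod B g x = 0 then Suc r else r) (A g x))"
    by (intro eff eff_comp[OF assms(2)] assms)
  ultimately show ?thesis by simp
qed

section \<open>Coded finite sets and lists\<close>

lemma dec_set_decode [eff]: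
  assumes "effective A" "effective B" shows "decidable (\<lambda>g x. A g x \<in> set_decode (B g x))"
  unfolding set_decode_def mem_Collect_eq odd_iff_mod_2_eq_one by (intro eff assms)

lemma set_decode_less: "z \<in> set_decode D \<Longrightarrow> z < D"
proof -
  assume "z \<in> set_decode D"
  then have "2 ^ z \<le> D" by (auto simp: set_decode_def intro!: leI dest: div_less)
  then show "z < D" using less_exp[of z] by linarith
qed

text \<open>The default 0 is what the projections return on the code 0 of the empty list, so
  indexing agrees with iterated decoding beyond the end as well.\<close>

definition lnth :: "nat list \<Rightarrow> nat \<Rightarrow> nat" where
  "lnth L i = (if i < length L then L ! i else 0)"

lemma prod_decode_0: "prod_decode 0 = (0, 0)"
  using prod_encode_inverse[of "(0, 0)"] by (simp add: prod_encode_def)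

lemma list_decode_tl: "list_decode (psnd (c - 1)) = tl (list_decode c)"
  by (cases c) (auto split: prod.split simp: prod_decode_0)

lemma list_decode_hd: "pfst (c - 1) = lnth (list_decode c) 0"
  by (cases c) (auto split: prod.split simp: lnth_def prod_decode_0)

lemma list_decode_drop: "list_decode (rec_nat c (\<lambda>k r. psnd (r - 1)) i) = drop i (list_decode c)"
  by (induction i) (simp_all add: list_decode_tl[simplified] drop_Suc tl_drop)

lemma eff_lnth [eff]:
  assumes "effective A" "effective B" shows "effective (\<lambda>g x. lnth (list_decode (A g x)) (B g x))"
proof -
  have "lnth (list_decode c) i = pfst (rec_nat c (\<lambda>k r. psnd (r - 1)) i - 1)" for c i
    unfolding list_decode_hd list_decode_drop by (simp add: lnth_def)
  moreover have "effective (\<lambda>g x. pfst (rec_nat (A g x) (\<lambda>k r. psnd (r - 1)) (B g x) - 1))"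
    by (intro eff assms)
  ultimately show ?thesis by simp
qed

lemma length_list_decode_le: "length (list_decode c) \<le> c"
proof (induction c rule: less_induct)
  case (less c)
  show ?case
  proof (cases c)
    case (Suc k)
    have "psnd k \<le> k" using le_prod_encode_2[of "psnd k" "pfst k"] by simp
    then show ?thesis using less[of "psnd k"] Suc by (auto split: prod.split)
  qed simp
qed

text \<open>A list has an entry \<open>i\<close> iff its \<open>i\<close>-fold tail has a nonzero
  code. As the length is at most the code, counting such \<open>i\<close> below the code gives the
  length.\<close>

lemma eff_length [eff]:
  assumes "effective A" shows "effective (\<lambda>g x. length (list_decode (A g x)))"
proof -
  have *: "(rec_nat c (\<lambda>k r. psnd (r - 1)) i \<noteq> 0) \<longleftrightarrow> i < length (list_decode c)" for c i
    by (metis list_decode_drop list_decode.simps(1) list_decode_inverse list_encode.simps(1)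
        drop_eq_Nil not_le)
  have "length (list_decode c) = card {i. i < c \<and> rec_nat c (\<lambda>k r. psnd (r - 1)) i \<noteq> 0}" for c
  proof -
    have "{i. i < c \<and> rec_nat c (\<lambda>k r. psnd (r - 1)) i \<noteq> 0} = {..<length (list_decode c)}"
      unfolding * using length_list_decode_le[of c] by auto
    then show ?thesis by simp
  qed
  moreover have "effective (\<lambda>g x. card {i. i < A g x \<and> rec_nat (A g x) (\<lambda>k r. psnd (r - 1)) i \<noteq> 0})"
    by (intro eff eff_comp[OF assms] assms)
  ultimately show ?thesis by simp
qed

section \<open>Substitution of programs for the oracle\<close>

primrec subst_query :: "prog \<Rightarrow> prog \<Rightarrow> prog" where
  "subst_query p Zero = Zero"
| "subst_query p Succ = Succ"
| "subst_query p Fst = Fst"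
| "subst_query p Snd = Snd"
| "subst_query p Query = p"
| "subst_query p (Pair a b) = Pair (subst_query p a) (subst_query p b)"
| "subst_query p (Comp a b) = Comp (subst_query p a) (subst_query p b)"
| "subst_query p (Prec a b) = Prec (subst_query p a) (subst_query p b)"
| "subst_query p (Search a) = Search (subst_query p a)"

lemma run_subst_query:
  assumes "\<And>n. run g p n = Some (h n)"
  shows "run g (subst_query p c) = run h c"
  by (induction c) (simp_all add: assms cong: if_cong)

text \<open>Trees are computable relative to the zero oracle; replacing the queries by
  \<open>Zero\<close> makes them usable inside programs with an arbitrary oracle.\<close>

lemma effective_zero_oracle:
  assumes "\<And>x. run (\<lambda>_. 0) c x = Some (F x)"
  shows "effective (\<lambda>g x. F x)"
  by (rule effectiveI[of "subst_query Zero c"]) (simp add: run_subst_query[where h="\<lambda>_. 0"] assms)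

section \<open>Certificates of halting computations\<close>

text \<open>
  A triple \<open>(e, x, y)\<close> asserts that the \<open>e\<close>-th program maps \<open>x\<close> to \<open>y\<close>; \<open>R\<close> lists the known
  answers of the oracle.  A set of triples needs no ordering to be a sound certificate: a triple is
  justified by triples with a smaller index or, for primitive recursion, with the same index and
  a smaller recursion argument.
\<close>

definition triple_code :: "nat \<Rightarrow> nat \<Rightarrow> nat \<Rightarrow> nat" where
  "triple_code e x y = prod_encode (e, prod_encode (x, y))"

definition justified :: "(nat \<Rightarrow> nat \<Rightarrow> bool) \<Rightarrow> nat set \<Rightarrow> nat \<Rightarrow> nat \<Rightarrow> nat \<Rightarrow> bool" where
  "justified R S e x y \<longleftrightarrow>
    (if e = 0 then y = 0
     else if e = 1 then y = Suc x
     else if e = 2 then y = pfst x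
     else if e = 3 then y = psnd x
     else if e = 4 then R x y
     else let q = (e - 5) div 4; r = (e - 5) mod 4; a = pfst q; b = psnd q in
       if r = 0 then triple_code a x (pfst y) \<in> S \<and> triple_code b x (psnd y) \<in> S
       else if r = 1 then \<exists>u. triple_code b x u \<in> S \<and> triple_code a u y \<in> S
       else if r = 2 then
         (if psnd x = 0 then triple_code a (pfst x) y \<in> S
          else \<exists>v. triple_code e (prod_encode (pfst x, psnd x - 1)) v \<in> S \<and>
                triple_code b (prod_encode (pfst x, prod_encode (psnd x - 1, v))) y \<in> S)
       else triple_code q (prod_encode (x, y)) 0 \<in> S \<and>
         (\<forall>m<y. \<exists>v. 0 < v \<and> triple_code q (prod_encode (x, m)) v \<in> S))"

definition certificate :: "(nat \<Rightarrow> nat \<Rightarrow> bool) \<Rightarrow> nat set \<Rightarrow> bool" where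
  "certificate R S \<longleftrightarrow> (\<forall>e x y. triple_code e x y \<in> S \<longrightarrow> justified R S e x y)"

lemma triple_code_less:
  assumes "triple_code e x y \<in> set_decode D"
  shows "x < D" "y < D"
proof -
  have "triple_code e x y < D" using set_decode_less[OF assms] .
  moreover have "x \<le> prod_encode (x, y)" "y \<le> prod_encode (x, y)" "prod_encode (x, y) \<le> triple_code e x y"
    unfolding triple_code_def by (rule le_prod_encode_1 le_prod_encode_2)+
  ultimately show "x < D" "y < D" by linarith+
qed

lemma triple_code_decode: "triple_code (pfst z) (pfst (psnd z)) (psnd (psnd z)) = z"
  by (simp add: triple_code_def)

lemma justified_mono: "justified R S e x y \<Longrightarrow> S \<subseteq> S' \<Longrightarrow> justified R S' e x y"
  unfolding justified_def Let_def by (auto split: if_splits) blast+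

text \<open>The oracle relation is consulted only for triples with index 4 that belong to
  \<open>S\<close>, so only these answers have to be preserved.\<close>

lemma certificate_mono:
  assumes "certificate R S" "\<And>q y. R q y \<Longrightarrow> triple_code 4 q y \<in> S \<Longrightarrow> R' q y"
  shows "certificate R' S"
proof -
  have "justified R' S e x y" if "justified R S e x y" "triple_code e x y \<in> S" for e x y
    using that assms(2)[of x y] unfolding justified_def by (cases "e = 4") simp_all
  then show ?thesis using assms(1) unfolding certificate_def by blast
qed

text \<open>Justification is monotone in the set, so certificates of the premises may be united;
  adding the conclusion, justified by the premises, yields a certificate again.\<close>

lemma certificate_step:
  assumes "finite X" "\<forall>t\<in>X. \<exists>S. finite S \<and> t \<in> S \<and> certificate R S" "justified R X e x y"
  shows "\<exists>S. finite S \<and> triple_code e x y \<in> S \<and> certificate R S"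
proof -
  obtain F where F: "\<And>t. t \<in> X \<Longrightarrow> finite (F t) \<and> t \<in> F t \<and> certificate R (F t)"
    using assms(2) by metis
  let ?S = "insert (triple_code e x y) (\<Union>t\<in>X. F t)"
  have "certificate R ?S"
    unfolding certificate_def
  proof (intro allI impI)
    fix e' x' y' assume "triple_code e' x' y' \<in> ?S"
    then consider "triple_code e' x' y' = triple_code e x y" | t where "t \<in> X" "triple_code e' x' y' \<in> F t" by blast
    then show "justified R ?S e' x' y'"
    proof cases
      case 1
      then have "e' = e" "x' = x" "y' = y" by (auto simp: triple_code_def)
      have "X \<subseteq> ?S" using F by blast
      from justified_mono[OF assms(3) this] show ?thesis using \<open>e' = e\<close> \<open>x' = x\<close> \<open>y' = y\<close> by simp
    next
      case 2
      then have "justified R (F t) e' x' y'" using F unfolding certificate_def by blast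
      then show ?thesis by (rule justified_mono) (use 2 in auto)
    qed
  qed
  moreover have "finite ?S" using assms(1) F by simp
  ultimately show ?thesis by (intro exI[of _ ?S]) simp
qed

lemma prog_of_ge5:
  assumes "5 \<le> e" "q = (e - 5) div 4" "r = (e - 5) mod 4"
  shows "prog_of e =
      (if r = 0 then Pair (prog_of (pfst q)) (prog_of (psnd q))
       else if r = 1 then Comp (prog_of (pfst q)) (prog_of (psnd q))
       else if r = 2 then Prec (prog_of (pfst q)) (prog_of (psnd q))
       else Search (prog_of q))"
  using assms by (subst prog_of.simps) (simp add: Let_def)

lemma prog_of_less5: "prog_of 0 = Zero" "prog_of 1 = Succ" "prog_of 2 = Fst" "prog_of 3 = Snd"
  "prog_of 4 = Query"
  by (simp_all add: prog_of.simps)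

lemma justified_ge5:
  assumes "5 \<le> e" "q = (e - 5) div 4" "r = (e - 5) mod 4"
  shows "justified R S e x y \<longleftrightarrow> 
    (if r = 0 then triple_code (pfst q) x (pfst y) \<in> S \<and> triple_code (psnd q) x (psnd y) \<in> S
       else if r = 1 then \<exists>u. triple_code (psnd q) x u \<in> S \<and> triple_code (pfst q) u y \<in> S
       else if r = 2 then
         (if psnd x = 0 then triple_code (pfst q) (pfst x) y \<in> S
          else \<exists>v. triple_code e (prod_encode (pfst x, psnd x - 1)) v \<in> S \<and>
                triple_code (psnd q) (prod_encode (pfst x, prod_encode (psnd x - 1, v))) y \<in> S)
       else triple_code q (prod_encode (x, y)) 0 \<in> S \<and>
         (\<forall>m<y. \<exists>v. 0 < v \<and> triple_code q (prod_encode (x, m)) v \<in> S))"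
  using assms unfolding justified_def by (simp add: Let_def)

lemma certificate_sound:
  assumes cert: "certificate R S" and R: "\<And>q y. R q y \<Longrightarrow> g q = y"
  shows "triple_code e x y \<in> S \<Longrightarrow> run g (prog_of e) x = Some y"
proof (induction e arbitrary: x y rule: less_induct)
  case (less e)
  have just: "justified R S e x y" if "triple_code e x y \<in> S" for x y
    using cert that unfolding certificate_def by blast
  show ?case
  proof (cases "5 \<le> e")
    case False
    then have "e = 0 \<or> e = 1 \<or> e = 2 \<or> e = 3 \<or> e = 4" by auto
    then show ?thesis using just[OF less.prems] R
      by (elim disjE) (simp_all add: justified_def prog_of_less5[simplified])
  next
    case True
    define q r where q: "q = (e - 5) div 4" and r: "r = (e - 5) mod 4"
    note J = justified_ge5[OF True q r] and P = prog_of_ge5[OF True q r]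
    have lt: "pfst q < e" "psnd q < e" "q < e" using prod_decode_less[OF True] q by auto
    have "r < 4" by (simp add: r)
    then consider "r = 0" | "r = 1" | "r = 2" | "r = 3" by linarith
    then show ?thesis
    proof cases
      case 1
      then show ?thesis using just[OF less.prems] less.IH[OF lt(1)] less.IH[OF lt(2)] by (auto simp: J P)
    next
      case 2
      then show ?thesis using just[OF less.prems] less.IH[OF lt(1)] less.IH[OF lt(2)]
        by (auto simp: J P)
    next
      case 3
      have "triple_code e (prod_encode (p, k)) y \<in> S \<Longrightarrow> run g (prog_of e) (prod_encode (p, k)) = Some y" for p k y
      proof (induction k arbitrary: y)
        case 0
        then show ?case using just[OF 0] less.IH[OF lt(1)] 3 by (simp add: J P)
      next
        case (Suc k)
        from just[OF Suc.prems] 3 obtain v where v: "triple_code e (prod_encode (p, k)) v \<in> S"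
          "triple_code (psnd q) (prod_encode (p, prod_encode (k, v))) y \<in> S" by (auto simp: J)
        show ?case using Suc.IH[OF v(1)] less.IH[OF lt(2) v(2)] 3 by (simp add: P)
      qed
      from this[of "pfst x" "psnd x"] show ?thesis using less.prems by simp
    next
      case 4
      have *: "run g (prog_of q) (prod_encode (x, y)) = Some 0"
        "\<And>m. m < y \<Longrightarrow> \<exists>v>0. run g (prog_of q) (prod_encode (x, m)) = Some v"
        using just[OF less.prems] 4 less.IH[OF lt(3)] by (auto simp: J)
      have "(LEAST n. run g (prog_of q) (prod_encode (x, n)) = Some 0) = y"
        by (rule Least_equality) (use * in \<open>force simp: not_less[symmetric]\<close>)+
      then show ?thesis using 4 * by (force simp: P)
    qed
  qed
qed

lemma certificate_complete_aux:
  "run g (prog_of e) x = Some y \<Longrightarrow>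
     \<exists>S. finite S \<and> triple_code e x y \<in> S \<and> certificate (\<lambda>q y. g q = y) S"
proof (induction e arbitrary: x y rule: less_induct)
  case (less e)
  let ?ok = "\<lambda>t. \<exists>S. finite S \<and> t \<in> S \<and> certificate (\<lambda>q y. g q = y) S"
  show ?case
  proof (cases "5 \<le> e")
    case False
    then have "e = 0 \<or> e = 1 \<or> e = 2 \<or> e = 3 \<or> e = 4" by auto
    then have "justified (\<lambda>q y. g q = y) {} e x y" using less.prems
      by (elim disjE) (simp_all add: justified_def prog_of_less5[simplified])
    then show ?thesis by (intro certificate_step[of "{}"]) auto
  next
    case True
    define q r where q: "q = (e - 5) div 4" and r: "r = (e - 5) mod 4"
    note J = justified_ge5[OF True q r] and P = prog_of_ge5[OF True q r]
    have lt: "pfst q < e" "psnd q < e" "q < e" using prod_decode_less[OF True] q by auto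
    have "r < 4" by (simp add: r)
    then consider "r = 0" | "r = 1" | "r = 2" | "r = 3" by linarith
    then show ?thesis
    proof cases
      case 1
      then obtain u v where uv: "run g (prog_of (pfst q)) x = Some u" "run g (prog_of (psnd q)) x = Some v"
        "y = prod_encode (u, v)" using less.prems by (auto simp: P bind_eq_Some_conv)
      show ?thesis
        by (rule certificate_step[of "{triple_code (pfst q) x u, triple_code (psnd q) x v}"])
          (use less.IH[OF lt(1) uv(1)] less.IH[OF lt(2) uv(2)] 1 uv(3) in \<open>auto simp: J\<close>)
    next
      case 2
      then obtain u where u: "run g (prog_of (psnd q)) x = Some u" "run g (prog_of (pfst q)) u = Some y"
        using less.prems by (auto simp: P bind_eq_Some_conv)
      show ?thesis
        by (rule certificate_step[of "{triple_code (psnd q) x u, triple_code (pfst q) u y}"])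
          (use less.IH[OF lt(2) u(1)] less.IH[OF lt(1) u(2)] 2 in \<open>auto simp: J\<close>)
    next
      case 3
      have "run g (prog_of e) (prod_encode (p, k)) = Some y \<Longrightarrow> ?ok (triple_code e (prod_encode (p, k)) y)" for p k y
      proof (induction k arbitrary: y)
        case 0
        then have u: "run g (prog_of (pfst q)) p = Some y" using 3 by (simp add: P)
        show ?case
          by (rule certificate_step[of "{triple_code (pfst q) p y}"])
            (use less.IH[OF lt(1) u] 3 in \<open>auto simp: J\<close>)
      next
        case (Suc k)
        then obtain v where v: "run g (prog_of e) (prod_encode (p, k)) = Some v"
          "run g (prog_of (psnd q)) (prod_encode (p, prod_encode (k, v))) = Some y" using 3
          by (auto simp: P bind_eq_Some_conv)
        show ?case
          by (rule certificate_step[of "{triple_code e (prod_encode (p, k)) v,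
              triple_code (psnd q) (prod_encode (p, prod_encode (k, v))) y}"])
            (use Suc.IH[OF v(1)] less.IH[OF lt(2) v(2)] 3 in \<open>auto simp: J\<close>)
      qed
      from this[of "pfst x" "psnd x"] show ?thesis using less.prems by simp
    next
      case 4
      let ?Z = "\<lambda>n. run g (prog_of q) (prod_encode (x, n))"
      have ex: "\<exists>n. ?Z n = Some 0 \<and> (\<forall>m<n. ?Z m \<noteq> None)" and y: "y = (LEAST n. ?Z n = Some 0)"
        using less.prems 4 by (auto simp: P split: if_splits)
      have y0: "?Z y = Some 0" unfolding y using ex by (metis (mono_tags, lifting) LeastI)
      have "\<exists>v>0. ?Z m = Some v" if m: "m < y" for m
      proof -
        obtain n where n: "?Z n = Some 0" "\<forall>m<n. ?Z m \<noteq> None" using ex by blast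
        have "y \<le> n" unfolding y using n(1) by (rule Least_le)
        then obtain v where v: "?Z m = Some v" using n(2) m by fastforce
        have "v \<noteq> 0" using v m Least_le[of "\<lambda>n. ?Z n = Some 0" m] y by auto
        then show ?thesis using v by blast
      qed
      then obtain v where v: "\<And>m. m < y \<Longrightarrow> 0 < v m \<and> ?Z m = Some (v m)" by metis
      let ?X = "insert (triple_code q (prod_encode (x, y)) 0) ((\<lambda>m. triple_code q (prod_encode (x, m)) (v m)) ` {..<y})"
      have "\<exists>u. 0 < u \<and> triple_code q (prod_encode (x, m)) u \<in> ?X" if "m < y" for m
        using v[OF that] that by blast
      then have just: "justified (\<lambda>q y. g q = y) ?X e x y" unfolding J using 4 by simp
      have ok: "\<forall>t\<in>?X. ?ok t"
      proof
        fix t assume "t \<in> ?X"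
        then consider "t = triple_code q (prod_encode (x, y)) 0"
          | m where "m < y" "t = triple_code q (prod_encode (x, m)) (v m)" by blast
        then show "?ok t"
          by cases (use less.IH[OF lt(3) y0] less.IH[OF lt(3)] v in blast)+
      qed
      have "finite ?X" by simp
      from certificate_step[OF this ok just] show ?thesis .
    qed
  qed
qed

lemma certificate_complete:
  assumes "run g (prog_of e) x = Some y"
  shows "\<exists>D N. triple_code e x y \<in> set_decode D \<and> certificate (\<lambda>q y. q < N \<and> g q = y) (set_decode D)"
proof -
  obtain S where S: "finite S" "triple_code e x y \<in> S" "certificate (\<lambda>q y. g q = y) S"
    using certificate_complete_aux[OF assms] by blast
  then have D: "set_decode (set_encode S) = S" by simp
  \<comment> \<open>A query recorded in \<open>S\<close> is a component of a triple in
    \<open>S\<close>, hence below the code of \<open>S\<close>; this code bounds the use of the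
    computation.\<close>
  have "certificate (\<lambda>q y. q < set_encode S \<and> g q = y) S"
    by (rule certificate_mono[OF S(3)]) (metis D triple_code_less(1))
  then show ?thesis using S(2) D by metis
qed

text \<open>Use principle: the finite certificate of the computation remains valid for every oracle
  with the same answers below \<open>N\<close>.\<close>

lemma run_use:
  assumes "run g c x = Some y"
  shows "\<exists>N. \<forall>h. (\<forall>i<N. h i = g i) \<longrightarrow> run h c x = Some y"
proof -
  have "run g (prog_of (index_of c)) x = Some y" using assms by (simp add: prog_of_index_of)
  from certificate_complete[OF this] obtain D N where D: "triple_code (index_of c) x y \<in> set_decode D"
    and N: "certificate (\<lambda>q y. q < N \<and> g q = y) (set_decode D)" by blast
  have "run h c x = Some y" if "\<forall>i<N. h i = g i" for h
    using certificate_sound[OF N _ D, of h] that by (auto simp: prog_of_index_of)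
  then show ?thesis by blast
qed

text \<open>
  The elements of \<open>set_decode D\<close> are below \<open>D\<close>, which bounds all quantifiers and makes the
  certificate property decidable.
\<close>

definition justified_below :: "(nat \<Rightarrow> nat \<Rightarrow> bool) \<Rightarrow> nat \<Rightarrow> nat \<Rightarrow> nat \<Rightarrow> nat \<Rightarrow> bool" where
  "justified_below R D e x y \<longleftrightarrow>
    (if e = 0 then y = 0
     else if e = 1 then y = Suc x
     else if e = 2 then y = pfst x
     else if e = 3 then y = psnd x
     else if e = 4 then R x y
     else 
       if (e - 5) mod 4 = 0 then triple_code (pfst ((e - 5) div 4)) x (pfst y) \<in> set_decode D \<and> 
          triple_code (psnd ((e - 5) div 4)) x (psnd y) \<in> set_decode D
       else if (e - 5) mod 4 = 1 then \<exists>u<D. triple_code (psnd ((e - 5) div 4)) x u \<in> set_decode D \<and> 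
          triple_code (pfst ((e - 5) div 4)) u y \<in> set_decode D
       else if (e - 5) mod 4 = 2 then
         (if psnd x = 0 then triple_code (pfst ((e - 5) div 4)) (pfst x) y \<in> set_decode D
          else \<exists>v<D. triple_code e (prod_encode (pfst x, psnd x - 1)) v \<in> set_decode D \<and>
                triple_code (psnd ((e - 5) div 4)) (prod_encode (pfst x, prod_encode (psnd x - 1, v))) y \<in> set_decode D)
       else triple_code ((e - 5) div 4) (prod_encode (x, y)) 0 \<in> set_decode D \<and>
         (\<forall>m<y. \<exists>v<D. 0 < v \<and> triple_code ((e - 5) div 4) (prod_encode (x, m)) v \<in> set_decode D))"

lemma justified_below: "justified R (set_decode D) e x y \<longleftrightarrow> justified_below R D e x y"
proof -
  have *: "(\<exists>u. triple_code a z u \<in> set_decode D \<and> Q u) \<longleftrightarrow> (\<exists>u<D. triple_code a z u \<in> set_decode D \<and> Q u)"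
    "(\<exists>u. 0 < u \<and> triple_code a z u \<in> set_decode D) \<longleftrightarrow> (\<exists>u<D. 0 < u \<and> triple_code a z u \<in> set_decode D)"
    for a z Q using triple_code_less(2) by blast+
  show ?thesis unfolding justified_def justified_below_def Let_def * by (rule refl)
qed

lemma certificate_below: "certificate R (set_decode D) \<longleftrightarrow>
   (\<forall>z<D. z \<in> set_decode D \<longrightarrow> justified_below R D (pfst z) (pfst (psnd z)) (psnd (psnd z)))"
proof -
  have "(\<forall>e x y. Q (triple_code e x y) e x y) \<longleftrightarrow> (\<forall>z. Q z (pfst z) (pfst (psnd z)) (psnd (psnd z)))" for Q
    by (metis triple_code_decode triple_code_def prod_encode_inverse fst_conv snd_conv)
  from this[of "\<lambda>z e x y. z \<in> set_decode D \<longrightarrow> justified_below R D e x y"] show ?thesis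
    unfolding certificate_def justified_below using set_decode_less by blast
qed

lemma eff_triple_code [eff]:
  "effective A \<Longrightarrow> effective B \<Longrightarrow> effective C \<Longrightarrow> effective (\<lambda>g x. triple_code (A g x) (B g x) (C g x))"
  unfolding triple_code_def by (intro eff)

text \<open>The parameter \<open>P\<close> lets the oracle relation vary with the input; in the
  applications it is the code of a finite string that serves as a partial oracle.\<close>

lemma dec_certificate:
  assumes R: "decidable (\<lambda>g z. R g (pfst z) (pfst (psnd z)) (psnd (psnd z)))"
    and "effective P" "effective D"
  shows "decidable (\<lambda>g x. certificate (R g (P g x)) (set_decode (D g x)))"
proof -
  have "decidable (\<lambda>g z. certificate (R g (pfst z)) (set_decode (psnd z)))"
    unfolding certificate_below justified_below_def by (intro eff eff_comp3[OF R])
  from dec_comp2[OF this assms(2,3)] show ?thesis .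
qed

section \<open>Forcing with bushy trees\<close>

text \<open>Strings are stored with the last entry first, so that \<open>i # \<tau>\<close> is a child of \<open>\<tau>\<close>.\<close>

primrec rseg :: "(nat \<Rightarrow> 'a) \<Rightarrow> nat \<Rightarrow> 'a list" where
  "rseg f 0 = []"
| "rseg f (Suc k) = f k # rseg f k"

lemma length_rseg [simp]: "length (rseg f k) = k"
  by (induction k) auto

lemma rseg_nth: "m < k \<Longrightarrow> rseg f k ! (k - Suc m) = f m"
  by (induction k) (auto simp: less_Suc_eq nth_Cons' Suc_diff_Suc)

text \<open>
  Above \<open>\<tau>\<close> there is a finite tree with leaves in \<open>C\<close>, each of whose inner nodes of length
  \<open>m\<close> has more than \<open>t m\<close> children (among the \<open>bnd m\<close> possible ones).
\<close>

inductive big :: "(nat \<Rightarrow> nat) \<Rightarrow> (nat \<Rightarrow> nat) \<Rightarrow> (nat list \<Rightarrow> bool) \<Rightarrow> nat list \<Rightarrow> bool"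
  for bnd t C where
  leaf: "C \<tau> \<Longrightarrow> big bnd t C \<tau>"
| node: "I \<subseteq> {..<bnd (length \<tau>)} \<Longrightarrow> t (length \<tau>) < card I \<Longrightarrow>
    (\<And>i. i \<in> I \<Longrightarrow> big bnd t C (i # \<tau>)) \<Longrightarrow> big bnd t C \<tau>"

text \<open>More than \<open>t\<close> big children would make \<tau> big by the rule
  \<open>node\<close>. This bounds the children lost per level and value by keeping a requirement
  active.\<close>

lemma card_big_children:
  assumes "\<not> big bnd t C \<tau>"
  shows "card {i. i < bnd (length \<tau>) \<and> big bnd t C (i # \<tau>)} \<le> t (length \<tau>)"
proof (rule ccontr)
  assume "\<not> ?thesis"
  then have *: "t (length \<tau>) < card {i. i < bnd (length \<tau>) \<and> big bnd t C (i # \<tau>)}" by simp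
  have "big bnd t C \<tau>" by (rule big.node[where bnd = bnd and t = t and C = C and \<tau> = \<tau>, OF _ *]) (blast, blast)
  with assms show False by contradiction
qed

text \<open>An inner node has more than \<open>t\<close> children in the tree and at most
  \<open>t\<close> children that are not \<open>ok\<close>, so one can climb through
  \<open>ok\<close> nodes up to a leaf.\<close>

lemma big_avoid:
  assumes "big bnd t C \<sigma>" "ok \<sigma>" "n \<le> length \<sigma>"
    and "\<And>\<tau>. ok \<tau> \<Longrightarrow> n \<le> length \<tau> \<Longrightarrow> card {i. i < bnd (length \<tau>) \<and> \<not> ok (i # \<tau>)} \<le> t (length \<tau>)"
  shows "\<exists>\<rho>. ok (\<rho> @ \<sigma>) \<and> C (\<rho> @ \<sigma>)"
  using assms(1-3)
proof (induction rule: big.induct)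
  case (leaf \<tau>)
  then show ?case by (intro exI[of _ "[]"]) simp
next
  case (node I \<tau>)
  let ?X = "{i. i < bnd (length \<tau>) \<and> \<not> ok (i # \<tau>)}"
  have "card ?X < card I" using assms(4)[OF node.prems] node.hyps(2) by simp
  then have "\<not> I \<subseteq> ?X" using card_mono[of ?X I] by force
  then obtain i where i: "i \<in> I" "ok (i # \<tau>)" using node.hyps(1) by auto
  from node.IH[OF i] node.prems(2) obtain \<rho> where "ok (\<rho> @ i # \<tau>)" "C (\<rho> @ i # \<tau>)" by auto
  then show ?case by (intro exI[of _ "\<rho> @ [i]"]) simp
qed

text \<open>
  \<open>C n v \<tau>\<close> stands for ``the computation assigned to the requirement \<open>n\<close> yields \<open>v\<close> along \<open>\<tau>\<close>'',
  \<open>E m\<close> is the set of forbidden values at level \<open>m\<close>, and \<open>c n\<close> bounds the values of interest for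
  \<open>n\<close>.  A requirement whose sets \<open>C n v\<close> are not big stays active: from then on the
  children that would make one of them big are avoided.  There are at most \<open>t n m\<close> of these for
  each \<open>v\<close>, and \<open>budget\<close> says that a big set survives the losses caused by \<open>E\<close> and by the
  requirements that were treated before.
\<close>

locale forcing =
  fixes bnd :: "nat \<Rightarrow> nat" and t :: "nat \<Rightarrow> nat \<Rightarrow> nat" and C :: "nat \<Rightarrow> nat \<Rightarrow> nat list \<Rightarrow> bool"
    and E :: "nat \<Rightarrow> nat set" and c :: "nat \<Rightarrow> nat" and N :: "nat set"
    and sel :: "nat \<Rightarrow> nat list \<Rightarrow> nat \<Rightarrow> bool" and enum :: "nat \<Rightarrow> nat"
  assumes C_mono: "C n v \<sigma> \<Longrightarrow> C n v (\<rho> @ \<sigma>)"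
    and finite_E: "finite (E m)"
    and budget: "n \<in> N \<Longrightarrow> n \<le> m \<Longrightarrow> card (E m) + (\<Sum>j\<in>N \<inter> {..<n}. c j * t j m) \<le> t n m"
    and budget_bnd: "card (E m) + (\<Sum>j\<in>N \<inter> {..m}. c j * t j m) < bnd m"
    and enum: "\<exists>n\<in>N. l < n \<and> enum n = k"
    and sel: "n \<in> N \<Longrightarrow> length \<sigma> = n \<Longrightarrow> big bnd (t n) (C n v) \<sigma> \<Longrightarrow>
      \<exists>v. sel n \<sigma> v \<and> big bnd (t n) (C n v) \<sigma>"
begin

primrec good :: "nat list \<Rightarrow> bool" where
  "good [] = True"
| "good (i # \<tau>) = (i < bnd (length \<tau>) \<and> i \<notin> E (length \<tau>) \<and> good \<tau>)"

text \<open>\<open>J\<close> is the set of active requirements.\<close>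

definition ok :: "nat set \<Rightarrow> nat list \<Rightarrow> bool" where
  "ok J \<tau> \<longleftrightarrow> good \<tau> \<and> (\<forall>j\<in>J. \<forall>v<c j. \<not> big bnd (t j) (C j v) \<tau>)"

lemma card_not_ok:
  assumes "finite J" "ok J \<tau>"
  shows "card {i. i < bnd (length \<tau>) \<and> \<not> ok J (i # \<tau>)}
    \<le> card (E (length \<tau>)) + (\<Sum>j\<in>J. c j * t j (length \<tau>))"
proof -
  let ?B = "\<lambda>j v. {i. i < bnd (length \<tau>) \<and> big bnd (t j) (C j v) (i # \<tau>)}"
  have "{i. i < bnd (length \<tau>) \<and> \<not> ok J (i # \<tau>)} \<subseteq> E (length \<tau>) \<union> (\<Union>j\<in>J. \<Union>v<c j. ?B j v)"
    using assms(2) by (auto simp: ok_def)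
  then have "card {i. i < bnd (length \<tau>) \<and> \<not> ok J (i # \<tau>)}
      \<le> card (E (length \<tau>) \<union> (\<Union>j\<in>J. \<Union>v<c j. ?B j v))"
    by (intro card_mono) (use finite_E assms(1) in auto)
  also have "\<dots> \<le> card (E (length \<tau>)) + card (\<Union>j\<in>J. \<Union>v<c j. ?B j v)" by (rule card_Un_le)
  also have "\<dots> \<le> card (E (length \<tau>)) + (\<Sum>j\<in>J. c j * t j (length \<tau>))"
  proof -
    have "card (\<Union>v<c j. ?B j v) \<le> c j * t j (length \<tau>)" if "j \<in> J" for j
    proof -
      have "card (\<Union>v<c j. ?B j v) \<le> (\<Sum>v<c j. card (?B j v))" by (rule card_UN_le) simp
      also have "\<dots> \<le> (\<Sum>v<c j. t j (length \<tau>))"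
        by (intro sum_mono card_big_children) (use assms(2) that in \<open>auto simp: ok_def\<close>)
      finally show ?thesis by simp
    qed
    then have "(\<Sum>j\<in>J. card (\<Union>v<c j. ?B j v)) \<le> (\<Sum>j\<in>J. c j * t j (length \<tau>))" by (rule sum_mono)
    with card_UN_le[OF assms(1), of "\<lambda>j. \<Union>v<c j. ?B j v"] show ?thesis by linarith
  qed
  finally show ?thesis .
qed

text \<open>Active requirements do not exceed the current level, which is the range of the sum in
  \<open>budget_bnd\<close>.\<close>

definition invariant :: "nat list \<Rightarrow> nat set \<Rightarrow> bool" where
  "invariant \<sigma> J \<longleftrightarrow> J \<subseteq> N \<inter> {..length \<sigma>} \<and> ok J \<sigma>"

lemma invariant_extend1:
  assumes "invariant \<sigma> J"
  shows "\<exists>i. invariant (i # \<sigma>) J"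
proof -
  have J: "J \<subseteq> N \<inter> {..length \<sigma>}" "ok J \<sigma>" using assms by (auto simp: invariant_def)
  then have fin: "finite J" by (meson finite_Int finite_atMost finite_subset)
  have "card {i. i < bnd (length \<sigma>) \<and> \<not> ok J (i # \<sigma>)}
      \<le> card (E (length \<sigma>)) + (\<Sum>j\<in>J. c j * t j (length \<sigma>))" by (rule card_not_ok[OF fin J(2)])
  also have "\<dots> \<le> card (E (length \<sigma>)) + (\<Sum>j\<in>N \<inter> {..length \<sigma>}. c j * t j (length \<sigma>))"
    using J(1) by (intro add_left_mono sum_mono2) auto
  also have "\<dots> < bnd (length \<sigma>)" by (rule budget_bnd)
  finally have "{i. i < bnd (length \<sigma>) \<and> \<not> ok J (i # \<sigma>)} \<noteq> {..<bnd (length \<sigma>)}"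
    by (metis card_lessThan less_irrefl)
  then obtain i where "i < bnd (length \<sigma>)" "ok J (i # \<sigma>)" by auto
  then show ?thesis using J(1) by (intro exI[of _ i]) (auto simp: invariant_def)
qed

lemma invariant_extend:
  assumes "invariant \<sigma> J" "length \<sigma> \<le> n"
  shows "\<exists>\<rho>. invariant (\<rho> @ \<sigma>) J \<and> length (\<rho> @ \<sigma>) = n"
  using assms(2)
proof (induction n rule: dec_induct)
  case base
  then show ?case using assms(1) by (intro exI[of _ "[]"]) simp
next
  case (step n)
  then obtain \<rho> where "invariant (\<rho> @ \<sigma>) J" "length (\<rho> @ \<sigma>) = n" by blast
  with invariant_extend1[of "\<rho> @ \<sigma>" J] obtain i where "invariant (i # \<rho> @ \<sigma>) J" by blast
  then show ?case using \<open>length (\<rho> @ \<sigma>) = n\<close> by (intro exI[of _ "i # \<rho>"]) simp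
qed

definition met :: "nat \<Rightarrow> nat list \<Rightarrow> nat set \<Rightarrow> bool" where
  "met k \<sigma> J \<longleftrightarrow> (\<exists>n\<in>N. enum n = k \<and>
     (n \<in> J \<or> (\<exists>\<rho> \<sigma>' v. \<sigma> = \<rho> @ \<sigma>' \<and> length \<sigma>' = n \<and> sel n \<sigma>' v \<and> C n v \<sigma>)))"

text \<open>Extend to a fresh level assigned to \<open>k\<close>. If no value of interest is big
  there, the requirement becomes active; otherwise climb to a leaf at which the selected value is
  computed, keeping the older active requirements intact.\<close>

lemma invariant_step:
  assumes "invariant \<sigma> J"
  shows "\<exists>\<rho> J'. invariant (\<rho> @ \<sigma>) J' \<and> \<rho> \<noteq> [] \<and> J \<subseteq> J' \<and> met k (\<rho> @ \<sigma>) J'"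
proof -
  obtain n where n: "n \<in> N" "length \<sigma> < n" "enum n = k" using enum by blast
  with invariant_extend[OF assms, of n] obtain \<rho> where \<rho>: "invariant (\<rho> @ \<sigma>) J" "length (\<rho> @ \<sigma>) = n" by auto
  \<comment> \<open>Since \<open>n\<close> lies strictly above the old length, all active
    requirements precede \<open>n\<close>, as in the sum in \<open>budget\<close>.\<close>
  have J: "J \<subseteq> N \<inter> {..<n}" using assms n(2) by (auto simp: invariant_def)
  then have fin: "finite J" by (meson finite_Int finite_lessThan finite_subset)
  have ne: "\<rho> \<noteq> []" using \<rho>(2) n(2) by auto
  show ?thesis
  proof (cases "\<forall>v<c n. \<not> big bnd (t n) (C n v) (\<rho> @ \<sigma>)")
    case True
    then have "invariant (\<rho> @ \<sigma>) (insert n J)" using \<rho> n by (auto simp: invariant_def ok_def)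
    then show ?thesis using ne n by (intro exI[of _ \<rho>] exI[of _ "insert n J"]) (auto simp: met_def)
  next
    case False
    \<comment> \<open>The selected value may differ from the big one found below \<open>c n\<close>,
      and need not itself lie below \<open>c n\<close>.\<close>
    then obtain v where v: "sel n (\<rho> @ \<sigma>) v" "big bnd (t n) (C n v) (\<rho> @ \<sigma>)"
      using sel[OF n(1) \<rho>(2)] by blast
    have "card {i. i < bnd (length \<tau>) \<and> \<not> ok J (i # \<tau>)} \<le> t n (length \<tau>)"
      if "ok J \<tau>" "n \<le> length \<tau>" for \<tau>
    proof -
      have "card {i. i < bnd (length \<tau>) \<and> \<not> ok J (i # \<tau>)}
          \<le> card (E (length \<tau>)) + (\<Sum>j\<in>J. c j * t j (length \<tau>))" by (rule card_not_ok[OF fin that(1)])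
      also have "\<dots> \<le> card (E (length \<tau>)) + (\<Sum>j\<in>N \<inter> {..<n}. c j * t j (length \<tau>))"
        using J by (intro add_left_mono sum_mono2) auto
      also have "\<dots> \<le> t n (length \<tau>)" by (rule budget[OF n(1) that(2)])
      finally show ?thesis .
    qed
    from big_avoid[of bnd "t n" "C n v" "\<rho> @ \<sigma>" "ok J" n, OF v(2) _ _ this] \<rho>
    obtain \<mu> where \<mu>: "ok J (\<mu> @ \<rho> @ \<sigma>)" "C n v (\<mu> @ \<rho> @ \<sigma>)" by (auto simp: invariant_def)
    then have "invariant ((\<mu> @ \<rho>) @ \<sigma>) J" using J \<rho>(2) by (auto simp: invariant_def)
    moreover have "met k ((\<mu> @ \<rho>) @ \<sigma>) J"
      unfolding met_def using n \<mu>(2) v(1) \<rho>(2) by (metis append.assoc)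
    ultimately show ?thesis using ne by blast
  qed
qed

theorem generic_exists:
  obtains x where "\<And>m. x m < bnd m" "\<And>m. x m \<notin> E m"
    "\<And>k. \<exists>n\<in>N. enum n = k \<and> ((\<forall>v<c n. \<forall>l. \<not> C n v (rseg x l)) \<or>
       (\<exists>v l. sel n (rseg x n) v \<and> C n v (rseg x l)))"
proof -
  define Q where "Q p q \<longleftrightarrow> (\<exists>\<rho>. \<rho> \<noteq> [] \<and> fst q = \<rho> @ fst p \<and> snd p \<subseteq> snd q)" for p q :: "nat list \<times> nat set"
  \<comment> \<open>Stage \<open>Suc k\<close> meets the index \<open>k\<close>; stage 0 is the
    empty string without active requirements.\<close>
  have "\<exists>s. \<forall>k. (invariant (fst (s k)) (snd (s k)) \<and> (k > 0 \<longrightarrow> met (k - 1) (fst (s k)) (snd (s k)))) \<and> Q (s k) (s (Suc k))"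
  proof (rule dependent_nat_choice[where Q="\<lambda>_. Q"])
    show "\<exists>p. invariant (fst p) (snd p) \<and> (0 < (0::nat) \<longrightarrow> met (0 - 1) (fst p) (snd p))"
      by (intro exI[of _ "([], {})"]) (simp add: invariant_def ok_def)
    fix p :: "nat list \<times> nat set" and k :: nat
    assume "invariant (fst p) (snd p) \<and> (0 < k \<longrightarrow> met (k - 1) (fst p) (snd p))"
    with invariant_step[of "fst p" "snd p" k] obtain \<rho> J' where
      "invariant (\<rho> @ fst p) J'" "\<rho> \<noteq> []" "snd p \<subseteq> J'" "met k (\<rho> @ fst p) J'" by blast
    then show "\<exists>q. (invariant (fst q) (snd q) \<and> (0 < Suc k \<longrightarrow> met (Suc k - 1) (fst q) (snd q))) \<and> Q p q"
      by (intro exI[of _ "(\<rho> @ fst p, J')"]) (auto simp: Q_def)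
  qed
  then obtain s where s: "\<And>k. invariant (fst (s k)) (snd (s k))" "\<And>k. met k (fst (s (Suc k))) (snd (s (Suc k)))"
    "\<And>k. Q (s k) (s (Suc k))" by (metis diff_Suc_1 zero_less_Suc)
  define \<sigma> where "\<sigma> k = fst (s k)" for k
  have ext: "\<exists>\<rho>. \<sigma> l = \<rho> @ \<sigma> k" if "k \<le> l" for k l
    using that
  proof (induction l rule: dec_induct)
    case (step l)
    then show ?case using s(3)[of l] unfolding Q_def \<sigma>_def by (metis append.assoc)
  qed simp
  have J_mono: "snd (s k) \<subseteq> snd (s l)" if "k \<le> l" for k l
    using that
  proof (induction l rule: dec_induct)
    case (step l)
    then show ?case using s(3)[of l] unfolding Q_def by blast
  qed simp
  have len: "k \<le> length (\<sigma> k)" for k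
  proof (induction k)
    case (Suc k)
    obtain \<rho> where "\<rho> \<noteq> []" "\<sigma> (Suc k) = \<rho> @ \<sigma> k" using s(3)[of k] by (auto simp: Q_def \<sigma>_def)
    then show ?case using Suc by (cases \<rho>) auto
  qed simp
  \<comment> \<open>Stage \<open>Suc m\<close> has length at least \<open>Suc m\<close>, so it
    decides the entry \<open>m\<close>, counted from the end because strings are reversed.\<close>
  define x where "x m = \<sigma> (Suc m) ! (length (\<sigma> (Suc m)) - Suc m)" for m
  have x: "\<sigma> k ! (length (\<sigma> k) - Suc m) = x m" if "m < length (\<sigma> k)" for k m
  proof -
    have *: "\<sigma> l ! (length (\<sigma> l) - Suc m) = \<sigma> k ! (length (\<sigma> k) - Suc m)"
      if "k \<le> l" "m < length (\<sigma> k)" for k l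
      using ext[OF that(1)] that(2) by (auto simp: nth_append)
    show ?thesis
    proof (cases "k \<le> Suc m")
      case True
      then show ?thesis using *[OF True that] by (simp add: x_def)
    next
      case False
      then show ?thesis using *[of "Suc m" k] len[of "Suc m"] by (simp add: x_def)
    qed
  qed
  have seg: "\<sigma> k = rseg x (length (\<sigma> k))" for k
  proof (rule nth_equalityI)
    fix i assume i: "i < length (\<sigma> k)"
    then show "\<sigma> k ! i = rseg x (length (\<sigma> k)) ! i"
      using x[of "length (\<sigma> k) - Suc i" k] rseg_nth[of "length (\<sigma> k) - Suc i" "length (\<sigma> k)" x] by simp
  qed simp
  have app: "rseg x l = take (l - k) (rseg x l) @ rseg x k" if "k \<le> l" for k l
    using that by (induction l rule: dec_induct) (simp_all add: Suc_diff_le)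
  have good_seg: "good (rseg x k)" for k
  proof -
    have "good (\<sigma> k)" using s(1)[of k] by (simp add: invariant_def ok_def \<sigma>_def)
    moreover have "good (\<rho> @ \<tau>) \<Longrightarrow> good \<tau>" for \<rho> \<tau> by (induction \<rho>) auto
    ultimately show ?thesis using app[OF len[of k]] seg[of k] by metis
  qed
  show ?thesis
  proof
    show "x m < bnd m" "x m \<notin> E m" for m using good_seg[of "Suc m"] by auto
    fix k
    obtain n where n: "n \<in> N" "enum n = k" and alt: "n \<in> snd (s (Suc k)) \<or> 
       (\<exists>\<rho> \<sigma>' v. \<sigma> (Suc k) = \<rho> @ \<sigma>' \<and> length \<sigma>' = n \<and> sel n \<sigma>' v \<and> C n v (\<sigma> (Suc k)))"
      using s(2)[of k] unfolding met_def \<sigma>_def by blast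
    from alt show "\<exists>n\<in>N. enum n = k \<and> ((\<forall>v<c n. \<forall>l. \<not> C n v (rseg x l)) \<or>
       (\<exists>v l. sel n (rseg x n) v \<and> C n v (rseg x l)))"
    proof (elim disjE exE conjE)
      assume J: "n \<in> snd (s (Suc k))"
      have "\<not> C n v (rseg x l)" if "v < c n" for v l
      proof
        assume "C n v (rseg x l)"
        \<comment> \<open>From this stage on the string extends \<open>rseg x l\<close> and
          \<open>n\<close> is still active, so halting along \<open>rseg x l\<close> would violate
          the invariant.\<close>
        define l' where "l' = max l (Suc k)"
        have "l \<le> length (\<sigma> l')" using len[of l'] by (simp add: l'_def)
        then have "C n v (rseg x (length (\<sigma> l')))" using app C_mono[OF \<open>C n v (rseg x l)\<close>] by metis
        then have "big bnd (t n) (C n v) (\<sigma> l')" using seg[of l'] by (simp add: big.leaf)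
        moreover have "n \<in> snd (s l')" using J J_mono[of "Suc k" l'] by (auto simp: l'_def)
        ultimately show False using s(1)[of l'] that by (auto simp: invariant_def ok_def \<sigma>_def)
      qed
      then show ?thesis using n by blast
    next
      fix \<rho> \<sigma>' v
      assume *: "\<sigma> (Suc k) = \<rho> @ \<sigma>'" "length \<sigma>' = n" "sel n \<sigma>' v" "C n v (\<sigma> (Suc k))"
      have "n \<le> length (\<sigma> (Suc k))" using * by simp
      from app[OF this] have "\<rho> @ \<sigma>' = take (length (\<sigma> (Suc k)) - n) (rseg x (length (\<sigma> (Suc k)))) @ rseg x n"
        using *(1) seg[of "Suc k"] by simp
      then have "\<sigma>' = rseg x n" using *(2) by (metis append_eq_append_conv length_rseg)
      then show ?thesis using n * seg[of "Suc k"] by metis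
    qed
  qed
qed

end

section \<open>Two incomparable effectively closed classes\<close>

text \<open>
  \<open>level_bound k\<close> bounds the values at level \<open>k\<close> and \<open>total_bound k\<close> is the product of the
  earlier bounds, hence bounds the number of strings of length \<open>k\<close>.  With
  \<open>B = total_bound m + 2\<close>, the thresholds \<open>B ^ (n + 1)\<close> at level \<open>m\<close> satisfy the budget
  conditions because \<open>(B - 1) * (\<Sum>j<n. B ^ (j + 1)) + B = B ^ (n + 1)\<close>.
\<close>

primrec total_bound :: "nat \<Rightarrow> nat" where
  "total_bound 0 = 1"
| "total_bound (Suc k) = total_bound k * (total_bound k + 2) ^ (k + 2)"

definition level_bound :: "nat \<Rightarrow> nat" where "level_bound k = (total_bound k + 2) ^ (k + 2)"

text \<open>
  The class with index \<open>p \<in> {0, 1}\<close> has free values only at the levels of parity \<open>p\<close>; at the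
  other levels, which carry the requirements of that class, the value is 0.
\<close>

definition value_bound :: "nat \<Rightarrow> nat \<Rightarrow> nat" where
  "value_bound p m = (if m mod 2 = p then level_bound m else 1)"

definition threshold :: "nat \<Rightarrow> nat \<Rightarrow> nat \<Rightarrow> nat" where
  "threshold p n m = (if m mod 2 = p then (total_bound m + 2) ^ (n + 1) else 0)"

text \<open>Halving forgets the parity and the second component of the pair is padding: every
  program owns arbitrarily high levels of both parities.\<close>

definition requirement :: "nat \<Rightarrow> nat" where "requirement n = pfst (n div 2)"

text \<open>Sequences are passed to programs as characteristic functions, to remain in Cantor space.\<close>

definition graph :: "(nat \<Rightarrow> nat) \<Rightarrow> nat \<Rightarrow> nat" where
  "graph x q = of_bool (x (pfst q) = psnd q)"

text \<open>The finite part of the oracle \<open>graph x\<close> that a reversed string decides,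
  namely the queries about levels below its length.\<close>

definition list_oracle :: "nat list \<Rightarrow> nat \<Rightarrow> nat \<Rightarrow> bool" where
  "list_oracle \<tau> q y \<longleftrightarrow>
     pfst q < length \<tau> \<and> y = of_bool (lnth \<tau> (length \<tau> - Suc (pfst q)) = psnd q)"

text \<open>Output 1 at \<open>(n, v)\<close> means that the computed graph asserts the value
  \<open>v\<close> at level \<open>n\<close>.\<close>

definition converges_at :: "nat \<Rightarrow> nat \<Rightarrow> nat list \<Rightarrow> nat \<Rightarrow> bool" where
  "converges_at n v \<tau> D \<longleftrightarrow> triple_code (requirement n) (prod_encode (n, v)) 1 \<in> set_decode D \<and>
     certificate (list_oracle \<tau>) (set_decode D)"

definition converges :: "nat \<Rightarrow> nat \<Rightarrow> nat list \<Rightarrow> bool" where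
  "converges n v \<tau> \<longleftrightarrow> (\<exists>D. converges_at n v \<tau> D)"

text \<open>
  \<open>set_decode T\<close> contains the nodes of the tree, and \<open>b\<close> bounds the halting certificates at its leaves.
\<close>

definition big_witness :: "nat \<Rightarrow> nat \<Rightarrow> nat \<Rightarrow> nat \<Rightarrow> nat \<Rightarrow> nat \<Rightarrow> bool" where
  "big_witness p n v s T b \<longleftrightarrow> s \<in> set_decode T \<and> (\<forall>z<T. z \<in> set_decode T \<longrightarrow>
     (\<exists>D<b. converges_at n v (list_decode z) D) \<or>
     threshold p n (length (list_decode z)) <
       card {i. i < value_bound p (length (list_decode z)) \<and> Suc (prod_encode (i, z)) \<in> set_decode T})"

text \<open>Value, tree and certificate bound are packed into one number, so the least witness
  determines a single value.\<close>

definition witness :: "nat \<Rightarrow> nat \<Rightarrow> nat \<Rightarrow> nat \<Rightarrow> bool" where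
  "witness p n s k \<longleftrightarrow> big_witness p n (pfst k) s (pfst (psnd k)) (psnd (psnd k))"

definition first_witness :: "nat \<Rightarrow> nat \<Rightarrow> nat \<Rightarrow> nat \<Rightarrow> bool" where
  "first_witness p n s k \<longleftrightarrow> witness p n s k \<and> (\<forall>k'<k. \<not> witness p n s k')"

definition selected :: "nat \<Rightarrow> nat \<Rightarrow> nat list \<Rightarrow> nat \<Rightarrow> bool" where
  "selected p n \<sigma> v \<longleftrightarrow> (\<exists>k. first_witness p n (list_encode \<sigma>) k \<and> pfst k = v)"

definition bounded :: "nat \<Rightarrow> nat list \<Rightarrow> bool" where
  "bounded p \<sigma> \<longleftrightarrow> (\<forall>i<length \<sigma>. lnth \<sigma> i < value_bound p (length \<sigma> - Suc i))"

text \<open>Level \<open>m\<close> has the parity of \<open>p\<close>. There class \<open>p\<close>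
  has free values, while class \<open>1 - p\<close> is trivial and carries its requirement.\<close>

definition excluded :: "nat \<Rightarrow> nat \<Rightarrow> nat set" where
  "excluded p m = {v. m mod 2 = p \<and> (\<exists>\<sigma>. length \<sigma> = m \<and> bounded (1 - p) \<sigma> \<and> selected (1 - p) m \<sigma> v)}"

definition avoiding_seqs :: "nat \<Rightarrow> (nat \<Rightarrow> nat) set" where
  "avoiding_seqs p = {x. \<forall>m. x m < value_bound p m \<and> x m \<notin> excluded p m}"

definition avoiding_class :: "nat \<Rightarrow> (nat \<Rightarrow> nat) set" where
  "avoiding_class p = graph ` avoiding_seqs p"

section \<open>Convergence along strings and the search for bushy trees\<close>

lemma pfst_le: "pfst q \<le> q"
  using le_prod_encode_1[of "pfst q" "psnd q"] by simp

lemma list_oracle_graph: "list_oracle (rseg x l) q y \<Longrightarrow> graph x q = y"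
  by (auto simp: list_oracle_def graph_def lnth_def rseg_nth)

lemma converges_sound:
  assumes "converges n v (rseg x l)"
  shows "run (graph x) (prog_of (requirement n)) (prod_encode (n, v)) = Some 1"
proof -
  obtain D where D: "triple_code (requirement n) (prod_encode (n, v)) 1 \<in> set_decode D"
    "certificate (list_oracle (rseg x l)) (set_decode D)"
    using assms unfolding converges_def converges_at_def by blast
  from certificate_sound[OF D(2) list_oracle_graph D(1)] show ?thesis .
qed

lemma converges_complete:
  assumes "run (graph x) (prog_of (requirement n)) (prod_encode (n, v)) = Some 1"
  shows "\<exists>l. converges n v (rseg x l)"
proof -
  obtain D N where D: "triple_code (requirement n) (prod_encode (n, v)) 1 \<in> set_decode D"
    and N: "certificate (\<lambda>q y. q < N \<and> graph x q = y) (set_decode D)"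
    using certificate_complete[OF assms] by blast
  \<comment> \<open>A query code below \<open>N\<close> asks about a level below \<open>N\<close>,
    so the string of length \<open>N\<close> answers it.\<close>
  have "list_oracle (rseg x N) q y" if "q < N \<and> graph x q = y" for q y
    using that pfst_le[of q] by (auto simp: list_oracle_def graph_def lnth_def rseg_nth)
  then have "certificate (list_oracle (rseg x N)) (set_decode D)" by (rule certificate_mono[OF N])
  then show ?thesis using D unfolding converges_def converges_at_def by blast
qed

lemma converges_mono:
  assumes "converges n v \<tau>" shows "converges n v (\<rho> @ \<tau>)"
proof -
  have "list_oracle (\<rho> @ \<tau>) q y" if "list_oracle \<tau> q y" for q y
    using that by (auto simp: list_oracle_def lnth_def nth_append)
  then show ?thesis using assms certificate_mono unfolding converges_def converges_at_def by blast
qed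

lemma big_witness_sound:
  assumes "big_witness p n v (list_encode \<sigma>) T b"
  shows "big (value_bound p) (threshold p n) (converges n v) \<sigma>"
proof -
  have T: "z \<in> set_decode T \<Longrightarrow> (\<exists>D<b. converges_at n v (list_decode z) D) \<or>
     threshold p n (length (list_decode z)) <
       card {i. i < value_bound p (length (list_decode z)) \<and> Suc (prod_encode (i, z)) \<in> set_decode T}" for z
    using assms set_decode_less[of z T] unfolding big_witness_def by blast
  have "z \<in> set_decode T \<Longrightarrow> big (value_bound p) (threshold p n) (converges n v) (list_decode z)" for z
  \<comment> \<open>Lengths are bounded by codes and codes of nodes are below \<open>T\<close>, so
    this difference decreases from a node to its children.\<close>
  proof (induction "T - length (list_decode z)" arbitrary: z rule: less_induct)
    case less
    let ?I = "{i. i < value_bound p (length (list_decode z)) \<and> Suc (prod_encode (i, z)) \<in> set_decode T}"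
    show ?case
    proof (cases "\<exists>D<b. converges_at n v (list_decode z) D")
      case True
      then show ?thesis by (intro big.leaf) (auto simp: converges_def)
    next
      case False
      then have card: "threshold p n (length (list_decode z)) < card ?I" using T[OF less.prems] by blast
      have "length (list_decode z) < T"
        using set_decode_less[OF less.prems] length_list_decode_le[of z] by simp
      then have "big (value_bound p) (threshold p n) (converges n v) (i # list_decode z)" if "i \<in> ?I" for i
        using that less.hyps[of "Suc (prod_encode (i, z))"] by simp
      then show ?thesis
        by (intro big.node[where bnd="value_bound p" and t="threshold p n" and \<tau>="list_decode z", OF _ card]) auto
    qed
  qed
  from this[of "list_encode \<sigma>"] show ?thesis using assms by (simp add: big_witness_def)
qed

text \<open>The finite trees above the children can be united with the root, because further nodes
  and a larger certificate bound preserve the condition at each node.\<close>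

lemma big_witness_complete:
  assumes "big (value_bound p) (threshold p n) (converges n v) \<sigma>"
  shows "\<exists>T b. big_witness p n v (list_encode \<sigma>) T b"
proof -
  define W where "W S b \<longleftrightarrow> finite S \<and> (\<forall>z\<in>S. (\<exists>D<b. converges_at n v (list_decode z) D) \<or>
     threshold p n (length (list_decode z)) <
       card {i. i < value_bound p (length (list_decode z)) \<and> Suc (prod_encode (i, z)) \<in> S})" for S b
  have mono: "(\<exists>D<b'. converges_at n v (list_decode z) D) \<or>
     threshold p n (length (list_decode z)) <
       card {i. i < value_bound p (length (list_decode z)) \<and> Suc (prod_encode (i, z)) \<in> S'}"
    if "W S b" "S \<subseteq> S'" "b \<le> b'" "z \<in> S" for S S' b b' z
  proof -
    have "card {i. i < value_bound p (length (list_decode z)) \<and> Suc (prod_encode (i, z)) \<in> S} \<le>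
      card {i. i < value_bound p (length (list_decode z)) \<and> Suc (prod_encode (i, z)) \<in> S'}"
      using that(2) by (intro card_mono) auto
    then show ?thesis using that unfolding W_def by (meson less_le_trans)
  qed
  have "\<exists>S b. list_encode \<sigma> \<in> S \<and> W S b"
    using assms
  proof (induction rule: big.induct)
    case (leaf \<tau>)
    then obtain D where "converges_at n v \<tau> D" by (auto simp: converges_def)
    then show ?case by (intro exI[of _ "{list_encode \<tau>}"] exI[of _ "Suc D"]) (auto simp: W_def)
  next
    case (node I \<tau>)
    have "\<forall>i\<in>I. \<exists>S b. list_encode (i # \<tau>) \<in> S \<and> W S b" using node.IH by blast
    then obtain S b where Sb: "\<And>i. i \<in> I \<Longrightarrow> list_encode (i # \<tau>) \<in> S i \<and> W (S i) (b i)"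
      by metis
    have finI: "finite I" using node.hyps(1) finite_subset by blast
    define S' where "S' = insert (list_encode \<tau>) (\<Union>i\<in>I. S i)"
    define b' where "b' = Max (insert 0 (b ` I))"
    have "(\<exists>D<b'. converges_at n v (list_decode z) D) \<or> threshold p n (length (list_decode z)) <
       card {i. i < value_bound p (length (list_decode z)) \<and> Suc (prod_encode (i, z)) \<in> S'}" if z: "z \<in> S'" for z
    proof (cases "z = list_encode \<tau>")
      case True
      have "card I \<le> card {i. i < value_bound p (length \<tau>) \<and> Suc (prod_encode (i, list_encode \<tau>)) \<in> S'}"
        using Sb node.hyps(1) by (intro card_mono) (auto simp: S'_def)
      then show ?thesis using node.hyps(2) True by simp
    next
      case False
      then obtain i where "i \<in> I" "z \<in> S i" using z by (auto simp: S'_def)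
      moreover have "b i \<le> b'" using \<open>i \<in> I\<close> finI by (simp add: b'_def)
      moreover have "S i \<subseteq> S'" using \<open>i \<in> I\<close> by (auto simp: S'_def)
      ultimately show ?thesis using Sb mono by blast
    qed
    moreover have "finite S'" using finI Sb by (auto simp: S'_def W_def)
    ultimately have "W S' b'" by (simp add: W_def)
    then show ?case by (intro exI[of _ S'] exI[of _ b']) (simp add: S'_def)
  qed
  then obtain S b where S: "list_encode \<sigma> \<in> S" "W S b" by blast
  then have "set_decode (set_encode S) = S" by (simp add: W_def)
  then show ?thesis using S unfolding big_witness_def W_def by metis
qed

lemma witness_iff: "(\<exists>k. witness p n (list_encode \<sigma>) k \<and> pfst k = v) \<longleftrightarrow> big (value_bound p) (threshold p n) (converges n v) \<sigma>"
proof
  assume "big (value_bound p) (threshold p n) (converges n v) \<sigma>"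
  then obtain T b where "big_witness p n v (list_encode \<sigma>) T b" using big_witness_complete by blast
  then show "\<exists>k. witness p n (list_encode \<sigma>) k \<and> pfst k = v"
    by (intro exI[of _ "prod_encode (v, prod_encode (T, b))"]) (simp add: witness_def)
qed (auto simp: witness_def dest: big_witness_sound)

text \<open>The given \<open>v\<close> shows that the search for a witness succeeds; the least
  witness may belong to another value, which is then big as well.\<close>

lemma selected_exists:
  assumes "big (value_bound p) (threshold p n) (converges n v) \<sigma>"
  shows "\<exists>v. selected p n \<sigma> v \<and> big (value_bound p) (threshold p n) (converges n v) \<sigma>"
proof -
  obtain k where k: "witness p n (list_encode \<sigma>) k" using assms witness_iff by blast
  define k0 where "k0 = (LEAST k. witness p n (list_encode \<sigma>) k)"
  have "first_witness p n (list_encode \<sigma>) k0"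
    using LeastI[of "witness p n (list_encode \<sigma>)", OF k] not_less_Least
    unfolding first_witness_def k0_def by blast
  then show ?thesis using witness_iff unfolding selected_def first_witness_def by blast
qed

lemma selected_unique: "selected p n \<sigma> v \<Longrightarrow> selected p n \<sigma> v' \<Longrightarrow> v = v'"
  unfolding selected_def first_witness_def by (metis linorder_neqE_nat)

section \<open>Counting for the budget conditions\<close>

lemma level_bound_pos: "1 \<le> level_bound k"
  unfolding level_bound_def by (rule one_le_power) simp

lemma total_bound_Suc: "total_bound (Suc k) = total_bound k * level_bound k"
  by (simp only: total_bound.simps level_bound_def)

declare total_bound.simps(2) [simp del]

lemma total_bound_pos: "1 \<le> total_bound k"
  using level_bound_pos by (induction k) (simp_all add: total_bound_Suc)

lemma level_bound_le_total: "j < k \<Longrightarrow> level_bound j \<le> total_bound k"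
proof (induction k)
  case (Suc k)
  have "total_bound k \<le> total_bound (Suc k)" "level_bound k \<le> total_bound (Suc k)" using total_bound_pos[of k] level_bound_pos[of k] by (simp_all add: total_bound_Suc)
  then show ?case using Suc by (cases "j = k") auto
qed simp

lemma value_bound_le: "value_bound p m \<le> level_bound m"
  using level_bound_pos[of m] by (simp add: value_bound_def)

lemma bounded_Cons: "bounded p (i # \<tau>) \<longleftrightarrow> i < value_bound p (length \<tau>) \<and> bounded p \<tau>"
  unfolding bounded_def lnth_def by (auto simp: All_less_Suc2)

lemma card_bounded: "finite {\<sigma>. length \<sigma> = m \<and> bounded p \<sigma>} \<and> card {\<sigma>. length \<sigma> = m \<and> bounded p \<sigma>} \<le> total_bound m"
proof (induction m)
  case 0
  have "{\<sigma>. length \<sigma> = 0 \<and> bounded p \<sigma>} = {[]}" by (auto simp: bounded_def)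
  then show ?case by simp
next
  case (Suc m)
  let ?B = "\<lambda>m. {\<sigma>. length \<sigma> = m \<and> bounded p \<sigma>}"
  have sub: "?B (Suc m) \<subseteq> (\<lambda>(i, \<tau>). i # \<tau>) ` ({..<value_bound p m} \<times> ?B m)"
  proof
    fix \<sigma> assume "\<sigma> \<in> ?B (Suc m)"
    then obtain i \<tau> where "\<sigma> = i # \<tau>" "length \<tau> = m" "bounded p (i # \<tau>)" by (auto simp: length_Suc_conv)
    then show "\<sigma> \<in> (\<lambda>(i, \<tau>). i # \<tau>) ` ({..<value_bound p m} \<times> ?B m)" by (force simp: bounded_Cons)
  qed
  have fin: "finite ({..<value_bound p m} \<times> ?B m)" using Suc by blast
  have "card (?B (Suc m)) \<le> card ({..<value_bound p m} \<times> ?B m)"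
    using card_mono[OF finite_imageI[OF fin] sub] card_image_le[OF fin, of "\<lambda>(i, \<tau>). i # \<tau>"] by linarith
  also have "\<dots> = value_bound p m * card (?B m)" by (simp add: card_cartesian_product)
  also have "\<dots> \<le> level_bound m * total_bound m" using Suc value_bound_le by (intro mult_mono) auto
  finally show ?case using finite_subset[OF sub finite_imageI[OF fin]] by (simp add: total_bound_Suc mult.commute)
qed

text \<open>Each bounded string of length \<open>m\<close> excludes at most one value, by
  \<open>selected_unique\<close>, and \<open>total_bound m\<close> bounds the number of these
  strings.\<close>

lemma card_excluded: "finite (excluded p m) \<and> card (excluded p m) \<le> (if m mod 2 = p then total_bound m else 0)"
proof (cases "m mod 2 = p")
  case True
  let ?B = "{\<sigma>. length \<sigma> = m \<and> bounded (1 - p) \<sigma>}"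
  have sub: "excluded p m \<subseteq> (\<lambda>\<sigma>. THE v. selected (1 - p) m \<sigma> v) ` ?B"
  proof
    fix v assume "v \<in> excluded p m"
    then obtain \<sigma> where \<sigma>: "\<sigma> \<in> ?B" "selected (1 - p) m \<sigma> v" by (auto simp: excluded_def)
    then have "(THE v. selected (1 - p) m \<sigma> v) = v" using selected_unique by blast
    then show "v \<in> (\<lambda>\<sigma>. THE v. selected (1 - p) m \<sigma> v) ` ?B" using \<sigma>(1) by force
  qed
  have fin: "finite ?B" "card ?B \<le> total_bound m" using card_bounded by blast+
  have "card (excluded p m) \<le> card ?B"
    using card_mono[OF finite_imageI[OF fin(1)] sub] by (rule le_trans) (rule card_image_le[OF fin(1)])
  then show ?thesis using fin True finite_subset[OF sub] by auto
qed (simp add: excluded_def)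

text \<open>Serves both budget conditions: \<open>n \<le> m\<close> for the thresholds, and
  \<open>n = Suc m\<close> for the number of available values.\<close>

lemma budget_sum:
  assumes "m mod 2 = p" "J \<subseteq> {..<n}" "n \<le> Suc m" "\<forall>j\<in>J. j mod 2 \<noteq> p"
  shows "card (excluded p m) + (\<Sum>j\<in>J. level_bound j * threshold p j m) + 2 \<le> (total_bound m + 2) ^ (n + 1)"
proof -
  let ?B = "total_bound m + 2"
  have "(\<Sum>j\<in>J. level_bound j * threshold p j m) \<le> (\<Sum>j\<in>J. (?B - 1) * ?B ^ (j + 1))"
  proof (rule sum_mono)
    fix j assume j: "j \<in> J"
    \<comment> \<open>Parity rules out \<open>j = m\<close>, so \<open>level_bound j\<close> is one
      of the factors of \<open>total_bound m\<close>.\<close>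
    then have "j \<noteq> m" "j < Suc m" using assms by auto
    then have "level_bound j \<le> total_bound m" by (intro level_bound_le_total) simp
    then show "level_bound j * threshold p j m \<le> (?B - 1) * ?B ^ (j + 1)"
      using assms(1) by (intro mult_mono) (simp_all add: threshold_def)
  qed
  also have "\<dots> \<le> (\<Sum>j<n. (?B - 1) * ?B ^ (j + 1))" using assms(2) by (intro sum_mono2) auto
  finally have 1: "(\<Sum>j\<in>J. level_bound j * threshold p j m) \<le> (\<Sum>j<n. (?B - 1) * ?B ^ (j + 1))" .
  have 2: "(\<Sum>j<n. (?B - 1) * ?B ^ (j + 1)) + ?B = ?B ^ (n + 1)"
    by (induction n) (simp_all add: algebra_simps)
  have "card (excluded p m) \<le> total_bound m" using card_excluded[of p m] assms(1) by auto
  with 1 2 show ?thesis by linarith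
qed

lemma forcing_avoiding_seqs:
  assumes "p < 2"
  shows "forcing (value_bound p) (threshold p) converges (excluded p) level_bound {n. n mod 2 \<noteq> p} (selected p) requirement"
proof
  show "converges n v \<sigma> \<Longrightarrow> converges n v (\<rho> @ \<sigma>)" for n v \<sigma> \<rho> by (rule converges_mono)
  show "finite (excluded p m)" for m by (rule conjunct1[OF card_excluded])
  show "card (excluded p m) + (\<Sum>j\<in>{n. n mod 2 \<noteq> p} \<inter> {..<n}. level_bound j * threshold p j m) \<le> threshold p n m"
    if "n \<le> m" for n m
  \<comment> \<open>At levels of the other parity nothing is excluded and all thresholds are
    0.\<close>
  proof (cases "m mod 2 = p")
    case True
    then have "threshold p n m = (total_bound m + 2) ^ (n + 1)" by (simp only: threshold_def simp_thms if_True)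
    moreover have "card (excluded p m) + (\<Sum>j\<in>{n. n mod 2 \<noteq> p} \<inter> {..<n}. level_bound j * threshold p j m) + 2
        \<le> (total_bound m + 2) ^ (n + 1)"
      by (rule budget_sum[OF True]) (use that in auto)
    ultimately show ?thesis by linarith
  qed (use conjunct2[OF card_excluded[of p m]] in \<open>simp add: threshold_def\<close>)
  show "card (excluded p m) + (\<Sum>j\<in>{n. n mod 2 \<noteq> p} \<inter> {..m}. level_bound j * threshold p j m) < value_bound p m" for m
  proof (cases "m mod 2 = p")
    case True
    then have "value_bound p m = (total_bound m + 2) ^ (Suc m + 1)" by (simp only: value_bound_def simp_thms if_True level_bound_def, simp only: add_Suc Suc_eq_plus1 add.assoc one_add_one)
    moreover have "card (excluded p m) + (\<Sum>j\<in>{n. n mod 2 \<noteq> p} \<inter> {..m}. level_bound j * threshold p j m) + 2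
        \<le> (total_bound m + 2) ^ (Suc m + 1)"
      by (rule budget_sum[OF True]) auto
    ultimately show ?thesis by linarith
  qed (use conjunct2[OF card_excluded[of p m]] in \<open>simp add: threshold_def value_bound_def\<close>)
  show "\<exists>n\<in>{n. n mod 2 \<noteq> p}. l < n \<and> requirement n = k" for l k
  proof -
    \<comment> \<open>The padding \<open>Suc l\<close> lifts the level above \<open>l\<close>, and
      \<open>1 - p\<close> gives it the parity opposite to \<open>p\<close>.\<close>
    have "l < 2 * prod_encode (k, Suc l) + (1 - p)" using le_prod_encode_2[of "Suc l" k] by simp
    moreover have "(2 * prod_encode (k, Suc l) + (1 - p)) mod 2 \<noteq> p"
      "(2 * prod_encode (k, Suc l) + (1 - p)) div 2 = prod_encode (k, Suc l)"
      using assms by (auto simp: less_2_cases_iff)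
    ultimately show ?thesis
      by (intro bexI[of _ "2 * prod_encode (k, Suc l) + (1 - p)"]) (simp_all add: requirement_def)
  qed
  show "\<exists>v. selected p n \<sigma> v \<and> big (value_bound p) (threshold p n) (converges n v) \<sigma>"
    if "big (value_bound p) (threshold p n) (converges n v) \<sigma>" for n \<sigma> v using selected_exists[OF that] .
qed

lemma bounded_rseg: "(\<And>m. x m < value_bound p m) \<Longrightarrow> bounded p (rseg x k)"
  by (induction k) (simp_all add: bounded_Cons, simp add: bounded_def)

text \<open>Take a generic \<open>x\<close> and the level \<open>n\<close> that treats the program.
  Either no admissible value is ever computed at \<open>n\<close>, although the true
  \<open>y n\<close> would be, or the selected value is computed, so that \<open>y n\<close> equals
  a value excluded from class \<open>1 - p\<close>.\<close>

theorem avoiding_class_incomparable: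
  assumes "p < 2"
  shows "\<exists>x\<in>avoiding_class p. \<forall>c y. y \<in> avoiding_class (1 - p) \<longrightarrow> \<not> (\<forall>q. run x c q = Some (y q))"
proof -
  interpret forcing "value_bound p" "threshold p" converges "excluded p" level_bound "{n. n mod 2 \<noteq> p}" "selected p" requirement
    by (rule forcing_avoiding_seqs[OF assms])
  obtain x where x: "\<And>m. x m < value_bound p m" "\<And>m. x m \<notin> excluded p m"
    and gen: "\<And>k. \<exists>n\<in>{n. n mod 2 \<noteq> p}. requirement n = k \<and> ((\<forall>v<level_bound n. \<forall>l. \<not> converges n v (rseg x l)) \<or>
       (\<exists>v l. selected p n (rseg x n) v \<and> converges n v (rseg x l)))"
    using generic_exists by blast
  have "False" if y: "y \<in> avoiding_seqs (1 - p)" and run: "\<forall>q. run (graph x) c q = Some (graph y q)" for c y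
  proof -
    obtain n where n: "n mod 2 \<noteq> p" "requirement n = index_of c" 
      and alt: "(\<forall>v<level_bound n. \<forall>l. \<not> converges n v (rseg x l)) \<or>
       (\<exists>v l. selected p n (rseg x n) v \<and> converges n v (rseg x l))" using gen[of "index_of c"] by blast
    have c: "prog_of (requirement n) = c" by (simp add: n prog_of_index_of)
    from alt show False
    proof (elim disjE exE conjE)
      assume A: "\<forall>v<level_bound n. \<forall>l. \<not> converges n v (rseg x l)"
      have "y n < level_bound n" using y value_bound_le[of "1 - p" n] by (auto simp: avoiding_seqs_def intro: less_le_trans)
      moreover have "run (graph x) (prog_of (requirement n)) (prod_encode (n, y n)) = Some 1"
        using run by (simp add: c graph_def)
      ultimately show False using A converges_complete by blast
    next
      fix v l assume v: "selected p n (rseg x n) v" "converges n v (rseg x l)"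
      have "graph y (prod_encode (n, v)) = 1" using converges_sound[OF v(2)] run by (simp add: c)
      then have "y n = v" by (cases "y n = v") (simp_all add: graph_def)
      moreover have "v \<in> excluded (1 - p) n"
        using v(1) n(1) assms bounded_rseg[OF x(1)] by (auto simp: excluded_def less_2_cases_iff intro!: exI[of _ "rseg x n"])
      ultimately show False using y by (auto simp: avoiding_seqs_def)
    qed
  qed
  moreover have "graph x \<in> avoiding_class p" using x by (auto simp: avoiding_class_def avoiding_seqs_def)
  ultimately show ?thesis by (intro bexI[of _ "graph x"]) (auto simp: avoiding_class_def)
qed

section \<open>Effective closedness of the classes\<close>

lemma Pi01I:
  assumes "decidable (\<lambda>g x. R g x)"
  shows "Pi01 {f \<in> cantor_space. \<forall>z. \<not> R f z}"
proof -
  have "decidable (\<lambda>g z. \<not> R g (psnd z))" by (intro eff eff_comp[OF assms])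
  then obtain c where c: "\<And>g z. run g c z = Some (of_bool (\<not> R g (psnd z)))"
    unfolding effective_def by blast
  have "(run f (Search c) 0 = None) \<longleftrightarrow> (\<forall>z. \<not> R f z)" for f by (auto simp: c)
  then have "{f \<in> cantor_space. \<forall>z. \<not> R f z} = Pi01_index (index_of (Search c))"
    unfolding Pi01_index_def prog_of_index_of by blast
  then show ?thesis unfolding Pi01_def by blast
qed

text \<open>The bound on the values makes the absence of a value at a level decidable; hence the
  graphs, unlike those of arbitrary functions, form an effectively closed class.\<close>

definition violates :: "nat \<Rightarrow> (nat \<Rightarrow> nat) \<Rightarrow> nat \<Rightarrow> nat \<Rightarrow> nat \<Rightarrow> nat \<Rightarrow> nat \<Rightarrow> bool" where
  "violates p f m u u' s k \<longleftrightarrow> (\<forall>v<value_bound p m. f (prod_encode (m, v)) \<noteq> 1) \<or>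
     (u \<noteq> u' \<and> f (prod_encode (m, u)) = 1 \<and> f (prod_encode (m, u')) = 1) \<or>
     (f (prod_encode (m, pfst k)) = 1 \<and> m mod 2 = p \<and> length (list_decode s) = m \<and>
        bounded (1 - p) (list_decode s) \<and> first_witness (1 - p) m s k)"

lemma avoiding_class_eq: "avoiding_class p = {f \<in> cantor_space. \<forall>m u u' s k. \<not> violates p f m u u' s k}"
proof (intro equalityI subsetI)
  fix f assume "f \<in> avoiding_class p"
  then obtain x where x: "x \<in> avoiding_seqs p" "f = graph x" by (auto simp: avoiding_class_def)
  have one: "f (prod_encode (m, u)) = 1 \<longleftrightarrow> x m = u" for m u by (simp add: x(2) graph_def)
  have "\<not> violates p f m u u' s k" for m u u' s k
  proof
    assume "violates p f m u u' s k"
    then have "x m = pfst k \<and> m mod 2 = p \<and> length (list_decode s) = m \<and>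
        bounded (1 - p) (list_decode s) \<and> first_witness (1 - p) m s k"
      using x(1) unfolding violates_def one avoiding_seqs_def by blast
    moreover then have "selected (1 - p) m (list_decode s) (x m)" by (auto simp: selected_def)
    ultimately have "x m \<in> excluded p m" by (auto simp: excluded_def)
    then show False using x(1) by (auto simp: avoiding_seqs_def)
  qed
  then show "f \<in> {f \<in> cantor_space. \<forall>m u u' s k. \<not> violates p f m u u' s k}"
    by (auto simp: cantor_space_def x(2) graph_def)
next
  fix f assume "f \<in> {f \<in> cantor_space. \<forall>m u u' s k. \<not> violates p f m u u' s k}"
  then have f: "f \<in> cantor_space" and good: "\<And>m u u' s k. \<not> violates p f m u u' s k" by auto
  have "\<exists>v<value_bound p m. f (prod_encode (m, v)) = 1" for m using good unfolding violates_def by blast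
  then obtain x where x: "\<And>m. x m < value_bound p m" "\<And>m. f (prod_encode (m, x m)) = 1" by metis
  have uniq: "u = x m" if "f (prod_encode (m, u)) = 1" for m u
    using good[of m u "x m"] x that unfolding violates_def by blast
  have "f (prod_encode (m, u)) = graph x (prod_encode (m, u))" for m u
  proof -
    have "f (prod_encode (m, u)) \<in> {0, 1}" using f by (auto simp: cantor_space_def)
    then show ?thesis using uniq[of m u] x(2)[of m] by (auto simp: graph_def)
  qed
  then have "f = graph x" by (metis ext prod_decode_inverse surj_pair)
  moreover have "x m \<notin> excluded p m" for m
  proof
    assume "x m \<in> excluded p m"
    then obtain \<sigma> k where "m mod 2 = p" "length \<sigma> = m" "bounded (1 - p) \<sigma>"
      "first_witness (1 - p) m (list_encode \<sigma>) k" "pfst k = x m"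
      by (auto simp: excluded_def selected_def)
    then show False using good[of m _ _ "list_encode \<sigma>" k] x(2)[of m] by (auto simp: violates_def)
  qed
  ultimately show "f \<in> avoiding_class p" using x(1) by (auto simp: avoiding_class_def avoiding_seqs_def)
qed

lemma eff_total_bound [eff]: "effective A \<Longrightarrow> effective (\<lambda>g x. total_bound (A g x))"
proof -
  assume A: "effective A"
  have "total_bound k = rec_nat 1 (\<lambda>k r. r * (r + 2) ^ (k + 2)) k" for k
    by (induction k) (simp_all only: total_bound.simps nat.rec)
  moreover have "effective (\<lambda>g x. rec_nat 1 (\<lambda>k r. r * (r + 2) ^ (k + 2)) (A g x))" by (intro eff A)
  ultimately show ?thesis by simp
qed

lemma eff_value_bound [eff]: "effective A \<Longrightarrow> effective (\<lambda>g x. value_bound p (A g x))"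
  unfolding value_bound_def level_bound_def by (intro eff)

lemma eff_threshold [eff]: "effective A \<Longrightarrow> effective B \<Longrightarrow> effective (\<lambda>g x. threshold p (A g x) (B g x))"
  unfolding threshold_def by (intro eff)

lemma dec_converges_at: 
  assumes "effective A" "effective B" "effective C" "effective D" 
  shows "decidable (\<lambda>g x. converges_at (A g x) (B g x) (list_decode (C g x)) (D g x))"
proof -
  have "decidable (\<lambda>g z. list_oracle (list_decode (pfst z)) (pfst (psnd z)) (psnd (psnd z)))"
    unfolding list_oracle_def by (intro eff)
  then show ?thesis unfolding converges_at_def requirement_def by (intro eff assms dec_certificate[where P=C and R="\<lambda>g p. list_oracle (list_decode p)"])
qed

lemma dec_witness:
  "decidable (\<lambda>g z. witness p (pfst z) (pfst (psnd z)) (psnd (psnd z)))"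
  unfolding witness_def big_witness_def by (intro eff dec_converges_at)

lemma dec_violates:
  "decidable (\<lambda>f z. violates p f (pfst z) (pfst (psnd z)) (pfst (psnd (psnd z)))
     (pfst (psnd (psnd (psnd z)))) (psnd (psnd (psnd (psnd z)))))"
  unfolding violates_def first_witness_def bounded_def by (intro eff eff_comp3[OF dec_witness])

theorem Pi01_avoiding_class: "Pi01 (avoiding_class p)"
proof -
  have "(\<forall>m u u' s k. \<not> violates p f m u u' s k) \<longleftrightarrow> (\<forall>z. \<not> violates p f (pfst z) (pfst (psnd z))
     (pfst (psnd (psnd z))) (pfst (psnd (psnd (psnd z)))) (psnd (psnd (psnd (psnd z)))))" for f
    by (metis prod_encode_inverse fst_conv snd_conv)
  then show ?thesis unfolding avoiding_class_eq using Pi01I[OF dec_violates] by simp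
qed

section \<open>Learners against interleaved tapes\<close>

text \<open>A single program is learned by a constant learner, with one hypothesis and no mind
  change.\<close>

lemma le_computable:
  assumes "\<And>g. g \<in> B \<Longrightarrow> \<exists>y\<in>A. \<forall>n. run g c n = Some (y n)"
  shows "le_mc A B" "le_err A B"
proof -
  let ?e = "index_of c"
  have Phi: "Phi ?e g = Some y" if "\<forall>n. run g c n = Some (y n)" for g y
    using that by (simp add: Phi_def prog_of_index_of)
  have learner: "learner (\<lambda>\<sigma>. ?e)"
  proof -
    obtain d where "\<And>g x. run g d x = Some ?e" using eff_const[of ?e] unfolding effective_def by blast
    then show ?thesis unfolding computable_on_strings_def by blast
  qed
  have "lim (\<lambda>n::nat. ?e) = ?e" by (intro limI tendsto_const)
  then have id: "identifies (\<lambda>\<sigma>. ?e) (Phi ?e)"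
    unfolding identifies_def by (auto intro: convergent_const)
  have red: "B \<subseteq> dom (Phi ?e)" "\<forall>g\<in>B. the (Phi ?e g) \<in> A" using assms Phi by fastforce+
  have "bounded_mind_change_computable (Phi ?e)"
    unfolding bounded_mind_change_computable_def mind_changes_def using learner id
    by (intro exI[of _ "\<lambda>\<sigma>. ?e"]) auto
  then show "le_mc A B" unfolding le_mc_def reducible_via_def using red by blast
  have "bounded_error_computable (Phi ?e)"
    unfolding bounded_error_computable_def hypotheses_def using learner id
    by (intro exI[of _ "\<lambda>\<sigma>. ?e"]) auto
  then show "le_err A B" unfolding le_err_def reducible_via_def using red by blast
qed

lemma le_err_finite:
  assumes learner: "learner \<Psi>" and F: "finite F" "\<And>\<sigma>. \<Psi> \<sigma> \<in> F"
    and B: "\<And>g. g \<in> B \<Longrightarrow> \<exists>e. (\<forall>\<^sub>F n in sequentially. \<Psi> (initial_segment g n) = e) \<and>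
      (\<exists>y\<in>A. \<forall>n. run g (prog_of e) n = Some (y n))"
  shows "le_err A B"
proof -
  let ?l = "\<lambda>g. lim (\<lambda>n. \<Psi> (initial_segment g n))"
  \<comment> \<open>Cutting the domain down to \<open>B\<close> confines the demands on the learner
    to \<open>B\<close>.\<close>
  define \<Gamma> where "\<Gamma> g = (if g \<in> B then Phi (?l g) g else None)" for g
  have *: "convergent (\<lambda>n. \<Psi> (initial_segment g n)) \<and> (\<exists>y\<in>A. Phi (?l g) g = Some y)" if g: "g \<in> B" for g
  proof -
    obtain e y where e: "\<forall>\<^sub>F n in sequentially. \<Psi> (initial_segment g n) = e"
      and y: "y \<in> A" "\<forall>n. run g (prog_of e) n = Some (y n)" using B[OF g] by blast
    have lim: "(\<lambda>n. \<Psi> (initial_segment g n)) \<longlonglongrightarrow> e" using e by (simp add: tendsto_discrete)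
    then have "?l g = e" by (rule limI)
    moreover have "Phi e g = Some y" using y(2) by (simp add: Phi_def)
    ultimately show ?thesis using lim y(1) by (auto simp: convergent_def)
  qed
  have "identifies \<Psi> \<Gamma>" unfolding identifies_def using * by (auto simp: \<Gamma>_def dom_def)
  moreover have "finite (hypotheses \<Psi> g) \<and> card (hypotheses \<Psi> g) \<le> card F" for g
    unfolding hypotheses_def using F by (auto intro!: card_mono finite_subset[OF _ F(1)])
  ultimately have "bounded_error_computable \<Gamma>" unfolding bounded_error_computable_def using learner by blast
  moreover have "B \<subseteq> dom \<Gamma>" "\<forall>g\<in>B. the (\<Gamma> g) \<in> A" using * by (fastforce simp: \<Gamma>_def)+
  ultimately show ?thesis unfolding le_err_def reducible_via_def by blast
qed

lemma le_mcE:
  assumes "le_mc A B"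
  obtains \<Psi> k where "\<And>g. g \<in> B \<Longrightarrow> finite (mind_changes \<Psi> g) \<and> card (mind_changes \<Psi> g) \<le> k"
    "\<And>g. g \<in> B \<Longrightarrow> \<exists>e N. (\<forall>n\<ge>N. \<Psi> (initial_segment g n) = e) \<and>
      (\<exists>y\<in>A. \<forall>n. run g (prog_of e) n = Some (y n))"
proof -
  obtain \<Gamma> \<Psi> k where id: "identifies \<Psi> \<Gamma>"
    and k: "\<And>g. g \<in> dom \<Gamma> \<Longrightarrow> finite (mind_changes \<Psi> g) \<and> card (mind_changes \<Psi> g) \<le> k"
    and \<Gamma>: "B \<subseteq> dom \<Gamma>" "\<And>g. g \<in> B \<Longrightarrow> the (\<Gamma> g) \<in> A"
    using assms unfolding le_mc_def reducible_via_def bounded_mind_change_computable_def by blast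
  show ?thesis
  proof
    show "g \<in> B \<Longrightarrow> finite (mind_changes \<Psi> g) \<and> card (mind_changes \<Psi> g) \<le> k" for g using k \<Gamma> by blast
    fix g assume g: "g \<in> B"
    let ?e = "lim (\<lambda>n. \<Psi> (initial_segment g n))"
    have "convergent (\<lambda>n. \<Psi> (initial_segment g n))" and Phi: "Phi ?e g = \<Gamma> g"
      using id g \<Gamma>(1) unfolding identifies_def by blast+
    then have "(\<lambda>n. \<Psi> (initial_segment g n)) \<longlonglongrightarrow> ?e" by (simp add: convergent_LIMSEQ_iff)
    then have "\<exists>N. \<forall>n\<ge>N. \<Psi> (initial_segment g n) = ?e"
      by (simp add: tendsto_discrete eventually_sequentially)
    moreover obtain y where y: "\<Gamma> g = Some y" using g \<Gamma>(1) by blast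
    then have "\<forall>n. run g (prog_of ?e) n = Some (y n)"
      using Phi by (auto simp: Phi_def split: if_splits)
    moreover have "y \<in> A" using \<Gamma>(2)[OF g] y by simp
    ultimately show "\<exists>e N. (\<forall>n\<ge>N. \<Psi> (initial_segment g n) = e) \<and>
      (\<exists>y\<in>A. \<forall>n. run g (prog_of e) n = Some (y n))" by blast
  qed
qed

section \<open>Initial segments and changes along finite strings\<close>

lemma length_initial_segment [simp]: "length (initial_segment g n) = n"
  by (simp add: initial_segment_def)

lemma nth_initial_segment [simp]: "k < n \<Longrightarrow> initial_segment g n ! k = g k"
  by (simp add: initial_segment_def)

lemma initial_segment_0 [simp]: "initial_segment g 0 = []"
  by (simp add: initial_segment_def)

lemma initial_segment_Suc: "initial_segment g (Suc n) = initial_segment g n @ [g n]"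
  by (simp add: initial_segment_def)

lemma take_initial_segment: "take k (initial_segment g n) = initial_segment g (min k n)"
  by (simp add: initial_segment_def take_map min_def)

lemma initial_segment_eq_iff: "initial_segment g n = initial_segment h n \<longleftrightarrow> (\<forall>k<n. g k = h k)"
  by (auto simp: initial_segment_def)

definition changes :: "('a list \<Rightarrow> nat) \<Rightarrow> 'a list \<Rightarrow> nat" where
  "changes \<phi> s = card {n. n < length s \<and> \<phi> (take (Suc n) s) \<noteq> \<phi> (take n s)}"

lemma changes_take_le: "changes \<phi> (take m s) \<le> changes \<phi> s"
  unfolding changes_def by (intro card_mono) (auto simp: min_def)

lemma changes_take_less:
  assumes "\<phi> (take m s) \<noteq> \<phi> s"
  shows "changes \<phi> (take m s) < changes \<phi> s"
proof -
  have lt: "m < length s" using assms by (metis not_le take_all)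
  have "\<exists>n. m \<le> n \<and> n < length s \<and> \<phi> (take (Suc n) s) \<noteq> \<phi> (take n s)"
  proof (rule ccontr)
    assume *: "\<not> ?thesis"
    have "n \<le> length s \<Longrightarrow> \<phi> (take n s) = \<phi> (take m s)" if "m \<le> n" for n
      using that
    proof (induction n rule: dec_induct)
      case (step n)
      then show ?case using * by (metis Suc_le_lessD less_imp_le)
    qed simp
    from this[of "length s"] show False using assms lt by simp
  qed
  then obtain n where n: "m \<le> n" "n < length s" "\<phi> (take (Suc n) s) \<noteq> \<phi> (take n s)" by blast
  have "{n. n < length (take m s) \<and> \<phi> (take (Suc n) (take m s)) \<noteq> \<phi> (take n (take m s))}
      \<subseteq> {n. n < length s \<and> \<phi> (take (Suc n) s) \<noteq> \<phi> (take n s)} - {n}"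
    using n(1) by (auto simp: min_def)
  then have "changes \<phi> (take m s) \<le> card ({n. n < length s \<and> \<phi> (take (Suc n) s) \<noteq> \<phi> (take n s)} - {n})"
    unfolding changes_def by (intro card_mono) simp_all
  also have "\<dots> < changes \<phi> s" unfolding changes_def using n by (intro card_Diff1_less) auto
  finally show ?thesis .
qed

lemma changes_initial_segment:
  assumes "finite (mind_changes \<phi> g)"
  shows "changes \<phi> (initial_segment g n) \<le> card (mind_changes \<phi> g)"
  unfolding changes_def
  by (rule card_mono[OF assms]) (auto simp: mind_changes_def take_initial_segment min_def)

section \<open>Interleavings of two sequences on two tapes\<close>

definition interleaving :: "(nat \<Rightarrow> nat \<Rightarrow> nat) \<Rightarrow> (nat \<times> nat) list \<Rightarrow> bool" where
  "interleaving u \<sigma> \<longleftrightarrow> (\<forall>q\<in>set \<sigma>. fst q < 2) \<and>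
     (\<forall>i<2. pr_list i \<sigma> = initial_segment (u i) (length (pr_list i \<sigma>)))"

text \<open>The offset \<open>length (pr_list i \<sigma>)\<close> resumes tape \<open>i\<close>
  where \<sigma> left it, so interleavings remain interleavings.\<close>

definition continue_with :: "(nat \<Rightarrow> nat) \<Rightarrow> nat \<Rightarrow> (nat \<times> nat) list \<Rightarrow> nat \<Rightarrow> nat \<times> nat" where
  "continue_with x i \<sigma> n = (if n < length \<sigma> then \<sigma> ! n
     else (i, x (n - length \<sigma> + length (pr_list i \<sigma>))))"

lemma pr_list_append [simp]: "pr_list i (\<sigma> @ \<tau>) = pr_list i \<sigma> @ pr_list i \<tau>"
  by (simp add: pr_list_def)

lemma pr_list_simps [simp]: "pr_list i [] = []" 
  "pr_list i (q # \<sigma>) = (if fst q = i then snd q # pr_list i \<sigma> else pr_list i \<sigma>)"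
  by (auto simp: pr_list_def)

lemma continue_with_initial: "initial_segment (continue_with x i \<sigma>) (length \<sigma>) = \<sigma>"
  by (rule nth_equalityI) (auto simp: continue_with_def)

lemma interleaving_take: "interleaving u (\<sigma> @ \<tau>) \<Longrightarrow> interleaving u \<sigma>"
proof -
  assume *: "interleaving u (\<sigma> @ \<tau>)"
  have "pr_list i \<sigma> = initial_segment (u i) (length (pr_list i \<sigma>))" if "i < 2" for i
  proof -
    have "pr_list i \<sigma> = take (length (pr_list i \<sigma>)) (pr_list i (\<sigma> @ \<tau>))" by simp
    also have "\<dots> = take (length (pr_list i \<sigma>)) (initial_segment (u i) (length (pr_list i (\<sigma> @ \<tau>))))"
      using * that by (simp only: interleaving_def)
    finally show ?thesis by (simp add: take_initial_segment)
  qed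
  then show ?thesis using * by (simp add: interleaving_def)
qed

lemma interleaving_snoc:
  "interleaving u \<sigma> \<Longrightarrow> i < 2 \<Longrightarrow> interleaving u (\<sigma> @ [(i, u i (length (pr_list i \<sigma>)))])"
  by (auto simp: interleaving_def initial_segment_Suc)

lemma interleaving_continue:
  assumes "interleaving u \<sigma>" "i < 2"
  shows "interleaving u (initial_segment (continue_with (u i) i \<sigma>) n)"
proof (cases "length \<sigma> \<le> n")
  case True
  have "interleaving u (initial_segment (continue_with (u i) i \<sigma>) n) \<and>
      length (pr_list i (initial_segment (continue_with (u i) i \<sigma>) n)) = n - length \<sigma> + length (pr_list i \<sigma>)"
    using True
  proof (induction n rule: dec_induct)
    case base
    then show ?case using assms by (simp add: continue_with_initial)
  next
    case (step n)
    define \<tau> where "\<tau> = initial_segment (continue_with (u i) i \<sigma>) n"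
    have "continue_with (u i) i \<sigma> n = (i, u i (length (pr_list i \<tau>)))"
      using step by (simp add: continue_with_def[of _ _ _ n] \<tau>_def)
    then have "initial_segment (continue_with (u i) i \<sigma>) (Suc n) = \<tau> @ [(i, u i (length (pr_list i \<tau>)))]"
      by (simp add: initial_segment_Suc \<tau>_def)
    then show ?case using interleaving_snoc[of u \<tau> i] step assms(2) by (simp add: \<tau>_def Suc_diff_le)
  qed
  then show ?thesis by blast
next
  case False
  then have "initial_segment (continue_with (u i) i \<sigma>) n @ drop n \<sigma> = \<sigma>"
    using continue_with_initial[of "u i" i \<sigma>] take_initial_segment[of n _ "length \<sigma>"]
    by (metis append_take_drop_id min.absorb1 nat_le_linear)
  then show ?thesis using assms(1) interleaving_take by metis
qed

lemma interleaving_pr_list: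
  "interleaving u \<sigma> \<Longrightarrow> i < 2 \<Longrightarrow> u i \<in> paths T \<Longrightarrow> pr_list i \<sigma> \<in> T"
  unfolding interleaving_def paths_def by (metis (mono_tags, lifting) mem_Collect_eq)

definition tag_changes_list :: "(nat \<times> nat) list \<Rightarrow> nat" where
  "tag_changes_list \<sigma> = card {n. Suc n < length \<sigma> \<and> fst (\<sigma> ! n) \<noteq> fst (\<sigma> ! Suc n)}"

lemma finite_list_tag_changes: "finite {n. Suc n < length \<sigma> \<and> fst (\<sigma> ! n) \<noteq> fst (\<sigma> ! Suc n)}"
  by (rule finite_subset[of _ "{..length \<sigma>}"]) auto

text \<open>The only new switch can occur between the last entry of \<sigma> and the first entry
  after it.\<close>

lemma tag_changes_continue:
  "tag_changes (continue_with x i \<sigma>) \<subseteq>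
     insert (length \<sigma> - 1) {n. Suc n < length \<sigma> \<and> fst (\<sigma> ! n) \<noteq> fst (\<sigma> ! Suc n)}"
  by (auto simp: tag_changes_def continue_with_def split: if_splits)

lemma finite_tag_changes_continue: "finite (tag_changes (continue_with x i \<sigma>))"
  by (rule finite_subset[OF tag_changes_continue]) (simp add: finite_list_tag_changes)

lemma card_tag_changes_continue: "card (tag_changes (continue_with x i \<sigma>)) \<le> Suc (tag_changes_list \<sigma>)"
proof -
  let ?S = "{n. Suc n < length \<sigma> \<and> fst (\<sigma> ! n) \<noteq> fst (\<sigma> ! Suc n)}"
  have "card (tag_changes (continue_with x i \<sigma>)) \<le> card (insert (length \<sigma> - 1) ?S)"
    by (rule card_mono[OF _ tag_changes_continue]) (simp add: finite_list_tag_changes)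
  also have "\<dots> \<le> Suc (card ?S)" by (simp add: card_insert_if finite_list_tag_changes)
  finally show ?thesis by (simp add: tag_changes_list_def)
qed

lemma tag_changes_list_continue:
  "tag_changes_list (initial_segment (continue_with x i \<sigma>) n) \<le> Suc (tag_changes_list \<sigma>)"
proof -
  have "tag_changes_list (initial_segment (continue_with x i \<sigma>) n) \<le> card (tag_changes (continue_with x i \<sigma>))"
    unfolding tag_changes_list_def
    by (rule card_mono[OF finite_tag_changes_continue]) (auto simp: tag_changes_def)
  then show ?thesis by (rule le_trans) (rule card_tag_changes_continue)
qed

lemma run_use_initial:
  assumes "\<forall>n. run g c n = Some (b n)"
  shows "\<exists>N. \<forall>h. (\<forall>k<N. h k = g k) \<longrightarrow> (\<forall>j<L. run h c j = Some (b j))"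
proof (induction L)
  case (Suc L)
  then obtain N where N: "\<forall>h. (\<forall>k<N. h k = g k) \<longrightarrow> (\<forall>j<L. run h c j = Some (b j))" by blast
  obtain N' where N': "\<forall>h. (\<forall>k<N'. h k = g k) \<longrightarrow> run h c L = Some (b L)"
    using run_use assms by blast
  show ?case
  proof (intro exI[of _ "max N N'"] allI impI)
    fix h j assume h: "\<forall>k<max N N'. h k = g k" and "j < Suc L"
    then consider "j < L" | "j = L" by linarith
    then show "run h c j = Some (b j)" by cases (use h N N' in auto)
  qed
qed simp

text \<open>
  A member of \<open>A\<close> codes an interleaving of \<open>u 0\<close> and \<open>u 1\<close> that eventually stays on one
  tape.  The map \<open>cl\<close> reads off a solution in \<open>B\<close> which of the two it belongs to, changing its
  guess at most \<open>R\<close> times; it need not be computable.  By \<open>room\<close>, arbitrarily many switches are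
  possible above some string.
\<close>

locale switching =
  fixes u :: "nat \<Rightarrow> nat \<Rightarrow> nat" and enc :: "(nat \<Rightarrow> nat \<times> nat) \<Rightarrow> nat \<Rightarrow> nat"
    and A B :: "(nat \<Rightarrow> nat) set" and cl :: "nat list \<Rightarrow> nat" and R :: nat
  assumes enc: "\<exists>M. \<forall>f f'. (\<forall>n<M. f n = f' n) \<longrightarrow> (\<forall>k<N. enc f k = enc f' k)"
    and room: "\<exists>\<sigma>0. interleaving u \<sigma>0 \<and> tag_changes_list \<sigma>0 = 0 \<and>
      (\<forall>\<sigma> i. i < 2 \<longrightarrow> interleaving u (\<sigma>0 @ \<sigma>) \<longrightarrow> tag_changes_list (\<sigma>0 @ \<sigma>) \<le> K \<longrightarrow>
        enc (continue_with (u i) i (\<sigma>0 @ \<sigma>)) \<in> A)"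
    and cl: "i < 2 \<Longrightarrow> b \<in> B \<Longrightarrow> \<forall>n. run (enc (continue_with (u i) i \<sigma>)) p n = Some (b n) \<Longrightarrow>
      \<exists>L0. \<forall>L\<ge>L0. cl (initial_segment b L) = i"
    and cl_bound: "b \<in> B \<Longrightarrow> finite (mind_changes cl b) \<and> card (mind_changes cl b) \<le> R"
begin

theorem not_le_mc: "\<not> le_mc B A"
proof
  assume "le_mc B A"
  then obtain \<Psi> k where k: "\<And>g. g \<in> A \<Longrightarrow> finite (mind_changes \<Psi> g) \<and> card (mind_changes \<Psi> g) \<le> k"
    and \<Psi>: "\<And>g. g \<in> A \<Longrightarrow> \<exists>e N. (\<forall>n\<ge>N. \<Psi> (initial_segment g n) = e) \<and>
      (\<exists>y\<in>B. \<forall>n. run g (prog_of e) n = Some (y n))" by (rule le_mcE) blast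
  \<comment> \<open>One more than \<open>k * (R + 1) + R\<close>, the largest possible
    potential.\<close>
  define K where "K = k * (R + 1) + R + 1"
  obtain \<sigma>0 where \<sigma>0: "interleaving u \<sigma>0" "tag_changes_list \<sigma>0 = 0"
    and room': "\<And>\<sigma> i. i < 2 \<Longrightarrow> interleaving u (\<sigma>0 @ \<sigma>) \<Longrightarrow> tag_changes_list (\<sigma>0 @ \<sigma>) \<le> K \<Longrightarrow>
        enc (continue_with (u i) i (\<sigma>0 @ \<sigma>)) \<in> A"
    using room[of K] by blast
  txt \<open>
    The string \<open>s\<close> is an initial part of the coded interleaving \<open>\<sigma>0 @ \<sigma>\<close>, and \<open>l\<close> the output that it
    determines under the current hypothesis.  Continuing on the tape that \<open>cl l\<close> does not name
    raises the potential \<open>changes \<Psi> s * (R + 1) + changes cl l\<close>: either the hypothesis changes, or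
    the output extends \<open>l\<close> and changes its class.
  \<close>
  define state where "state n \<sigma> s l \<longleftrightarrow> interleaving u (\<sigma>0 @ \<sigma>) \<and> tag_changes_list (\<sigma>0 @ \<sigma>) \<le> n \<and>
      (\<forall>f. initial_segment f (length (\<sigma>0 @ \<sigma>)) = \<sigma>0 @ \<sigma> \<longrightarrow> initial_segment (enc f) (length s) = s) \<and>
      (\<forall>h. initial_segment h (length s) = s \<longrightarrow> (\<forall>j<length l. run h (prog_of (\<Psi> s)) j = Some (l ! j))) \<and>
      changes cl l \<le> R \<and> changes \<Psi> s \<le> k \<and> n \<le> changes \<Psi> s * (R + 1) + changes cl l" for n \<sigma> s l
  have "\<exists>\<sigma> s l. state n \<sigma> s l" if "n \<le> K" for n
    using that
  proof (induction n)
    case 0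
    have "state 0 [] [] []" using \<sigma>0 by (simp add: state_def changes_def)
    then show ?case by blast
  next
    case (Suc n)
    then obtain \<sigma> s l where st: "state n \<sigma> s l" by auto
    let ?\<sigma> = "\<sigma>0 @ \<sigma>"
    \<comment> \<open>Truncated subtraction yields a tape different from \<open>cl l\<close> even if
      \<open>cl l\<close> exceeds 1.\<close>
    define i where "i = 1 - cl l"
    have i: "i < 2" "i \<noteq> cl l" unfolding i_def by arith+
    define f where "f = continue_with (u i) i ?\<sigma>"
    have f\<sigma>: "initial_segment f (length ?\<sigma>) = ?\<sigma>" unfolding f_def by (rule continue_with_initial)
    have fs: "initial_segment (enc f) (length s) = s" using st f\<sigma> unfolding state_def by blast
    have fA: "enc f \<in> A" unfolding f_def
      using st Suc.prems by (intro room' i) (auto simp: state_def)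
    obtain e N0 b where N0: "\<And>n. n \<ge> N0 \<Longrightarrow> \<Psi> (initial_segment (enc f) n) = e"
      and b: "b \<in> B" "\<forall>n. run (enc f) (prog_of e) n = Some (b n)" using \<Psi>[OF fA] by blast
    obtain L0 where L0: "\<forall>L\<ge>L0. cl (initial_segment b L) = i"
      using cl[OF i(1) b(1), of ?\<sigma>] b(2) unfolding f_def by blast
    \<comment> \<open>Long enough for \<open>cl\<close> to have settled on \<open>i\<close> and for
      the new output to cover \<open>l\<close>.\<close>
    define L where "L = max L0 (length l)"
    obtain N1 where N1: "\<forall>h. (\<forall>k<N1. h k = enc f k) \<longrightarrow> (\<forall>j<L. run h (prog_of e) j = Some (b j))"
      using run_use_initial[OF b(2)] by blast
    \<comment> \<open>At \<open>N\<close> the learner has converged, the first \<open>L\<close>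
      output values are determined, and \<open>s\<close> is covered.\<close>
    define N where "N = max (max N0 N1) (length s)"
    obtain M where M: "\<And>f f'. (\<forall>n<M. f n = f' n) \<Longrightarrow> (\<forall>k<N. enc f k = enc f' k)" using enc[of N] by blast
    define M' where "M' = max M (length ?\<sigma>)"
    define \<sigma>' where "\<sigma>' = drop (length \<sigma>0) (initial_segment f M')"
    have \<sigma>': "\<sigma>0 @ \<sigma>' = initial_segment f M'"
    proof -
      have "take (length \<sigma>0) (initial_segment f M') = take (length \<sigma>0) (initial_segment f (length ?\<sigma>))"
        by (simp add: take_initial_segment M'_def min.absorb1)
      also have "\<dots> = \<sigma>0" unfolding f\<sigma> by simp
      finally show ?thesis unfolding \<sigma>'_def by (metis append_take_drop_id)
    qed
    define s' where "s' = initial_segment (enc f) N"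
    define l' where "l' = initial_segment b L"
    have s: "s = take (length s) s'" using fs by (simp add: s'_def take_initial_segment N_def)
    have e: "\<Psi> s' = e" unfolding s'_def by (intro N0) (simp add: N_def)
    have pot: "Suc n \<le> changes \<Psi> s' * (R + 1) + changes cl l'"
    proof (cases "\<Psi> s' = \<Psi> s")
      case False
      \<comment> \<open>A new hypothesis may lose all of \<open>changes cl l\<close>, which is at
        most \<open>R\<close>; the weight \<open>R + 1\<close> outweighs this.\<close>
      then have "changes \<Psi> s < changes \<Psi> s'" using changes_take_less[of \<Psi> "length s" s'] s by auto
      then have "(changes \<Psi> s + 1) * (R + 1) \<le> changes \<Psi> s' * (R + 1)" by (intro mult_right_mono) simp_all
      then show ?thesis using st unfolding state_def by (simp add: algebra_simps)
    next
      case True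
      have "run (enc f) (prog_of e) j = Some (l ! j)" if "j < length l" for j
        using st fs that True e unfolding state_def by metis
      then have "l = take (length l) l'"
        using b(2) by (intro nth_equalityI) (auto simp: l'_def L_def)
      moreover have "cl l' = i" unfolding l'_def using L0 by (simp add: L_def)
      ultimately have "changes cl l < changes cl l'"
        using changes_take_less[of cl "length l" l'] i(2) by auto
      moreover have "changes \<Psi> s \<le> changes \<Psi> s'" using changes_take_le[of \<Psi> "length s" s'] s by simp
      then have "changes \<Psi> s * (R + 1) \<le> changes \<Psi> s' * (R + 1)" by (rule mult_right_mono) simp
      ultimately show ?thesis using st unfolding state_def by linarith
    qed
    have "state (Suc n) \<sigma>' s' l'"
      unfolding state_def
    proof (intro conjI allI impI)
      show "interleaving u (\<sigma>0 @ \<sigma>')" unfolding \<sigma>' f_def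
        using st i(1) by (intro interleaving_continue) (simp_all add: state_def)
      show "tag_changes_list (\<sigma>0 @ \<sigma>') \<le> Suc n" unfolding \<sigma>' f_def
        using st tag_changes_list_continue[of "u i" i ?\<sigma> M'] by (simp add: state_def)
      show "changes cl l' \<le> R" unfolding l'_def
        using cl_bound[OF b(1)] changes_initial_segment le_trans by blast
      show "changes \<Psi> s' \<le> k" unfolding s'_def
        using k[OF fA] changes_initial_segment le_trans by blast
      show "Suc n \<le> changes \<Psi> s' * (R + 1) + changes cl l'" by (rule pot)
    next
      fix f' assume "initial_segment f' (length (\<sigma>0 @ \<sigma>')) = \<sigma>0 @ \<sigma>'"
      then have "\<forall>n<M'. f' n = f n" unfolding \<sigma>' by (simp add: initial_segment_eq_iff)
      then have "\<forall>k<N. enc f' k = enc f k" by (intro M) (simp add: M'_def)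
      then show "initial_segment (enc f') (length s') = s'" by (simp add: s'_def initial_segment_eq_iff)
    next
      fix h j assume "initial_segment h (length s') = s'" "j < length l'"
      then have "\<forall>k<N1. h k = enc f k" "j < L" by (auto simp: s'_def initial_segment_eq_iff N_def l'_def)
      then show "run h (prog_of (\<Psi> s')) j = Some (l' ! j)" using N1 e by (simp add: l'_def)
    qed
    then show ?case by blast
  qed
  then obtain \<sigma> s l where "state K \<sigma> s l" by blast
  then have "K \<le> changes \<Psi> s * (R + 1) + changes cl l" "changes cl l \<le> R" "changes \<Psi> s \<le> k"
    by (auto simp: state_def)
  moreover then have "changes \<Psi> s * (R + 1) \<le> k * (R + 1)" by (intro mult_right_mono) simp_all
  ultimately show False by (simp add: K_def)
qed

end

section \<open>Trees and disjunctions\<close>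

lemma eff_map_filter:
  assumes "decidable (\<lambda>g z. R g (pfst z) (psnd z))" "effective (\<lambda>g z. H g (pfst z) (psnd z))" "effective N"
  shows "effective (\<lambda>g x. list_encode (map (H g x) (filter (R g x) [0..<N g x])))"
proof -
  \<comment> \<open>The list is built from its end: after \<open>k\<close> steps the result codes
    the part with indices from \<open>n - k\<close> on.\<close>
  have rec: "k \<le> n \<Longrightarrow> rec_nat 0 (\<lambda>k r. if Q (n - Suc k) then Suc (prod_encode (h (n - Suc k), r)) else r) k
      = list_encode (map h (filter Q [n - k..<n]))" for Q h and k n :: nat
  proof (induction k)
    case (Suc k)
    then have "[n - Suc k..<n] = (n - Suc k) # [n - k..<n]" by (metis Suc_diff_Suc Suc_le_lessD diff_less less_le_trans upt_conv_Cons zero_less_Suc)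
    then show ?case using Suc by simp
  qed simp
  have "effective (\<lambda>g x. rec_nat 0 (\<lambda>k r. if R g x (N g x - Suc k)
      then Suc (prod_encode (H g x (N g x - Suc k), r)) else r) (N g x))"
    by (intro eff dec_comp2[OF assms(1)] eff_comp2[OF assms(2)] assms(3) eff_comp[OF assms(3)])
  then show ?thesis by (simp add: rec)
qed

lemma eff_initial_segment:
  assumes "effective (\<lambda>g z. H g (pfst z) (psnd z))" "effective N"
  shows "effective (\<lambda>g x. list_encode (initial_segment (H g x) (N g x)))"
  using eff_map_filter[OF eff_const[of "of_bool True"] assms] by (simp add: initial_segment_def)

lemma pr_list_initial_segment:
  "pr_list i (initial_segment f n) = map (\<lambda>k. snd (f k)) (filter (\<lambda>k. fst (f k) = i) [0..<n])"
  by (simp add: pr_list_def initial_segment_def filter_map comp_def)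

lemma dec_tree:
  assumes "computable_tree T" "effective A"
  shows "decidable (\<lambda>g x. list_decode (A g x) \<in> T)"
proof -
  obtain c where c: "\<And>\<sigma>. run (\<lambda>_. 0) c (list_encode \<sigma>) = Some (of_bool (\<sigma> \<in> T))"
    using assms(1) unfolding computable_tree_def computable_on_strings_def by blast
  have "run (\<lambda>_. 0) c x = Some (of_bool (list_decode x \<in> T))" for x
    using c[of "list_decode x"] by simp
  from eff_comp[OF effective_zero_oracle[OF this] assms(2)] show ?thesis .
qed

lemma tree_binary: "computable_tree T \<Longrightarrow> \<sigma> \<in> T \<Longrightarrow> set \<sigma> \<subseteq> {0, 1}"
  by (simp add: computable_tree_def)

lemma tree_prefix: "computable_tree T \<Longrightarrow> \<sigma> @ \<tau> \<in> T \<Longrightarrow> \<sigma> \<in> T"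
  unfolding computable_tree_def by blast

lemma tree_initial_segment: "computable_tree T \<Longrightarrow> initial_segment f n \<in> T \<Longrightarrow> m \<le> n \<Longrightarrow> initial_segment f m \<in> T"
  by (metis append_take_drop_id min.absorb1 take_initial_segment tree_prefix)

lemma computable_on_stringsI:
  assumes "effective (\<lambda>g x. h (list_decode x))"
  shows "computable_on_strings h"
proof -
  obtain c where "\<And>g x. run g c x = Some (h (list_decode x))" using assms unfolding effective_def by blast
  then have "\<forall>\<sigma>. run (\<lambda>_. 0) c (list_encode \<sigma>) = Some (h \<sigma>)" by simp
  then show ?thesis unfolding computable_on_strings_def by blast
qed

section \<open>Computable trees for effectively closed classes\<close>

definition prefix_oracle :: "nat list \<Rightarrow> nat \<Rightarrow> nat \<Rightarrow> bool" where
  "prefix_oracle \<sigma> q y \<longleftrightarrow> q < length \<sigma> \<and> lnth \<sigma> q = y"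

text \<open>Bounding the certificate by the length of the string makes the test decidable and keeps
  it true under extension.\<close>

definition halts_in :: "nat \<Rightarrow> nat list \<Rightarrow> bool" where
  "halts_in e \<sigma> \<longleftrightarrow> (\<exists>D<length \<sigma>. \<exists>y<D. triple_code e 0 y \<in> set_decode D \<and>
     certificate (prefix_oracle \<sigma>) (set_decode D))"

text \<open>Part (2) comes without given trees; this supplies one for each index.\<close>

definition halting_tree :: "nat \<Rightarrow> nat list set" where
  "halting_tree e = {\<sigma>. (\<forall>i<length \<sigma>. lnth \<sigma> i < 2) \<and> \<not> halts_in e \<sigma>}"

lemma halts_in_append:
  assumes "halts_in e \<sigma>" shows "halts_in e (\<sigma> @ \<tau>)"
proof -
  obtain D y where D: "D < length \<sigma>" "y < D" "triple_code e 0 y \<in> set_decode D"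
    "certificate (prefix_oracle \<sigma>) (set_decode D)" using assms unfolding halts_in_def by blast
  have "certificate (prefix_oracle (\<sigma> @ \<tau>)) (set_decode D)"
    by (rule certificate_mono[OF D(4)]) (auto simp: prefix_oracle_def lnth_def nth_append)
  then show ?thesis unfolding halts_in_def using D(1-3) by (metis length_append trans_less_add1)
qed

lemma computable_tree_halting_tree: "computable_tree (halting_tree e)"
  unfolding computable_tree_def
proof (intro conjI ballI allI impI)
  fix \<sigma> assume "\<sigma> \<in> halting_tree e"
  then show "set \<sigma> \<subseteq> {0, 1}"
    by (fastforce simp: halting_tree_def in_set_conv_nth lnth_def less_2_cases_iff)
next
  fix \<sigma> \<tau> assume *: "\<sigma> @ \<tau> \<in> halting_tree e"
  have "lnth \<sigma> i < 2" if "i < length \<sigma>" for i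
  proof -
    have "lnth \<sigma> i = lnth (\<sigma> @ \<tau>) i" using that by (simp add: lnth_def nth_append)
    then show ?thesis using * that by (simp add: halting_tree_def)
  qed
  then show "\<sigma> \<in> halting_tree e" using * halts_in_append unfolding halting_tree_def by blast
next
  have "decidable (\<lambda>g z. prefix_oracle (list_decode (pfst z)) (pfst (psnd z)) (psnd (psnd z)))"
    unfolding prefix_oracle_def by (intro eff)
  note cert = dec_certificate[where R="\<lambda>g p. prefix_oracle (list_decode p)", OF this]
  have "decidable (\<lambda>g x. list_decode x \<in> halting_tree e)"
    unfolding halting_tree_def halts_in_def mem_Collect_eq by (intro eff cert)
  then show "computable_on_strings (\<lambda>\<sigma>. of_bool (\<sigma> \<in> halting_tree e))" by (rule computable_on_stringsI)
qed

lemma cantor_space_iff: "f \<in> cantor_space \<longleftrightarrow> (\<forall>n. f n < 2)"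
  unfolding cantor_space_def by (simp add: image_subset_iff less_2_cases_iff)

lemma paths_halting_tree: "paths (halting_tree e) = Pi01_index e"
proof (intro equalityI subsetI)
  fix f assume f: "f \<in> paths (halting_tree e)"
  have "f n < 2" for n
  proof -
    have "initial_segment f (Suc n) \<in> halting_tree e" using f by (simp add: paths_def)
    then have "lnth (initial_segment f (Suc n)) n < 2" by (auto simp: halting_tree_def)
    then show ?thesis by (simp add: lnth_def)
  qed
  then have "f \<in> cantor_space" by (simp add: cantor_space_iff)
  moreover have "run f (prog_of e) 0 = None"
  proof (rule ccontr)
    assume "run f (prog_of e) 0 \<noteq> None"
    then obtain y where "run f (prog_of e) 0 = Some y" by blast
    from certificate_complete[OF this] obtain D N where D: "triple_code e 0 y \<in> set_decode D"
      and N: "certificate (\<lambda>q y. q < N \<and> f q = y) (set_decode D)" by blast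
    \<comment> \<open>The length covers the oracle answers used and exceeds the code of the
      certificate.\<close>
    let ?\<sigma> = "initial_segment f (max N (Suc D))"
    have "certificate (prefix_oracle ?\<sigma>) (set_decode D)"
      by (rule certificate_mono[OF N]) (auto simp: prefix_oracle_def lnth_def)
    then have "halts_in e ?\<sigma>" using D triple_code_less(2)[OF D] unfolding halts_in_def
      by (intro exI[of _ D]) auto
    then show False using f by (auto simp: paths_def halting_tree_def)
  qed
  ultimately show "f \<in> Pi01_index e" by (simp add: Pi01_index_def)
next
  fix f assume f: "f \<in> Pi01_index e"
  have "\<not> halts_in e (initial_segment f n)" for n
  proof
    assume "halts_in e (initial_segment f n)"
    then obtain D y where "triple_code e 0 y \<in> set_decode D"
      "certificate (prefix_oracle (initial_segment f n)) (set_decode D)" unfolding halts_in_def by blast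
    from certificate_sound[OF this(2) _ this(1), of f]
    show False using f by (auto simp: prefix_oracle_def lnth_def Pi01_index_def)
  qed
  moreover have "f n < 2" for n using f by (simp add: Pi01_index_def cantor_space_iff)
  ultimately show "f \<in> paths (halting_tree e)" by (auto simp: paths_def halting_tree_def lnth_def)
qed

section \<open>Projections of interleavings to one tape\<close>

lemma enumerate_initial:
  fixes S :: "nat set"
  assumes "infinite S"
  shows "{j. j < enumerate S k \<and> j \<in> S} = enumerate S ` {..<k}"
proof (intro equalityI subsetI)
  fix j assume "j \<in> {j. j < enumerate S k \<and> j \<in> S}"
  then obtain m where m: "enumerate S m = j" "enumerate S m < enumerate S k"
    using enumerate_Ex[OF assms] by blast
  then show "j \<in> enumerate S ` {..<k}" using assms by (auto simp: enumerate_mono_iff)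
qed (use assms in \<open>auto simp: enumerate_in_set enumerate_mono\<close>)

lemma card_enumerate_initial:
  fixes S :: "nat set"
  assumes "infinite S"
  shows "card {j. j < enumerate S k \<and> j \<in> S} = k"
  unfolding enumerate_initial[OF assms] using inj_enumerate[OF assms]
  by (simp add: card_image inj_on_subset)

lemma enumerate_card:
  fixes S :: "nat set"
  assumes "infinite S" "n \<in> S"
  shows "enumerate S (card {j. j < n \<and> j \<in> S}) = n"
proof -
  obtain k where "enumerate S k = n" using enumerate_Ex[OF assms] by blast
  then show ?thesis using card_enumerate_initial[OF assms(1), of k] by simp
qed

text \<open>Connects the finite projections, which the trees constrain, with the infinite projection
  in \<open>pr_in\<close>.\<close>

lemma pr_list_enumerate:
  fixes f :: "nat \<Rightarrow> nat \<times> nat"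
  assumes "infinite {n. fst (f n) = i}"
  shows "pr_list i (initial_segment f n) = 
     initial_segment (\<lambda>k. snd (f (enumerate {n. fst (f n) = i} k))) (card {j. j < n \<and> fst (f j) = i})"
proof (induction n)
  case (Suc n)
  let ?S = "{n. fst (f n) = i}"
  show ?case
  proof (cases "fst (f n) = i")
    case True
    then have "{j. j < Suc n \<and> fst (f j) = i} = insert n {j. j < n \<and> fst (f j) = i}" by (auto simp: less_Suc_eq)
    then have "card {j. j < Suc n \<and> fst (f j) = i} = Suc (card {j. j < n \<and> fst (f j) = i})" by simp
    moreover have "enumerate ?S (card {j. j < n \<and> fst (f j) = i}) = n"
      using enumerate_card[OF assms, of n] True by simp
    ultimately show ?thesis using Suc True by (simp add: initial_segment_Suc)
  next
    case False
    then have "{j. j < Suc n \<and> fst (f j) = i} = {j. j < n \<and> fst (f j) = i}" by (auto simp: less_Suc_eq)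
    then show ?thesis using Suc False by (simp add: initial_segment_Suc)
  qed
qed simp

lemma pr_list_path:
  fixes f :: "nat \<Rightarrow> nat \<times> nat"
  assumes "infinite {n. fst (f n) = i}" "\<And>n. pr_list i (initial_segment f n) \<in> T"
  shows "(\<lambda>k. snd (f (enumerate {n. fst (f n) = i} k))) \<in> paths T"
  unfolding paths_def mem_Collect_eq
proof
  fix k
  let ?S = "{n. fst (f n) = i}"
  have "card {j. j < enumerate ?S k \<and> fst (f j) = i} = k"
    using card_enumerate_initial[OF assms(1), of k] by simp
  then show "initial_segment (\<lambda>k. snd (f (enumerate ?S k))) k \<in> T"
    using assms(2)[of "enumerate ?S k"] pr_list_enumerate[OF assms(1), of "enumerate ?S k"] by simp
qed

text \<open>A tape that is used from \<open>L\<close> on is infinite, and its projection is a path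
  because all its finite parts lie in the tree; all tag changes occur before
  \<open>L\<close>.\<close>

lemma disjunction_omega_memI:
  fixes f :: "nat \<Rightarrow> nat \<times> nat"
  assumes "\<And>n. fst (f n) \<in> {0, 1}" "\<And>n. n \<ge> L \<Longrightarrow> fst (f n) = i" 
    "\<And>n. pr_list 0 (initial_segment f n) \<in> T0" "\<And>n. pr_list 1 (initial_segment f n) \<in> T1"
  shows "prod_encode \<circ> f \<in> disjunction_omega (paths T0) T0 (paths T1) T1"
proof -
  have "{L..} \<subseteq> {n. fst (f n) = i}" using assms(2) by auto
  then have inf: "infinite {n. fst (f n) = i}" by (rule infinite_super) (rule infinite_Ici)
  have "i \<in> {0, 1}" using assms(1)[of L] assms(2)[of L] by simp
  then have pr: "pr_in 0 f (paths T0) \<or> pr_in 1 f (paths T1)"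
    using pr_list_path[of f 0 T0, OF _ assms(3)] pr_list_path[of f 1 T1, OF _ assms(4)] inf
    unfolding pr_in_def by blast
  have "tag_changes f \<subseteq> {..<L}"
  proof
    fix n assume "n \<in> tag_changes f"
    then have "\<not> L \<le> n" using assms(2)[of n] assms(2)[of "Suc n"] by (auto simp: tag_changes_def)
    then show "n \<in> {..<L}" by simp
  qed
  then have fin: "finite (tag_changes f)" by (rule finite_subset) simp
  show ?thesis
    unfolding disjunction_omega_def mem_Collect_eq
    by (intro exI[of _ f] conjI allI refl pr fin assms(1,3,4))
qed

section \<open>Concatenations as interleavings\<close>

lemma prepend_singleton [simp]: "prepend [j] h 0 = j" "prepend [j] h (Suc n) = h n"
  by (simp_all add: prepend_def)

lemma initial_segment_prepend: "initial_segment (prepend [j] h) (Suc n) = j # initial_segment h n"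
proof (rule nth_equalityI)
  fix i assume "i < length (initial_segment (prepend [j] h) (Suc n))"
  then show "initial_segment (prepend [j] h) (Suc n) ! i = (j # initial_segment h n) ! i" by (cases i) simp_all
qed simp

lemma paths_initial_segment: "f \<in> paths T \<Longrightarrow> initial_segment f n \<in> T"
  by (simp add: paths_def)

lemma Nil_in_tree: "f \<in> paths T \<Longrightarrow> [] \<in> T"
  using paths_initial_segment[of f T 0] by simp

lemma paths_binary: "computable_tree T \<Longrightarrow> f \<in> paths T \<Longrightarrow> f n < 2"
  using tree_binary[OF _ paths_initial_segment[of f T "Suc n"]] by (auto simp: initial_segment_Suc)

text \<open>In the second case \<open>m\<close> is the length of the leaf. A leaf has no extension
  in the tree, so the passage to the second set is visible from the tree alone.\<close>

lemma concatenation_cases: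
  assumes "h \<in> concatenation (paths S) S (paths S')" "computable_tree S"
  obtains "h \<in> paths S"
    | m where "(\<lambda>n. h (n + m)) \<in> paths S'" "initial_segment h m \<in> S" "\<And>n. m < n \<Longrightarrow> initial_segment h n \<notin> S"
proof -
  have "h \<in> paths S \<or> (\<exists>m. (\<lambda>n. h (n + m)) \<in> paths S' \<and> initial_segment h m \<in> S \<and> (\<forall>n>m. initial_segment h n \<notin> S))"
  proof (cases "h \<in> paths S")
    case False
    then obtain \<rho> y where \<rho>: "\<rho> \<in> leaves S" "y \<in> paths S'" "h = prepend \<rho> y"
      using assms(1) by (auto simp: concatenation_def)
    have y: "(\<lambda>n. h (n + length \<rho>)) = y" by (auto simp: \<rho>(3) prepend_def)
    have init: "initial_segment h (length \<rho>) = \<rho>" by (rule nth_equalityI) (auto simp: \<rho>(3) prepend_def)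
    have "initial_segment h n \<notin> S" if "length \<rho> < n" for n
    proof
      assume "initial_segment h n \<in> S"
      then have "initial_segment h (Suc (length \<rho>)) \<in> S"
        using tree_initial_segment[OF assms(2)] that by (metis Suc_leI)
      then show False using \<rho>(1) by (simp add: initial_segment_Suc init leaves_def)
    qed
    then show ?thesis using \<rho> y init by (auto simp: leaves_def intro!: exI[of _ "length \<rho>"])
  qed simp
  then show ?thesis using that by blast
qed

text \<open>Entry \<open>n\<close> is tagged by testing the segment of length \<open>Suc n\<close>,
  which includes it; the tag thus switches exactly at the first entry after the leaf.\<close>

lemma split_concatenation:
  fixes f :: "nat \<Rightarrow> nat \<times> nat"
  assumes h: "h \<in> concatenation (paths S) S (paths S')" and S: "computable_tree S" and "[] \<in> S'" "j \<noteq> j'"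
    and f: "\<And>n. f n = (if initial_segment h (Suc n) \<in> S then j else j', h n)"
  shows "\<exists>L i. \<forall>n\<ge>L. fst (f n) = i" "pr_list j (initial_segment f n) \<in> S"
    "pr_list j' (initial_segment f n) \<in> S'"
proof -
  have "(\<exists>L i. \<forall>n\<ge>L. fst (f n) = i) \<and> pr_list j (initial_segment f n) \<in> S \<and>
    pr_list j' (initial_segment f n) \<in> S'"
  proof (rule concatenation_cases[OF h S])
    assume p: "h \<in> paths S"
    then have "f n = (j, h n)" for n by (simp add: f paths_initial_segment)
    moreover from this have "pr_list j (initial_segment f n) = initial_segment h n \<and>
      pr_list j' (initial_segment f n) = []" for n
      using assms(4) by (induction n) (simp_all add: initial_segment_Suc)
    ultimately show ?thesis using p assms(3) by (simp add: paths_initial_segment)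
  next
    fix m assume m: "(\<lambda>n. h (n + m)) \<in> paths S'" "initial_segment h m \<in> S"
      "\<And>n. m < n \<Longrightarrow> initial_segment h n \<notin> S"
    have fn: "f n = (if n < m then j else j', h n)" for n
      using m(3)[of "Suc n"] tree_initial_segment[OF S m(2), of "Suc n"] by (auto simp: f)
    have "pr_list j (initial_segment f n) = initial_segment h (min n m) \<and>
      pr_list j' (initial_segment f n) = initial_segment (\<lambda>n. h (n + m)) (n - m)" for n
    proof (induction n)
      case (Suc n)
      then show ?case using assms(4)
        by (cases "n < m") (simp_all add: initial_segment_Suc fn min_def Suc_diff_le)
    qed simp
    moreover have "initial_segment h (min n m) \<in> S" by (rule tree_initial_segment[OF S m(2)]) simp
    moreover have "\<forall>n\<ge>m. fst (f n) = j'" by (simp add: fn)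
    ultimately show ?thesis using m(1) by (metis paths_initial_segment)
  qed
  then show "\<exists>L i. \<forall>n\<ge>L. fst (f n) = i" "pr_list j (initial_segment f n) \<in> S"
    "pr_list j' (initial_segment f n) \<in> S'" by blast+
qed

text \<open>The finite string is built into the program as a constant, so the continued interleaving
  is computable from the sequence on the current tape alone.\<close>

lemma eff_continue_with: "effective (\<lambda>g n. prod_encode (continue_with g i \<sigma> n))"
proof -
  have *: "prod_encode (continue_with g i \<sigma> n) = (if n < length \<sigma>
      then lnth (list_decode (list_encode (map prod_encode \<sigma>))) n
      else prod_encode (i, g (n - length \<sigma> + length (pr_list i \<sigma>))))" for g n
    by (simp add: continue_with_def lnth_def)
  show ?thesis unfolding * by (intro eff)
qed

lemma computable_compose:
  assumes "effective F" "\<forall>n. run (F x) p n = Some (b n)"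
  shows "\<exists>c. \<forall>n. run x c n = Some (b (n + m))"
proof -
  obtain d where d: "\<And>g n. run g d n = Some (F g n)" using assms(1) unfolding effective_def by blast
  obtain s where s: "\<And>g n. run g s n = Some (n + m)"
    using eff_add[OF eff_id eff_const[of m]] unfolding effective_def by blast
  have "run x (Comp (subst_query d p) s) n = Some (b (n + m))" for n
    using run_subst_query[of x d "F x" p] assms(2) by (simp add: d s)
  then show ?thesis by blast
qed

text \<open>Tags and entries alternate, so an interleaving of binary sequences stays in Cantor
  space, which the numerical pairing would leave.\<close>

definition split_coding :: "(nat \<Rightarrow> nat \<times> nat) \<Rightarrow> nat \<Rightarrow> nat" where
  "split_coding f k = (if even k then fst (f (k div 2)) else snd (f (k div 2)))"

definition pairs :: "(nat \<Rightarrow> nat) \<Rightarrow> nat \<Rightarrow> nat \<times> nat" where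
  "pairs z n = (z (2 * n), z (2 * n + 1))"

lemma pairs_split_coding [simp]: "pairs (split_coding f) = f"
  by (simp add: pairs_def split_coding_def fun_eq_iff)

text \<open>
  Interleavings of paths where the number of tape changes is at most the position of the first
  entry on tape 1.  Unlike the finiteness of the number of changes, this is a closed condition.
\<close>

definition limited :: "nat list set \<Rightarrow> nat list set \<Rightarrow> (nat \<Rightarrow> nat) set" where
  "limited T0 T1 = {z \<in> cantor_space.
     (\<forall>n. pr_list 0 (initial_segment (pairs z) n) \<in> T0 \<and> pr_list 1 (initial_segment (pairs z) n) \<in> T1) \<and>
     (\<forall>n k. fst (pairs z k) = 1 \<longrightarrow> card {j. j < n \<and> fst (pairs z j) \<noteq> fst (pairs z (Suc j))} \<le> k)}"

lemma Pi01_limited: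
  assumes "computable_tree T0" "computable_tree T1"
  shows "Pi01 (limited T0 T1)"
proof -
  define bad where "bad z q \<longleftrightarrow> \<not> (pr_list 0 (initial_segment (pairs z) (pfst q)) \<in> T0 \<and>
      pr_list 1 (initial_segment (pairs z) (pfst q)) \<in> T1) \<or>
      (fst (pairs z (psnd q)) = 1 \<and> psnd q < card {j. j < pfst q \<and> fst (pairs z j) \<noteq> fst (pairs z (Suc j))})" for z q
  have pr: "decidable (\<lambda>z q. pr_list i (initial_segment (pairs z) (pfst q)) \<in> T)" if "computable_tree T" for i T
  proof -
    have "effective (\<lambda>z q. list_encode (pr_list i (initial_segment (pairs z) (pfst q))))"
      unfolding pr_list_initial_segment pairs_def fst_conv snd_conv by (intro eff_map_filter eff)
    from dec_tree[OF that this] show ?thesis by simp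
  qed
  have "decidable (\<lambda>z q. bad z q)"
    unfolding bad_def
    by (intro dec_disj dec_not dec_conj pr assms) (unfold pairs_def fst_conv snd_conv, (intro eff)+)
  then have "Pi01 {z \<in> cantor_space. \<forall>q. \<not> bad z q}" by (rule Pi01I)
  moreover have "limited T0 T1 = {z \<in> cantor_space. \<forall>q. \<not> bad z q}"
  proof -
    have "(\<forall>n k. Q n k) \<longleftrightarrow> (\<forall>q. Q (pfst q) (psnd q))" for Q :: "nat \<Rightarrow> nat \<Rightarrow> bool"
      by (metis prod_encode_inverse fst_conv snd_conv)
    from this[of "\<lambda>n k. (pr_list 0 (initial_segment (pairs z) n) \<in> T0 \<and> pr_list 1 (initial_segment (pairs z) n) \<in> T1) \<and>
       (fst (pairs z k) = 1 \<longrightarrow> card {j. j < n \<and> fst (pairs z j) \<noteq> fst (pairs z (Suc j))} \<le> k)" for z]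
    show ?thesis unfolding limited_def bad_def by (auto simp: not_less)
  qed
  ultimately show ?thesis by simp
qed

lemma Pi01_coproduct:
  assumes "computable_tree T0" "computable_tree T1"
  shows "Pi01 (coproduct (paths T0) (paths T1))"
proof -
  let ?h = "\<lambda>b k. b (Suc k) :: nat"
  have *: "coproduct (paths T0) (paths T1) = {b \<in> cantor_space. \<forall>n.
     \<not> (if b 0 = 0 then initial_segment (?h b) n \<notin> T0 else initial_segment (?h b) n \<notin> T1)}"
  proof (intro equalityI subsetI)
    fix b assume "b \<in> coproduct (paths T0) (paths T1)"
    then consider h where "b = prepend [0] h" "h \<in> paths T0" | h where "b = prepend [1] h" "h \<in> paths T1"
      by (auto simp: coproduct_def)
    then show "b \<in> {b \<in> cantor_space. \<forall>n.
     \<not> (if b 0 = 0 then initial_segment (?h b) n \<notin> T0 else initial_segment (?h b) n \<notin> T1)}"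
    proof cases
      case 1
      have "b n < 2" for n using paths_binary[OF assms(1) 1(2)] by (cases n) (simp_all add: 1(1))
      then show ?thesis using 1 by (simp add: cantor_space_iff paths_initial_segment)
    next
      case 2
      have "b n < 2" for n using paths_binary[OF assms(2) 2(2)] by (cases n) (simp_all add: 2(1))
      then show ?thesis using 2 by (simp add: cantor_space_iff paths_initial_segment)
    qed
  next
    fix b assume b: "b \<in> {b \<in> cantor_space. \<forall>n.
     \<not> (if b 0 = 0 then initial_segment (?h b) n \<notin> T0 else initial_segment (?h b) n \<notin> T1)}"
    then have "b 0 < 2" by (simp add: cantor_space_iff)
    then have "b 0 = 0 \<or> b 0 = 1" by auto
    moreover have "b = prepend [b 0] (?h b)"
    proof
      show "b n = prepend [b 0] (?h b) n" for n by (cases n) simp_all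
    qed
    ultimately show "b \<in> coproduct (paths T0) (paths T1)"
      using b unfolding coproduct_def paths_def by (cases "b 0 = 0") (auto split: if_splits)
  qed
  have tree: "decidable (\<lambda>g x. initial_segment (?h g) x \<in> T)" if "computable_tree T" for T
  proof -
    have "effective (\<lambda>g x. list_encode (initial_segment (?h g) x))"
      by (intro eff_initial_segment eff)
    from dec_tree[OF that this] show ?thesis by simp
  qed
  show ?thesis unfolding * by (rule Pi01I) (intro eff tree assms)
qed

text \<open>The trees are parameters because part (1) concerns arbitrary given trees, whereas part
  (2) may choose them.\<close>

locale incomparable_trees =
  fixes T :: "nat \<Rightarrow> nat list set" and u :: "nat \<Rightarrow> nat \<Rightarrow> nat"
  assumes tree: "i < 2 \<Longrightarrow> computable_tree (T i)"
    and path: "i < 2 \<Longrightarrow> u i \<in> paths (T i)"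
    and incomparable: "i < 2 \<Longrightarrow> y \<in> paths (T (1 - i)) \<Longrightarrow> \<not> (\<forall>n. run (u i) c n = Some (y n))"
begin

lemma continue_facts:
  assumes "interleaving u \<sigma>" "i < 2"
  shows "fst (continue_with (u i) i \<sigma> n) < 2" "snd (continue_with (u i) i \<sigma> n) < 2"
    "k < 2 \<Longrightarrow> pr_list k (initial_segment (continue_with (u i) i \<sigma>) n) \<in> T k"
proof -
  let ?f = "continue_with (u i) i \<sigma>"
  have int: "interleaving u (initial_segment ?f n)" for n by (rule interleaving_continue[OF assms])
  show pr: "pr_list k (initial_segment ?f n) \<in> T k" if "k < 2" for k n
    using interleaving_pr_list[OF int that path[OF that]] .
  show fst: "fst (?f n) < 2" using int[of "Suc n"] by (simp add: interleaving_def initial_segment_Suc)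
  have "snd (?f n) \<in> set (pr_list (fst (?f n)) (initial_segment ?f (Suc n)))"
    by (simp add: initial_segment_Suc)
  then have "snd (?f n) \<in> {0, 1}" using tree_binary[OF tree[OF fst] pr[OF fst]] by blast
  then show "snd (?f n) < 2" by auto
qed

text \<open>Otherwise \<open>u i\<close> would compute a path of the other tree, contrary to
  incomparability.\<close>

lemma type_of_tail:
  assumes "effective F" "i < 2" "j < 2" "\<forall>n. run (F (u i)) p n = Some (b n)" "(\<lambda>n. b (n + m)) \<in> paths (T j)"
  shows "i = j"
proof (rule ccontr)
  assume "i \<noteq> j"
  then have "1 - i = j" using assms(2,3) by auto
  moreover obtain c where "\<forall>n. run (u i) c n = Some (b (n + m))"
    using computable_compose[where F=F and x="u i" and b=b, OF assms(1,4)] by blast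
  ultimately show False using incomparable[OF assms(2), of "\<lambda>n. b (n + m)"] assms(5) by blast
qed

section \<open>The disjunction with finitely many switches and the commutative concatenation\<close>

abbreviation "odisj \<equiv> disjunction_omega (paths (T 0)) (T 0) (paths (T 1)) (T 1)"
abbreviation "conc \<equiv> commutative_concatenation (paths (T 0)) (T 0) (paths (T 1)) (T 1)"

lemma conc_cases:
  assumes "b \<in> conc"
  obtains j h where "j < 2" "b = prepend [j] h" "h \<in> concatenation (paths (T j)) (T j) (paths (T (1 - j)))"
  using assms unfolding commutative_concatenation_def coproduct_def by (auto intro: that[of 0] that[of 1])

text \<open>A single program suffices: copy the input to the tape named by its first bit until it
  leaves that tree, and to the other tape afterwards.\<close>

lemma le_mc_disj_conc: "le_mc odisj conc"
proof -
  define F where "F g n = (if initial_segment (\<lambda>k. g (Suc k)) (Suc n) \<in> (if g 0 = 0 then T 0 else T 1)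
     then g 0 else 1 - g 0, g (Suc n))" for g n
  have "decidable (\<lambda>g n. initial_segment (\<lambda>k. g (Suc k)) (Suc n) \<in> T i)" if "i < 2" for i
  proof -
    have "effective (\<lambda>g n. list_encode (initial_segment (\<lambda>k. g (Suc k)) (Suc n)))"
      by (intro eff_initial_segment eff)
    from dec_tree[OF tree[OF that] this] show ?thesis by simp
  qed
  \<comment> \<open>The bit \<open>g 0\<close> chooses the tree; pulling the choice out of the
    membership leaves two decidable tests.\<close>
  from this[of 0] this[of 1] have "effective (\<lambda>g n. prod_encode (F g n))"
    unfolding F_def if_distrib[where f="\<lambda>S. _ \<in> S"] by (intro eff) simp_all
  then obtain c where c: "\<And>g n. run g c n = Some (prod_encode (F g n))" unfolding effective_def by blast
  have mem: "prod_encode \<circ> F g \<in> odisj" if g: "g \<in> conc" for g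
  proof (rule conc_cases[OF g])
    fix j h assume j: "j < 2" and gh: "g = prepend [j] h"
      and h: "h \<in> concatenation (paths (T j)) (T j) (paths (T (1 - j)))"
    have F: "F g n = (if initial_segment h (Suc n) \<in> T j then j else 1 - j, h n)" for n
      using j by (cases "j = 0") (auto simp: F_def gh less_2_cases_iff)
    have "j \<noteq> 1 - j" "1 - j < 2" using j by arith+
    note S = split_concatenation[where f="F g", OF h tree[OF j] Nil_in_tree[OF path[OF \<open>1 - j < 2\<close>]] \<open>j \<noteq> 1 - j\<close> F]
    have "pr_list 0 (initial_segment (F g) n) \<in> T 0" "pr_list 1 (initial_segment (F g) n) \<in> T 1" for n
      using S(2,3)[of n] j by (cases "j = 0"; simp add: less_2_cases_iff)+
    moreover have "fst (F g n) \<in> {0, 1}" for n using j by (auto simp: F)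
    moreover obtain L i where "\<And>n. n \<ge> L \<Longrightarrow> fst (F g n) = i" using S(1) by blast
    ultimately show ?thesis by (intro disjunction_omega_memI) auto
  qed
  show ?thesis
  proof (rule le_computable(1))
    fix g assume "g \<in> conc"
    then show "\<exists>y\<in>odisj. \<forall>n. run g c n = Some (y n)" using mem c by (intro bexI[of _ "prod_encode \<circ> F g"]) auto
  qed
qed

text \<open>The classifier trusts the first bit until the tail leaves the tree, then names the other
  tape. Its at most two changes come from reading the first bit and from leaving the tree. Any
  finite number of switches is allowed, so the empty string provides \<open>room\<close>.\<close>

lemma switching_conc:
  "switching u (\<lambda>f. prod_encode \<circ> f) odisj conc
     (\<lambda>l. if l = [] then 0 else if tl l \<in> T (hd l) then hd l else 1 - hd l) 2" (is "switching _ _ _ _ ?cl _")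
proof
  show "\<exists>M. \<forall>f f'. (\<forall>n<M. f n = f' n) \<longrightarrow> (\<forall>k<N. (prod_encode \<circ> f) k = (prod_encode \<circ> f') k)" for N
    by (intro exI[of _ N]) simp
  show "\<exists>\<sigma>0. interleaving u \<sigma>0 \<and> tag_changes_list \<sigma>0 = 0 \<and>
      (\<forall>\<sigma> i. i < 2 \<longrightarrow> interleaving u (\<sigma>0 @ \<sigma>) \<longrightarrow> tag_changes_list (\<sigma>0 @ \<sigma>) \<le> K \<longrightarrow>
        prod_encode \<circ> continue_with (u i) i (\<sigma>0 @ \<sigma>) \<in> odisj)" for K
  proof (intro exI[of _ "[]"] conjI allI impI)
    show "interleaving u []" "tag_changes_list [] = 0" by (simp_all add: interleaving_def tag_changes_list_def)
    fix \<sigma> :: "(nat \<times> nat) list" and i :: nat assume i: "i < 2" and int: "interleaving u ([] @ \<sigma>)"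
    note F = continue_facts[OF int i]
    show "prod_encode \<circ> continue_with (u i) i ([] @ \<sigma>) \<in> odisj"
    proof (rule disjunction_omega_memI)
      show "fst (continue_with (u i) i ([] @ \<sigma>) n) \<in> {0, 1}" for n using F(1)[of n] by auto
      show "fst (continue_with (u i) i ([] @ \<sigma>) n) = i" if "length \<sigma> \<le> n" for n
        using that by (simp add: continue_with_def)
    qed (use F(3) in auto)
  qed
next
  fix i b \<sigma> p
  assume i: "i < 2" and b: "b \<in> conc"
    and run: "\<forall>n. run (prod_encode \<circ> continue_with (u i) i \<sigma>) p n = Some (b n)"
  have run': "\<forall>n. run ((\<lambda>g n. prod_encode (continue_with g i \<sigma> n)) (u i)) p n = Some (b n)"
    using run by (simp add: comp_def)
  note type = type_of_tail[where F="\<lambda>g n. prod_encode (continue_with g i \<sigma> n)", OF eff_continue_with i _ run']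
  show "\<exists>L0. \<forall>L\<ge>L0. ?cl (initial_segment b L) = i"
  proof (rule conc_cases[OF b])
    fix j h assume j: "j < 2" and bh: "b = prepend [j] h"
      and h: "h \<in> concatenation (paths (T j)) (T j) (paths (T (1 - j)))"
    have cl: "?cl (initial_segment b (Suc n)) = (if initial_segment h n \<in> T j then j else 1 - j)" for n
      by (simp add: bh initial_segment_prepend)
    show ?thesis
    proof (rule concatenation_cases[OF h tree[OF j]])
      assume p: "h \<in> paths (T j)"
      have "(\<lambda>n. b (n + 1)) = h" by (simp add: bh)
      then have "i = j" using p by (intro type[of _ 1] j) simp
      then have "?cl (initial_segment b L) = i" if "1 \<le> L" for L
      proof -
        obtain n where L: "L = Suc n" using \<open>1 \<le> L\<close> by (cases L) auto
        show ?thesis unfolding L cl using p \<open>i = j\<close> by (simp add: paths_initial_segment)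
      qed
      then show ?thesis by blast
    next
      fix m assume m: "(\<lambda>n. h (n + m)) \<in> paths (T (1 - j))" "\<And>n. m < n \<Longrightarrow> initial_segment h n \<notin> T j"
      have "(\<lambda>n. b (n + Suc m)) = (\<lambda>n. h (n + m))" by (simp add: bh)
      then have "i = 1 - j" using m(1) by (intro type[of _ "Suc m"]) simp_all
      then have "?cl (initial_segment b L) = i" if "Suc (Suc m) \<le> L" for L
      proof -
        obtain n where L: "L = Suc n" "m < n" using \<open>Suc (Suc m) \<le> L\<close> by (cases L) auto
        show ?thesis unfolding L(1) cl using m(2)[OF L(2)] \<open>i = 1 - j\<close> by simp
      qed
      then show ?thesis by blast
    qed
  qed
next
  fix b assume "b \<in> conc"
  then obtain j h where j: "j < 2" and bh: "b = prepend [j] h" by (rule conc_cases)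
  let ?X = "{n. initial_segment h n \<in> T j \<and> initial_segment h (Suc n) \<notin> T j}"
  have "n = m" if "n \<in> ?X" "m \<in> ?X" for n m
  proof (rule ccontr)
    assume "n \<noteq> m"
    then have "Suc n \<le> m \<or> Suc m \<le> n" by auto
    then show False using that tree_initial_segment[OF tree[OF j]] by blast
  qed
  then obtain m where m: "?X \<subseteq> {m}" by blast
  have cl: "?cl (initial_segment b (Suc n)) = (if initial_segment h n \<in> T j then j else 1 - j)" for n
    by (simp add: bh initial_segment_prepend)
  have "n \<in> {0, Suc m}" if n: "n \<in> mind_changes ?cl b" for n
  proof (cases n)
    case (Suc k)
    have "(if initial_segment h (Suc k) \<in> T j then j else 1 - j) \<noteq> (if initial_segment h k \<in> T j then j else 1 - j)"
      using n unfolding mind_changes_def Suc mem_Collect_eq cl .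
    then have "k \<in> ?X" using tree_initial_segment[OF tree[OF j], of h "Suc k" k] by (auto split: if_splits)
    then show ?thesis using m Suc by auto
  qed simp
  then have sub: "mind_changes ?cl b \<subseteq> {0, Suc m}" by blast
  then show "finite (mind_changes ?cl b) \<and> card (mind_changes ?cl b) \<le> 2"
    using finite_subset[OF sub] card_mono[OF _ sub] by simp
qed

theorem less_mc_disj_conc: "less_mc odisj conc"
proof -
  interpret switching u "\<lambda>f. prod_encode \<circ> f" odisj conc
    "\<lambda>l. if l = [] then 0 else if tl l \<in> T (hd l) then hd l else 1 - hd l" 2
    by (rule switching_conc)
  show ?thesis unfolding less_mc_def using le_mc_disj_conc not_le_mc by blast
qed

section \<open>Limited interleavings and the coproduct\<close>

abbreviation "lim_set \<equiv> limited (T 0) (T 1)"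
abbreviation "cop \<equiv> coproduct (paths (T 0)) (paths (T 1))"

lemma cop_cases:
  assumes "b \<in> cop"
  obtains j h where "j < 2" "b = prepend [j] h" "h \<in> paths (T j)"
  using assms unfolding coproduct_def by (auto intro: that[of 0] that[of 1])

lemma cop_memI: "j < 2 \<Longrightarrow> h \<in> paths (T j) \<Longrightarrow> prepend [j] h \<in> cop"
  by (auto simp: coproduct_def less_2_cases_iff)

lemma split_coding_limited:
  assumes "\<And>n. fst (f n) < 2" "\<And>n. snd (f n) < 2" "\<And>k n. k < 2 \<Longrightarrow> pr_list k (initial_segment f n) \<in> T k"
    "finite (tag_changes f)" "\<And>k. fst (f k) = 1 \<Longrightarrow> card (tag_changes f) \<le> k"
  shows "split_coding f \<in> lim_set"
proof -
  have "card {j. j < n \<and> fst (f j) \<noteq> fst (f (Suc j))} \<le> k" if "fst (f k) = 1" for n k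
  proof -
    have "card {j. j < n \<and> fst (f j) \<noteq> fst (f (Suc j))} \<le> card (tag_changes f)"
      by (rule card_mono[OF assms(4)]) (auto simp: tag_changes_def)
    also have "\<dots> \<le> k" by (rule assms(5)[OF that])
    finally show ?thesis .
  qed
  moreover have "split_coding f \<in> cantor_space"
    using assms(1,2) by (simp add: cantor_space_iff split_coding_def)
  ultimately show ?thesis unfolding limited_def using assms(3)[of 0] assms(3)[of 1] by simp
qed

lemma switching_limited: "switching u split_coding lim_set cop (\<lambda>l. if l = [] then 0 else hd l) 1"
  (is "switching _ _ _ _ ?cl _")
proof
  show "\<exists>M. \<forall>f f'. (\<forall>n<M. f n = f' n) \<longrightarrow> (\<forall>k<N. split_coding f k = split_coding f' k)" for N
    by (intro exI[of _ N]) (auto simp: split_coding_def)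
  show "\<exists>\<sigma>0. interleaving u \<sigma>0 \<and> tag_changes_list \<sigma>0 = 0 \<and>
      (\<forall>\<sigma> i. i < 2 \<longrightarrow> interleaving u (\<sigma>0 @ \<sigma>) \<longrightarrow> tag_changes_list (\<sigma>0 @ \<sigma>) \<le> K \<longrightarrow>
        split_coding (continue_with (u i) i (\<sigma>0 @ \<sigma>)) \<in> lim_set)" for K
  proof -
    \<comment> \<open>With \<open>Suc K\<close> entries on tape 0 first, tape 1 starts no earlier
      than position \<open>Suc K\<close>. This permits the \<open>K\<close> switches of the string
      and one more for the continuation.\<close>
    define \<sigma>0 where "\<sigma>0 = map (\<lambda>k. (0::nat, u 0 k)) [0..<Suc K]"
    have nth: "\<sigma>0 ! k = (0, u 0 k)" if "k < Suc K" for k using that unfolding \<sigma>0_def by (simp del: upt_Suc)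
    have len: "length \<sigma>0 = Suc K" by (simp add: \<sigma>0_def)
    have "pr_list 0 (map (\<lambda>k. (0::nat, u 0 k)) ks) = map (u 0) ks"
      "pr_list (Suc 0) (map (\<lambda>k. (0::nat, u 0 k)) ks) = []" for ks
      by (induction ks) simp_all
    then have "interleaving u \<sigma>0"
      unfolding interleaving_def \<sigma>0_def by (auto simp: less_2_cases_iff initial_segment_def)
    moreover have "tag_changes_list \<sigma>0 = 0" by (simp add: tag_changes_list_def len nth)
    moreover have "split_coding (continue_with (u i) i (\<sigma>0 @ \<sigma>)) \<in> lim_set"
      if i: "i < 2" and int: "interleaving u (\<sigma>0 @ \<sigma>)" and K: "tag_changes_list (\<sigma>0 @ \<sigma>) \<le> K" for \<sigma> i
    proof (rule split_coding_limited)
      let ?f = "continue_with (u i) i (\<sigma>0 @ \<sigma>)"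
      show "finite (tag_changes ?f)" by (rule finite_tag_changes_continue)
      fix k assume k: "fst (?f k) = 1"
      have "Suc K \<le> k"
      proof (rule ccontr)
        assume "\<not> Suc K \<le> k"
        then have "?f k = (0, u 0 k)" by (simp add: continue_with_def len nth_append nth)
        then show False using k by simp
      qed
      then show "card (tag_changes ?f) \<le> k"
        using card_tag_changes_continue[of "u i" i "\<sigma>0 @ \<sigma>"] K by linarith
    qed (use continue_facts[OF int i] in auto)
    ultimately show ?thesis by blast
  qed
next
  fix i b \<sigma> p
  assume i: "i < 2" and b: "b \<in> cop"
    and run: "\<forall>n. run (split_coding (continue_with (u i) i \<sigma>)) p n = Some (b n)"
  define F where "F g k = split_coding (continue_with g i \<sigma>) k" for g k
  have F: "F g k = (if k mod 2 = 0 then pfst (prod_encode (continue_with g i \<sigma> (k div 2)))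
      else psnd (prod_encode (continue_with g i \<sigma> (k div 2))))" for g k
    by (simp add: F_def split_coding_def even_iff_mod_2_eq_zero)
  have "effective (\<lambda>g k. F g k)" unfolding F by (intro eff eff_comp[OF eff_continue_with])
  have run': "\<forall>n. run (F (u i)) p n = Some (b n)" using run by (simp add: F_def[abs_def])
  obtain j h where j: "j < 2" "b = prepend [j] h" "h \<in> paths (T j)" using cop_cases[OF b] .
  have "(\<lambda>n. b (n + 1)) = h" by (simp add: j(2))
  then have "i = j" using j(3) by (intro type_of_tail[where F=F, OF \<open>effective F\<close> i j(1) run', of 1]) simp
  have "?cl (initial_segment b L) = i" if "1 \<le> L" for L
  proof -
    obtain n where L: "L = Suc n" using \<open>1 \<le> L\<close> by (cases L) auto
    show ?thesis unfolding L using \<open>i = j\<close> by (simp add: j(2) initial_segment_prepend)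
  qed
  then show "\<exists>L0. \<forall>L\<ge>L0. ?cl (initial_segment b L) = i" by blast
next
  fix b assume b: "b \<in> cop"
  obtain j h where j: "j < 2" "b = prepend [j] h" "h \<in> paths (T j)" using cop_cases[OF b] .
  have "n = 0" if "n \<in> mind_changes ?cl b" for n
    using that by (cases n) (simp_all add: mind_changes_def j(2) initial_segment_prepend)
  then have sub: "mind_changes ?cl b \<subseteq> {0}" by blast
  then show "finite (mind_changes ?cl b) \<and> card (mind_changes ?cl b) \<le> 1"
    using finite_subset[OF sub] card_mono[OF _ sub] by simp
qed

text \<open>Write the sequence on the tape named by its first bit; no tag change occurs, so the
  limit on changes holds trivially.\<close>

lemma limited_le_cop: "le_mc lim_set cop" "le_err lim_set cop"
proof -
  have "effective (\<lambda>b k. if k mod 2 = 0 then b 0 else b (Suc (k div 2)))" by (intro eff)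
  then obtain c where c: "\<And>b k. run b c k = Some (if k mod 2 = 0 then b 0 else b (Suc (k div 2)))"
    unfolding effective_def by blast
  have *: "\<exists>y\<in>lim_set. \<forall>n. run b c n = Some (y n)" if b: "b \<in> cop" for b
  proof -
    obtain j h where j: "j < 2" "b = prepend [j] h" "h \<in> paths (T j)" using cop_cases[OF b] .
    let ?f = "\<lambda>n. (j, h n)"
    have pr: "pr_list k (initial_segment ?f n) = (if k = j then initial_segment h n else [])" for k n
      by (induction n) (simp_all add: initial_segment_Suc)
    have "split_coding ?f \<in> lim_set"
    proof (rule split_coding_limited)
      show "pr_list k (initial_segment ?f n) \<in> T k" if "k < 2" for k n
        unfolding pr using j(3) Nil_in_tree[OF path[OF that]] by (simp add: paths_initial_segment)
      show "snd (?f n) < 2" for n using paths_binary[OF tree[OF j(1)] j(3)] by simp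
    qed (use j(1) in \<open>simp_all add: tag_changes_def\<close>)
    moreover have "run b c n = Some (split_coding ?f n)" for n
      by (simp add: c split_coding_def j(2) even_iff_mod_2_eq_zero)
    ultimately show ?thesis by blast
  qed
  show "le_mc lim_set cop" "le_err lim_set cop" by (rule le_computable[OF *], assumption)+
qed

lemma read_tape: "\<exists>c. \<forall>z. infinite {n. fst (pairs z n) = i} \<longrightarrow> (\<forall>n. run z c n =
    Some (prepend [i] (\<lambda>k. snd (pairs z (enumerate {n. fst (pairs z n) = i} k))) n))"
proof -
  define found where "found z n N \<longleftrightarrow> n = 0 \<or> (fst (pairs z N) = i \<and>
     card {j. j < N \<and> fst (pairs z j) = i} = n - 1)" for z n N
  have "decidable (\<lambda>z q. \<not> found z (pfst q) (psnd q))"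
    unfolding found_def pairs_def fst_conv snd_conv by (intro eff)
  then obtain s where s: "\<And>z q. run z s q = Some (of_bool (\<not> found z (pfst q) (psnd q)))"
    unfolding effective_def by blast
  have "effective (\<lambda>z q. if pfst q = 0 then i else z (2 * psnd q + 1))" by (intro eff)
  then obtain r where r: "\<And>z q. run z r q = Some (if pfst q = 0 then i else z (2 * psnd q + 1))"
    unfolding effective_def by blast
  \<comment> \<open>\<open>Pair Fst Snd\<close> is the identity. For \<open>n = 0\<close> the search
    succeeds at once and the tag is output; for \<open>n > 0\<close> it finds the position of entry
    \<open>n - 1\<close> of the tape.\<close>
  have "run z (Comp r (Pair (Pair Fst Snd) (Search s))) n =
      Some (prepend [i] (\<lambda>k. snd (pairs z (enumerate {n. fst (pairs z n) = i} k))) n)"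
    if inf: "infinite {n. fst (pairs z n) = i}" for z n
  proof -
    let ?S = "{n. fst (pairs z n) = i}"
    have f: "found z n N \<longleftrightarrow> (n = 0 \<or> N = enumerate ?S (n - 1))" for N
      using card_enumerate_initial[OF inf, of "n - 1"] enumerate_card[OF inf, of N]
        enumerate_in_set[OF inf, of "n - 1"] by (auto simp: found_def)
    then have "run z (Search s) n = Some (LEAST N. found z n N)" by (auto simp: s)
    moreover have "n \<noteq> 0 \<Longrightarrow> (LEAST N. found z n N) = enumerate ?S (n - 1)"
      by (rule Least_equality) (simp_all add: f)
    ultimately show ?thesis by (cases n) (simp_all add: r pairs_def)
  qed
  then show ?thesis by blast
qed

text \<open>If tape 1 is used at position \<open>k\<close>, there are at most \<open>k\<close> tag
  changes altogether; otherwise all tags are 0.\<close>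

lemma limited_tag_converges:
  assumes "z \<in> lim_set"
  shows "\<exists>L i. i < 2 \<and> (\<forall>n\<ge>L. z (2 * n) = i)"
proof -
  let ?S = "{j. z (2 * j) \<noteq> z (2 * Suc j)}"
  have z: "z n < 2" for n using assms by (simp add: limited_def cantor_space_iff)
  have card: "card {j. j < n \<and> j \<in> ?S} \<le> k" if "z (2 * k) = 1" for n k
    using assms that unfolding limited_def pairs_def by simp
  show ?thesis
  proof (cases "\<exists>k. z (2 * k) = 1")
    case True
    then obtain k where k: "z (2 * k) = 1" by blast
    have "finite ?S"
    proof (rule ccontr)
      assume inf: "infinite ?S"
      show False using card_enumerate_initial[OF inf, of "Suc k"] card[OF k, of "enumerate ?S (Suc k)"] by simp
    qed
    then obtain L where L: "\<And>j. j \<in> ?S \<Longrightarrow> j < L" using finite_nat_set_iff_bounded by auto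
    have stable: "z (2 * j) = z (2 * Suc j)" if "L \<le> j" for j
    proof (rule ccontr)
      assume "z (2 * j) \<noteq> z (2 * Suc j)"
      then have "j < L" by (intro L) simp
      then show False using that by simp
    qed
    have "z (2 * n) = z (2 * L)" if "L \<le> n" for n
      using that
    proof (induction n rule: dec_induct)
      case (step n)
      then show ?case using stable[of n] by simp
    qed (rule refl)
    then show ?thesis using z by blast
  next
    case False
    then have "z (2 * n) = 0" for n using z[of "2 * n"] by (metis less_2_cases One_nat_def)
    then show ?thesis by (intro exI[of _ 0]) simp
  qed
qed

text \<open>The learner guesses the current tape. Its mind changes are unbounded over the class, but
  it has only two hypotheses.\<close>

lemma cop_le_limited: "le_err cop lim_set"
proof -
  obtain c where c: "\<And>i z n. infinite {n. fst (pairs z n) = i} \<Longrightarrow> run z (c i) n =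
    Some (prepend [i] (\<lambda>k. snd (pairs z (enumerate {n. fst (pairs z n) = i} k))) n)"
    using read_tape by metis
  \<comment> \<open>This is the last even position below the length, which holds the most recent
    tag; the empty string reads the default 0.\<close>
  define \<Psi> where "\<Psi> \<sigma> = (if lnth \<sigma> (2 * ((length \<sigma> - 1) div 2)) = 0 then index_of (c 0) else index_of (c 1))"
    for \<sigma> :: "nat list"
  have "learner \<Psi>" by (rule computable_on_stringsI) (unfold \<Psi>_def, intro eff)
  then show ?thesis
  proof (rule le_err_finite[where F="{index_of (c 0), index_of (c 1)}"])
    fix z assume z: "z \<in> lim_set"
    obtain L i where i: "i < 2" and L: "\<And>n. L \<le> n \<Longrightarrow> z (2 * n) = i" using limited_tag_converges[OF z] by blast
    have "\<Psi> (initial_segment z n) = index_of (c i)" if n: "2 * L + 2 \<le> n" for n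
    proof -
      have "2 * ((n - 1) div 2) < n" "L \<le> (n - 1) div 2" using n by linarith+
      then have "lnth (initial_segment z n) (2 * ((n - 1) div 2)) = i" by (simp add: lnth_def L)
      then show ?thesis using i by (auto simp: \<Psi>_def less_2_cases_iff)
    qed
    then have ev: "\<forall>\<^sub>F n in sequentially. \<Psi> (initial_segment z n) = index_of (c i)"
      unfolding eventually_sequentially by blast
    have "{L..} \<subseteq> {n. fst (pairs z n) = i}" using L by (auto simp: pairs_def)
    then have inf: "infinite {n. fst (pairs z n) = i}" by (rule infinite_super) (rule infinite_Ici)
    have "pr_list i (initial_segment (pairs z) n) \<in> T i" for n
      using z i by (auto simp: limited_def less_2_cases_iff)
    from pr_list_path[where f="pairs z" and i=i and T="T i", OF inf this]
    have "prepend [i] (\<lambda>k. snd (pairs z (enumerate {n. fst (pairs z n) = i} k))) \<in> cop"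
      by (rule cop_memI[OF i])
    with c[OF inf] ev show "\<exists>e. (\<forall>\<^sub>F n in sequentially. \<Psi> (initial_segment z n) = e) \<and>
      (\<exists>y\<in>cop. \<forall>n. run z (prog_of e) n = Some (y n))"
      by (intro exI[of _ "index_of (c i)"]) (auto simp: prog_of_index_of)
  qed (simp_all add: \<Psi>_def)
qed

theorem limited_equiv_err_less_mc: "equiv_err lim_set cop" "less_mc lim_set cop"
proof -
  interpret switching u split_coding lim_set cop "\<lambda>l. if l = [] then 0 else hd l" 1
    by (rule switching_limited)
  show "equiv_err lim_set cop" "less_mc lim_set cop"
    unfolding equiv_err_def less_mc_def using limited_le_cop cop_le_limited not_le_mc by blast+
qed

end

section \<open>Assembly of both parts\<close>

lemma incomparable_trees_exist:
  assumes "\<And>i. i < 2 \<Longrightarrow> computable_tree (T i)" "\<And>i. i < 2 \<Longrightarrow> paths (T i) = avoiding_class i"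
  shows "\<exists>u. incomparable_trees T u"
proof -
  obtain u where u: "\<And>i. i < 2 \<Longrightarrow> u i \<in> avoiding_class i \<and>
      (\<forall>c y. y \<in> avoiding_class (1 - i) \<longrightarrow> \<not> (\<forall>q. run (u i) c q = Some (y q)))"
    using avoiding_class_incomparable by metis
  have "incomparable_trees T u"
  proof
    fix i :: nat assume i: "i < 2"
    then have "1 - i < 2" by arith
    then show "\<not> (\<forall>n. run (u i) c n = Some (y n))" if "y \<in> paths (T (1 - i))" for c y
      using u[OF i] that by (simp add: assms(2))
    show "u i \<in> paths (T i)" using u[OF i] by (simp add: assms(2)[OF i])
  qed (rule assms(1))
  then show ?thesis by blast
qed

theorem corollary12:
  shows "(\<forall>T. tree_assignment T \<longrightarrow>
            (\<exists>d e. less_mc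
               (disjunction_omega (Pi01_index d) (T d) (Pi01_index e) (T e))
               (commutative_concatenation (Pi01_index d) (T d) (Pi01_index e) (T e))))
       \<and> (\<exists>P Q. Pi01 P \<and> Pi01 Q \<and> equiv_err P Q \<and> less_mc P Q)"
proof -
  \<comment> \<open>The indices are fixed before the trees: the two classes and their incomparable
    members do not depend on the tree assignment.\<close>
  obtain d where d: "\<And>i. Pi01_index (d i) = avoiding_class i" using Pi01_avoiding_class unfolding Pi01_def by metis
  have "\<exists>d e. less_mc (disjunction_omega (Pi01_index d) (T d) (Pi01_index e) (T e))
      (commutative_concatenation (Pi01_index d) (T d) (Pi01_index e) (T e))" if T: "tree_assignment T" for T
  proof -
    obtain u where "incomparable_trees (\<lambda>i. T (d i)) u"
      using incomparable_trees_exist[of "\<lambda>i. T (d i)"] T d unfolding tree_assignment_def by auto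
    from incomparable_trees.less_mc_disj_conc[OF this] show ?thesis
      using T unfolding tree_assignment_def by (intro exI[of _ "d 0"] exI[of _ "d 1"]) simp
  qed
  moreover obtain u where u: "incomparable_trees (\<lambda>i. halting_tree (d i)) u"
    using incomparable_trees_exist[of "\<lambda>i. halting_tree (d i)"]
    by (auto simp: computable_tree_halting_tree paths_halting_tree d)
  \<comment> \<open>\<open>P\<close> is the set of limited interleavings and \<open>Q\<close> the
    coproduct of the two classes.\<close>
  then have "\<exists>P Q. Pi01 P \<and> Pi01 Q \<and> equiv_err P Q \<and> less_mc P Q"
    using incomparable_trees.limited_equiv_err_less_mc[OF u]
      Pi01_limited Pi01_coproduct computable_tree_halting_tree by blast
  ultimately show ?thesis by blast
qed

end
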